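(* There is a function $\varepsilon:\mathbb N\to[0,\infty)$ with $\varepsilon(s)\to 0$ as $s\to\infty$ such that the following holds. Let $k\ge 3$ and $s\ge 1$ be integers and let $n$ be an integer satisfying either $n\ge (s+\max\{25,2s+2\})k$ or $n\ge (2+\varepsilon(s))sk$. Then for every family $\mathcal G\subset\binom{[n]}{k}$ with $\nu(\mathcal G)=s<\tau(\mathcal G)$ we have $|\mathcal G|\le |\mathcal H^{(k)}(n,s)|$, that is, $$|\mathcal G|\le \binom{n}{k}-\binom{n-s}{k}+1-\binom{n-s-k}{k-1}.$$
   Context: $\binom{[n]}{k}$ is the family of $k$-element subsets of $[n]=\{1,\ldots,n\}$. For a family $\mathcal F$, $\nu(\mathcal F)$ is the maximum number of pairwise disjoint members of $\mathcal F$, and $\tau(\mathcal F)$ is the minimum $|T|$ over $T\subset[n]$ with $T\cap F\neq\emptyset$ for all $F\in\mathcal F$. $[a,b]=\{a,a+1,\ldots,b\}$. The family $\mathcal H^{(k)}(n,s)$ consists of all $H\in\binom{[n]}{k}$ with $H\cap[s]\ne\emptyset$, together with the set $[s+1,s+k]$, minus all $H\in\binom{[n]}{k}$ with $H\cap[s]=\{s\}$ and $H\cap[s+1,s+k]=\emptyset$; its size equals $\binom nk-\binom{n-s}{k}+1-\binom{n-s-k}{k-1}$. *)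

theory Defs
  imports Complex_Main "HOL-Library.Ramsey"
begin

definition matching_number :: "nat set set \<Rightarrow> nat" where
  "matching_number F = Max {card M | M. M \<subseteq> F \<and> finite M \<and> pairwise disjnt M}"

(* Only meaningful when the empty set is not in F and every member of F is a subset of {1..n}:
   then {1..n} itself is a cover and the minimum is attained. *)
definition covering_number :: "nat \<Rightarrow> nat set set \<Rightarrow> nat" where
  "covering_number n F = (LEAST t. \<exists>T \<subseteq> {1..n}. card T = t \<and> (\<forall>A\<in>F. T \<inter> A \<noteq> {}))"

definition HM_family :: "nat \<Rightarrow> nat \<Rightarrow> nat \<Rightarrow> nat set set" where
  "HM_family k n s =
     ({H \<in> nsets {1..n} k. H \<inter> {1..s} \<noteq> {}} \<union> {{s+1..s+k}})
     - {H \<in> nsets {1..n} k. H \<inter> {1..s} = {s} \<and> H \<inter> {s+1..s+k} = {}}"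

end

theory Submission
  imports Defs "HOL-Combinatorics.Permutations"
begin

text \<open>
  Shift \<open>G\<close> until it is shifted or the next shift would create a cover of size \<open>s\<close>; in the latter
  case \<open>G\<close> has a cover of size \<open>s + 1\<close>. Either way there are \<open>s + 1\<close> points whose links, on the
  remaining \<open>m = n - s - 1\<close> points, have no disjoint transversal and can be made into a chain
  \<open>H\<^sub>0 \<subseteq> \<dots> \<subseteq> H\<^sub>s\<close> of families of \<open>l\<close>-sets, \<open>l = k - 1\<close>, with \<open>H\<^sub>0\<close> shifted and non-empty. The members
  of \<open>G\<close> avoiding all \<open>s + 1\<close> points form a family \<open>\<G>\<close> whose shadow lies in \<open>H\<^sub>0\<close>, so that
  \<open>\<bar>\<G>\<bar> \<le> (r l - 1) / (l + 1) \<sqdot> \<bar>H\<^sub>0\<bar>\<close> where \<open>r\<close> is the matching number of \<open>H\<^sub>0\<close>. It remains to show that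
  the number of sets missing from \<open>H\<^sub>1, \<dots>, H\<^sub>s\<close> is at least
  \<open>C - 1 + \<bar>H\<^sub>0\<bar> + \<bar>\<G>\<bar>\<close> with \<open>C = binom (m - l) l\<close>.

  Whenever a matching contains \<open>X\<close> members of \<open>H\<^sub>0\<close>, Hall's condition fails for some \<open>j \<ge> X\<close>, and all
  but at most \<open>j\<close> blocks are missing from each of \<open>H\<^sub>1, \<dots>, H\<^sub>j\<close>. Averaging over
  random matchings gives two kinds of bounds. Uniform matchings with \<open>t = m div l\<close> blocks give about
  \<open>(t - 1) \<bar>H\<^sub>0\<bar>\<close> missing sets, because disjoint sets are negatively correlated with respect to shifted families; this
  settles the case of large \<open>H\<^sub>0\<close>. Weighted matchings through prescribed members of \<open>H\<^sub>0\<close> give \<open>C\<close>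
  times a factor exceeding 1 by a definite amount; this settles the case of small \<open>H\<^sub>0\<close>.
\<close>

section \<open>Averages over random disjoint sets\<close>

text \<open>In the extremal family \<open>H 0\<close> is a single set, \<open>\<G>\<close> is empty
  and exactly \<open>C\<close> sets are missing, so at \<open>card (H 0) = 1\<close> nothing may be
  lost. Write f for \<open>card (H 0)\<close> and S for the number of missing sets. Since f +
  \<open>card \<G>\<close> <= (r + 1) f, a counterexample has S < C + (r + 1) f. The bound S >= (t -
  r) f forces (t - 2 r - 1) f < C, so \<open>H 0\<close> is sparse; negative correlation then
  improves the bound to nearly (t - 1) f, whence roughly (t - r - 2) f < C. Conversely S >= C (1 +
  g) forces C g < (r + 1) f. These conflict once g is about (r + 1) / (t - r - 2). This ratio
  dictates the gains: near 1/2 when t is about 3 s, covered by 5/8, and close to 1 when t is about 2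
  s, where four disjoint members are used. The term 2 s + 2 in the hypothesis gives t >= 3 s + 2,
  and 25 takes care of small r. The correction of order sqrt(s) in the other hypothesis keeps t - 2
  s large enough to absorb the density loss of about 2 s / (t - 2 s).\<close>

lemma card_nsets: "finite A \<Longrightarrow> card (nsets A k) = card A choose k"
  by (simp add: nsets_def n_subsets finite_subset cong: conj_cong)

lemma card_nsets_Diff:
  assumes "finite V" "F \<subseteq> nsets V k"
  shows "real (card (nsets V k - F)) = real (card V choose k) - real (card F)"
proof -
  have fin: "finite (nsets V k)" using assms(1) by (rule finite_imp_finite_nsets)
  then have "card (nsets V k - F) = card (nsets V k) - card F" "card F \<le> card (nsets V k)"
    using card_Diff_subset[OF finite_subset[OF assms(2) fin] assms(2)] card_mono[OF fin assms(2)] by simp_all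
  then show ?thesis using assms(1) by (simp add: card_nsets of_nat_diff del: binomial_Suc_Suc)
qed

text \<open>When \<open>X i\<close> is reached, at most i points are taken. This greedy choice
  serves in place of Hall's theorem, because along a chain of families it suffices that sizes exceed
  indices.\<close>

lemma greedy_sdr:
  assumes "\<And>i. i < n \<Longrightarrow> finite (X i) \<and> i < card (X i)"
  shows "\<exists>a. inj_on a {..<n} \<and> (\<forall>i<n. a i \<in> X i)"
  using assms
proof (induction n)
  case 0
  then show ?case by simp
next
  case (Suc n)
  then obtain a where a: "inj_on a {..<n}" "\<forall>i<n. a i \<in> X i"
    by (meson less_Suc_eq)
  have "card (a ` {..<n}) \<le> n"
    using card_image_le[of "{..<n}" a] by simp
  then have "card (a ` {..<n}) < card (X n)"
    using Suc.prems[of n] by simp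
  then obtain y where y: "y \<in> X n" "y \<notin> a ` {..<n}"
    by (meson card_mono finite_imageI finite_lessThan linorder_not_less subsetI)
  have "inj_on (a(n := y)) {..<Suc n}"
    using a(1) y(2) by (auto simp: inj_on_def less_Suc_eq)
  moreover have "\<forall>i<Suc n. (a(n := y)) i \<in> X i"
    using a(2) y(1) by (auto simp: less_Suc_eq)
  ultimately show ?case by blast
qed

lemma permutation_mapping_pair:
  assumes "finite V" "S \<subseteq> V" "S' \<subseteq> V" "S \<inter> S' = {}" "A \<subseteq> V" "B \<subseteq> V" "A \<inter> B = {}"
    and "card A = card S" "card B = card S'"
  shows "\<exists>\<sigma>. \<sigma> permutes V \<and> \<sigma> ` S = A \<and> \<sigma> ` S' = B"
proof -
  have fin: "finite S" "finite S'" "finite A" "finite B"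
    using assms(1,2,3,5,6) by (auto intro: finite_subset)
  have "card (V - (S \<union> S')) = card (V - (A \<union> B))"
    using assms fin by (simp add: card_Diff_subset card_Un_disjoint)
  then obtain h where h: "bij_betw h (V - (S \<union> S')) (V - (A \<union> B))"
    using assms(1) finite_same_card_bij by blast
  obtain f where f: "bij_betw f S A"
    using fin assms finite_same_card_bij by metis
  obtain g where g: "bij_betw g S' B"
    using fin assms finite_same_card_bij by metis
  define \<sigma> where "\<sigma> x = (if x \<in> S then f x else if x \<in> S' then g x else if x \<in> V then h x else x)" for x
  have "bij_betw \<sigma> S A"
    using f by (rule bij_betw_cong[THEN iffD1, rotated]) (simp add: \<sigma>_def)
  moreover have "bij_betw \<sigma> S' B"
    using g by (rule bij_betw_cong[THEN iffD1, rotated]) (use assms(4) in \<open>auto simp: \<sigma>_def\<close>)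
  moreover have "bij_betw \<sigma> (V - (S \<union> S')) (V - (A \<union> B))"
    using h by (rule bij_betw_cong[THEN iffD1, rotated]) (auto simp: \<sigma>_def)
  ultimately have b: "bij_betw \<sigma> S A" "bij_betw \<sigma> S' B"
    "bij_betw \<sigma> (V - (S \<union> S')) (V - (A \<union> B))" by auto
  have "bij_betw \<sigma> (S \<union> S') (A \<union> B)"
    using b assms by (intro bij_betw_combine) auto
  then have "bij_betw \<sigma> ((S \<union> S') \<union> (V - (S \<union> S'))) ((A \<union> B) \<union> (V - (A \<union> B)))"
    using b(3) by (rule bij_betw_combine) auto
  moreover have "(S \<union> S') \<union> (V - (S \<union> S')) = V" "(A \<union> B) \<union> (V - (A \<union> B)) = V"
    using assms by auto
  ultimately have "bij_betw \<sigma> V V" by simp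
  moreover have "\<sigma> x = x" if "x \<notin> V" for x
    using that assms by (auto simp: \<sigma>_def)
  ultimately have "\<sigma> permutes V"
    by (rule bij_imp_permutes)
  then show ?thesis
    using b by (auto simp: bij_betw_def)
qed

text \<open>The map from a permutation to the images of \<open>S\<close> and \<open>S'\<close> has
  fibres of equal size over \<open>X\<close>, each a coset of the stabiliser of the pair. The
  identity is kept multiplied out, so no denominator has to be nonzero.\<close>

lemma sum_over_permutations_pair:
  fixes g :: "'a set \<Rightarrow> 'a set \<Rightarrow> real"
  assumes V: "finite V" and S: "S \<subseteq> V" "S' \<subseteq> V" "S \<inter> S' = {}"
  defines "X \<equiv> {(A, B). A \<in> nsets V (card S) \<and> B \<in> nsets V (card S') \<and> A \<inter> B = {}}"
  shows "card X * (\<Sum>\<pi> | \<pi> permutes V. g (\<pi> ` S) (\<pi> ` S'))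
           = card {\<pi>. \<pi> permutes V} * (\<Sum>(A, B)\<in>X. g A B)"
proof -
  let ?P = "{\<pi>. \<pi> permutes V}"
  let ?f = "\<lambda>\<pi>::'a\<Rightarrow>'a. (\<pi> ` S, \<pi> ` S')"
  define c where "c = card {\<pi> \<in> ?P. ?f \<pi> = (S, S')}"
  have finP: "finite ?P" using V by (rule finite_permutations)
  have finX: "finite X"
    by (rule finite_subset[of _ "nsets V (card S) \<times> nsets V (card S')"])
       (auto simp: X_def intro: finite_imp_finite_nsets V)
  have fS: "finite S" "finite S'" using V S by (auto intro: finite_subset)
  have maps: "?f ` ?P \<subseteq> X"
  proof (clarsimp simp: X_def)
    fix \<pi> assume p: "\<pi> permutes V"
    have inj: "inj \<pi>" using p by (rule permutes_inj)
    have "\<pi> ` S \<subseteq> V" "\<pi> ` S' \<subseteq> V"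
      using permutes_image[OF p] S by blast+
    moreover have "card (\<pi> ` S) = card S" "card (\<pi> ` S') = card S'"
      using inj by (auto intro: card_image inj_on_subset)
    moreover have "\<pi> ` S \<inter> \<pi> ` S' = {}"
      using inj S(3) by (metis image_Int image_empty)
    ultimately show "\<pi> ` S \<in> nsets V (card S) \<and> \<pi> ` S' \<in> nsets V (card S') \<and> \<pi> ` S \<inter> \<pi> ` S' = {}"
      using fS by (auto simp: nsets_def)
  qed
  have fibre: "card {\<pi> \<in> ?P. ?f \<pi> = x} = c" if "x \<in> X" for x
  proof -
    obtain A B where x: "x = (A, B)" by (cases x)
    have AB: "A \<subseteq> V" "B \<subseteq> V" "A \<inter> B = {}" "card A = card S" "card B = card S'"
      using that x by (auto simp: X_def nsets_def)
    obtain \<sigma> where s: "\<sigma> permutes V" "\<sigma> ` S = A" "\<sigma> ` S' = B"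
      using permutation_mapping_pair[OF V S AB] by blast
    have i: "inv \<sigma> ` A = S" "inv \<sigma> ` B = S'"
      using s permutes_inj[OF s(1)] by (auto simp: image_inv_f_f)
    have "bij_betw (\<lambda>\<pi>. \<sigma> \<circ> \<pi>) {\<pi> \<in> ?P. ?f \<pi> = (S, S')} {\<pi> \<in> ?P. ?f \<pi> = x}"
    proof (rule bij_betw_byWitness[where f' = "\<lambda>\<pi>. inv \<sigma> \<circ> \<pi>"])
      show "\<forall>\<pi>\<in>{\<pi> \<in> ?P. ?f \<pi> = (S, S')}. inv \<sigma> \<circ> (\<sigma> \<circ> \<pi>) = \<pi>"
        using permutes_inv_o(2)[OF s(1)] by (simp add: comp_assoc[symmetric])
      show "\<forall>\<pi>\<in>{\<pi> \<in> ?P. ?f \<pi> = x}. \<sigma> \<circ> (inv \<sigma> \<circ> \<pi>) = \<pi>"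
        using permutes_inv_o(1)[OF s(1)] by (simp add: comp_assoc[symmetric])
      show "(\<lambda>\<pi>. \<sigma> \<circ> \<pi>) ` {\<pi> \<in> ?P. ?f \<pi> = (S, S')} \<subseteq> {\<pi> \<in> ?P. ?f \<pi> = x}"
      proof
        fix \<rho> assume "\<rho> \<in> (\<lambda>\<pi>. \<sigma> \<circ> \<pi>) ` {\<pi> \<in> ?P. ?f \<pi> = (S, S')}"
        then obtain \<pi> where "\<rho> = \<sigma> \<circ> \<pi>" "\<pi> permutes V" "\<pi> ` S = S" "\<pi> ` S' = S'"
          by auto
        then show "\<rho> \<in> {\<pi> \<in> ?P. ?f \<pi> = x}"
          using s x permutes_compose[of \<pi> V \<sigma>]
          by (simp only: image_comp[symmetric] mem_Collect_eq)
      qed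
      show "(\<lambda>\<pi>. inv \<sigma> \<circ> \<pi>) ` {\<pi> \<in> ?P. ?f \<pi> = x} \<subseteq> {\<pi> \<in> ?P. ?f \<pi> = (S, S')}"
      proof
        fix \<rho> assume "\<rho> \<in> (\<lambda>\<pi>. inv \<sigma> \<circ> \<pi>) ` {\<pi> \<in> ?P. ?f \<pi> = x}"
        then obtain \<pi> where "\<rho> = inv \<sigma> \<circ> \<pi>" "\<pi> permutes V" "\<pi> ` S = A" "\<pi> ` S' = B"
          using x by auto
        then show "\<rho> \<in> {\<pi> \<in> ?P. ?f \<pi> = (S, S')}"
          using i permutes_inv[OF s(1)] permutes_compose[of \<pi> V "inv \<sigma>"]
          by (simp only: image_comp[symmetric] mem_Collect_eq)
      qed
    qed
    then show ?thesis unfolding c_def by (simp add: bij_betw_same_card)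
  qed
  have "(\<Sum>\<pi>\<in>?P. g (\<pi> ` S) (\<pi> ` S')) = (\<Sum>\<pi>\<in>?P. (case ?f \<pi> of (A, B) \<Rightarrow> g A B))"
    by simp
  also have "\<dots> = (\<Sum>x\<in>X. \<Sum>\<pi> | \<pi> \<in> ?P \<and> ?f \<pi> = x. (case ?f \<pi> of (A, B) \<Rightarrow> g A B))"
    by (rule sum.group[symmetric]) (use finP finX maps in auto)
  also have "\<dots> = (\<Sum>x\<in>X. real c * (case x of (A, B) \<Rightarrow> g A B))"
  proof (rule sum.cong[OF refl])
    fix x assume x: "x \<in> X"
    have "(\<Sum>\<pi> | \<pi> \<in> ?P \<and> ?f \<pi> = x. (case ?f \<pi> of (A, B) \<Rightarrow> g A B))
        = (\<Sum>\<pi> | \<pi> \<in> ?P \<and> ?f \<pi> = x. (case x of (A, B) \<Rightarrow> g A B))"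
      by (rule sum.cong) auto
    then show "(\<Sum>\<pi> | \<pi> \<in> ?P \<and> ?f \<pi> = x. (case ?f \<pi> of (A, B) \<Rightarrow> g A B)) = real c * (case x of (A, B) \<Rightarrow> g A B)"
      using fibre[OF x] by simp
  qed
  finally have 1: "(\<Sum>\<pi>\<in>?P. g (\<pi> ` S) (\<pi> ` S')) = real c * (\<Sum>(A, B)\<in>X. g A B)"
    by (simp add: sum_distrib_left)
  have "card ?P = (\<Sum>x\<in>X. card {\<pi> \<in> ?P. ?f \<pi> = x})"
    using sum.group[OF finP finX maps, of "\<lambda>_. 1::nat"] by simp
  also have "\<dots> = card X * c" using fibre by simp
  finally show ?thesis using 1 by simp
qed

lemma sum_over_permutations:
  fixes g :: "'a set \<Rightarrow> real"
  assumes V: "finite V" and S: "S \<subseteq> V"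
  shows "real (card V choose card S) * (\<Sum>\<pi> | \<pi> permutes V. g (\<pi> ` S))
           = card {\<pi>. \<pi> permutes V} * (\<Sum>A\<in>nsets V (card S). g A)"
proof -
  have *: "{(A, B). A \<in> nsets V (card S) \<and> B \<in> nsets V (card ({}::'a set)) \<and> A \<inter> B = {}}
      = (\<lambda>A. (A, {})) ` nsets V (card S)"
    by (auto simp: nsets_def)
  have inj: "inj_on (\<lambda>A. (A, {}::'a set)) Y" for Y :: "'a set set" by (auto simp: inj_on_def)
  show ?thesis
    using sum_over_permutations_pair[OF V S, of "{}" "\<lambda>A B. g A"]
    unfolding * by (simp add: card_image[OF inj] sum.reindex[OF inj] card_nsets[OF V])
qed

lemma exists_disjoint_subsets:
  assumes "finite I" "finite V" "(\<Sum>i\<in>I. d i) \<le> card V"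
  shows "\<exists>S. disjoint_family_on S I \<and> (\<forall>i\<in>I. S i \<subseteq> V \<and> card (S i) = d i)"
  using assms
proof (induction I arbitrary: V rule: finite_induct)
  case empty
  then show ?case by (simp add: disjoint_family_on_def)
next
  case (insert j I)
  have le: "d j \<le> card V" using insert by simp
  obtain T where T: "T \<subseteq> V" "card T = d j"
    using obtain_subset_with_card_n[OF le] by blast
  have "(\<Sum>i\<in>I. d i) \<le> card (V - T)"
    using insert T by (simp add: card_Diff_subset finite_subset)
  then obtain S where S: "disjoint_family_on S I" "\<forall>i\<in>I. S i \<subseteq> V - T \<and> card (S i) = d i"
    using insert.IH[of "V - T"] insert.prems by auto
  have "disjoint_family_on (S(j := T)) (insert j I)"
    using S insert.hyps by (auto simp: disjoint_family_on_def)
  moreover have "\<forall>i\<in>insert j I. (S(j := T)) i \<subseteq> V \<and> card ((S(j := T)) i) = d i"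
    using S T insert.hyps by auto
  ultimately show ?case by blast
qed

lemma disjoint_family_on_image_permutes:
  assumes "disjoint_family_on S I" "\<pi> permutes V"
  shows "disjoint_family_on (\<lambda>i. \<pi> ` S i) I"
  using assms permutes_inj[OF assms(2)]
  unfolding disjoint_family_on_def by (metis image_Int image_empty)

text \<open>Linearity of expectation for the images of one fixed disjoint family under a random
  permutation: each block contributes its own mean. Block sizes may differ, which the swap argument
  uses for one block with a point fewer.\<close>

lemma average_over_disjoint_families:
  fixes g :: "'i \<Rightarrow> 'a set \<Rightarrow> real"
  assumes I: "finite I" and V: "finite V" and d: "(\<Sum>i\<in>I. d i) \<le> card V"
    and bound: "\<And>B. disjoint_family_on B I \<Longrightarrow> (\<And>i. i \<in> I \<Longrightarrow> B i \<in> nsets V (d i)) \<Longrightarrow> c \<le> (\<Sum>i\<in>I. g i (B i))"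
  shows "c \<le> (\<Sum>i\<in>I. (\<Sum>A\<in>nsets V (d i). g i A) / real (card V choose d i))"
proof -
  let ?P = "{\<pi>. \<pi> permutes V}"
  obtain S where S: "disjoint_family_on S I" "\<And>i. i \<in> I \<Longrightarrow> S i \<subseteq> V \<and> card (S i) = d i"
    using exists_disjoint_subsets[OF I V d] by blast
  have finP: "finite ?P" using V by (rule finite_permutations)
  have P: "0 < card ?P" using finP permutes_id[of V] by (metis card_gt_0_iff empty_iff mem_Collect_eq)
  have "real (card ?P) * c = (\<Sum>\<pi>\<in>?P. c)" by simp
  also have "\<dots> \<le> (\<Sum>\<pi>\<in>?P. \<Sum>i\<in>I. g i (\<pi> ` S i))"
  proof (rule sum_mono)
    fix \<pi> assume "\<pi> \<in> ?P"
    then have p: "\<pi> permutes V" by simp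
    show "c \<le> (\<Sum>i\<in>I. g i (\<pi> ` S i))"
    proof (rule bound)
      show "disjoint_family_on (\<lambda>i. \<pi> ` S i) I"
        using S(1) p by (rule disjoint_family_on_image_permutes)
      show "\<pi> ` S i \<in> nsets V (d i)" if "i \<in> I" for i
        using S(2)[OF that] permutes_image[OF p] permutes_inj[OF p] V
        by (auto simp: nsets_def card_image inj_on_subset finite_subset)
    qed
  qed
  also have "\<dots> = (\<Sum>i\<in>I. \<Sum>\<pi>\<in>?P. g i (\<pi> ` S i))" by (rule sum.swap)
  also have "\<dots> = (\<Sum>i\<in>I. real (card ?P) * ((\<Sum>A\<in>nsets V (d i). g i A) / real (card V choose d i)))"
  proof (rule sum.cong[OF refl])
    fix i assume i: "i \<in> I"
    have "d i \<le> card V" using S(2)[OF i] V card_mono by metis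
    then have "0 < card V choose d i" by simp
    then show "(\<Sum>\<pi>\<in>?P. g i (\<pi> ` S i)) = real (card ?P) * ((\<Sum>A\<in>nsets V (d i). g i A) / real (card V choose d i))"
      using sum_over_permutations[OF V, of "S i" "g i"] S(2)[OF i] by (simp add: field_simps)
  qed
  finally have "real (card ?P) * c \<le> real (card ?P) * (\<Sum>i\<in>I. (\<Sum>A\<in>nsets V (d i). g i A) / real (card V choose d i))"
    by (simp add: sum_distrib_left)
  then show ?thesis using P by simp
qed

section \<open>Shifted families\<close>

definition shifted :: "nat \<Rightarrow> nat set set \<Rightarrow> bool" where
  "shifted m F \<longleftrightarrow>
     (\<forall>A\<in>F. \<forall>x y. 1 \<le> x \<longrightarrow> x < y \<longrightarrow> y \<le> m \<longrightarrow> y \<in> A \<longrightarrow> x \<notin> A \<longrightarrow> insert x (A - {y}) \<in> F)"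

lemma shiftedD:
  "shifted m F \<Longrightarrow> A \<in> F \<Longrightarrow> 1 \<le> x \<Longrightarrow> x < y \<Longrightarrow> y \<le> m \<Longrightarrow> y \<in> A \<Longrightarrow> x \<notin> A \<Longrightarrow> insert x (A - {y}) \<in> F"
  by (auto simp: shifted_def)

text \<open>The prefix condition says that the j-th smallest element of \<open>C\<close> is at most
  that of \<open>A\<close>, for every j. Exchanging the least element of \<open>A - C\<close> for
  the least element of \<open>C - A\<close> is then a shift; it keeps the condition and brings
  \<open>A\<close> closer to \<open>C\<close>.\<close>

lemma shifted_dominates:
  assumes "shifted m F" "F \<subseteq> nsets {1..m} a" "A \<in> F" "C \<in> nsets {1..m} a"
    and "\<And>i. card (A \<inter> {1..i}) \<le> card (C \<inter> {1..i})"
  shows "C \<in> F"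
  using assms(3,5)
proof (induction "card (A - C)" arbitrary: A rule: less_induct)
  case less
  have A: "A \<subseteq> {1..m}" "finite A" "card A = a"
    using less.prems(1) assms(2) by (auto simp: nsets_def)
  have C: "C \<subseteq> {1..m}" "finite C" "card C = a"
    using assms(4) by (auto simp: nsets_def)
  show ?case
  proof (cases "A - C = {}")
    case True
    then have "A = C" using A C by (metis Diff_eq_empty_iff card_subset_eq)
    then show ?thesis using less by simp
  next
    case False
    define y where "y = Min (A - C)"
    have y: "y \<in> A" "y \<notin> C" "\<And>z. z \<in> A \<Longrightarrow> z < y \<Longrightarrow> z \<in> C"
      using Min_in[of "A - C"] False A Min_le[of "A - C"] unfolding y_def by force+
    have "C - A \<noteq> {}"
    proof
      assume "C - A = {}"
      then have "C = A" using A C by (metis Diff_eq_empty_iff card_subset_eq)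
      then show False using False by simp
    qed
    define x where "x = Min (C - A)"
    have x: "x \<in> C" "x \<notin> A" "\<And>z. z \<in> C \<Longrightarrow> z < x \<Longrightarrow> z \<in> A"
      using Min_in[of "C - A"] \<open>C - A \<noteq> {}\<close> C Min_le[of "C - A"] unfolding x_def by force+
    have xy: "x < y"
    proof (rule ccontr)
      assume "\<not> x < y"
      then have "y < x" using x y by (metis linorder_neqE_nat)
      then have "C \<inter> {1..y} \<subseteq> A \<inter> {1..y} - {y}"
        using x y by force
      then have "card (C \<inter> {1..y}) \<le> card (A \<inter> {1..y} - {y})"
        using A by (intro card_mono) auto
      also have "\<dots> < card (A \<inter> {1..y})"
        using A y(1) by (intro card_Diff1_less) auto
      finally show False using less.prems(2)[of y] by simp
    qed
    define A' where "A' = insert x (A - {y})"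
    have "A' \<in> F"
      unfolding A'_def using assms(1) less.prems(1) xy x y A C
      by (intro shiftedD) auto
    moreover have "card (A' - C) < card (A - C)"
    proof -
      have "A' - C = (A - C) - {y}" using x by (auto simp: A'_def)
      then show ?thesis using A y card_Diff1_less[of "A - C" y] by auto
    qed
    moreover have "card (A' \<inter> {1..i}) \<le> card (C \<inter> {1..i})" for i
    proof -
      consider "i < x" | "x \<le> i" "i < y" | "y \<le> i" by linarith
      then show ?thesis
      proof cases
        case 1
        then have "A' \<inter> {1..i} = A \<inter> {1..i}" using xy by (auto simp: A'_def)
        then show ?thesis using less.prems(2) by simp
      next
        case 2
        then have "A' \<inter> {1..i} \<subseteq> C \<inter> {1..i}" using x y by (auto simp: A'_def)
        then show ?thesis using C by (intro card_mono) auto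
      next
        case 3
        have "1 \<le> x" using x C by auto
        then have "A' \<inter> {1..i} = insert x ((A \<inter> {1..i}) - {y})" using 3 xy by (auto simp: A'_def)
        then have "card (A' \<inter> {1..i}) = card (A \<inter> {1..i})"
          using A x y 3 xy \<open>1 \<le> x\<close> by (simp add: card_Suc_Diff1 del: card_Diff_insert card_Diff_singleton)
        then show ?thesis using less.prems(2) by simp
      qed
    qed
    ultimately show ?thesis using less.hyps by blast
  qed
qed

lemma shifted_initial_segment:
  assumes "shifted m F" "F \<subseteq> nsets {1..m} a" "F \<noteq> {}"
  shows "{1..a} \<in> F"
proof -
  obtain A where A: "A \<in> F" using assms by blast
  then have A': "A \<subseteq> {1..m}" "finite A" "card A = a" using assms by (auto simp: nsets_def)
  then have "a \<le> m" using card_mono[of "{1..m}" A] by simp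
  show ?thesis
  proof (rule shifted_dominates[OF assms(1,2) A])
    show "{1..a} \<in> nsets {1..m} a" using \<open>a \<le> m\<close> by (auto simp: nsets_def)
    fix i
    have "card (A \<inter> {1..i}) \<le> a" using A' card_mono[of A "A \<inter> {1..i}"] by auto
    moreover have "card (A \<inter> {1..i}) \<le> i" using card_mono[of "{1..i}" "A \<inter> {1..i}"] by auto
    moreover have "{1..a} \<inter> {1..i} = {1..min a i}" by auto
    ultimately show "card (A \<inter> {1..i}) \<le> card ({1..a} \<inter> {1..i})" by simp
  qed
qed

text \<open>The local LYM inequality in the upward direction: pairs (A, x) with x outside A inject
  into pairs (B, x) with x inside B.\<close>

lemma upper_shadow_double_counting:
  assumes V: "finite V" and sub: "\<A> \<subseteq> nsets V a" "\<B> \<subseteq> nsets V (Suc a)"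
    and up: "\<And>A x. A \<in> \<A> \<Longrightarrow> x \<in> V - A \<Longrightarrow> insert x A \<in> \<B>"
  shows "card \<A> * (card V - a) \<le> card \<B> * Suc a"
proof -
  have fin: "finite \<A>" "finite \<B>"
    using finite_subset[OF sub(1)] finite_subset[OF sub(2)] finite_imp_finite_nsets[OF V] by auto
  have "card (SIGMA A:\<A>. V - A) \<le> card (SIGMA B:\<B>. B)"
  proof (rule card_inj_on_le)
    show "inj_on (\<lambda>(A, x). (insert x A, x)) (SIGMA A:\<A>. V - A)"
      unfolding inj_on_def by (auto simp: insert_ident)
    show "(\<lambda>(A, x). (insert x A, x)) ` (SIGMA A:\<A>. V - A) \<subseteq> (SIGMA B:\<B>. B)"
      using up by auto
    show "finite (SIGMA B:\<B>. B)"
      using fin sub by (auto simp: nsets_def)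
  qed
  moreover have "card (SIGMA A:\<A>. V - A) = (\<Sum>A\<in>\<A>. card (V - A))"
    using fin V by (intro card_SigmaI) auto
  moreover have "\<dots> = (\<Sum>A\<in>\<A>. card V - a)"
    using sub by (intro sum.cong) (auto simp: nsets_def card_Diff_subset)
  moreover have "card (SIGMA B:\<B>. B) = (\<Sum>B\<in>\<B>. card B)"
    using fin sub by (intro card_SigmaI) (auto simp: nsets_def)
  moreover have "\<dots> = (\<Sum>B\<in>\<B>. Suc a)"
    using sub by (intro sum.cong) (auto simp: nsets_def)
  ultimately show ?thesis by simp
qed

text \<open>Prepares induction on the size of the ground set. Shifting the last point away puts the
  upper shadow of the link \<open>F1\<close> inside the deletion \<open>F0\<close>, so
  \<open>F1\<close> is at most as dense in its layer as \<open>F0\<close>. This monotonicity is the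
  source of negative correlation.\<close>

lemma shifted_split_last:
  assumes "shifted (Suc m) F" "F \<subseteq> nsets {1..Suc m} (Suc a)" "a < m"
  defines "F0 \<equiv> {A \<in> F. Suc m \<notin> A}" and "F1 \<equiv> {A. Suc m \<notin> A \<and> insert (Suc m) A \<in> F}"
  shows "shifted m F0" "shifted m F1" "F0 \<subseteq> nsets {1..m} (Suc a)" "F1 \<subseteq> nsets {1..m} a"
    "card F = card F0 + card F1" "card F1 * (m choose Suc a) \<le> card F0 * (m choose a)"
proof -
  show "shifted m F0"
    using assms(1) by (auto simp: shifted_def F0_def)
  show "shifted m F1"
    unfolding shifted_def
  proof (intro ballI allI impI)
    fix A x y assume A: "A \<in> F1" and xy: "1 \<le> x" "x < y" "y \<le> m" "y \<in> A" "x \<notin> A"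
    have "insert x (insert (Suc m) A - {y}) \<in> F"
      using A xy by (intro shiftedD[OF assms(1)]) (auto simp: F1_def)
    moreover have "insert x (insert (Suc m) A - {y}) = insert (Suc m) (insert x (A - {y}))"
      using xy by auto
    ultimately show "insert x (A - {y}) \<in> F1"
      using A xy by (auto simp: F1_def)
  qed
  show F0: "F0 \<subseteq> nsets {1..m} (Suc a)"
    using assms(2) by (fastforce simp: F0_def nsets_def le_Suc_eq)
  show F1: "F1 \<subseteq> nsets {1..m} a"
  proof
    fix A assume "A \<in> F1"
    then have A: "Suc m \<notin> A" "insert (Suc m) A \<in> nsets {1..Suc m} (Suc a)"
      using assms(2) by (auto simp: F1_def)
    then have "A \<subseteq> {1..m}" by (force simp: nsets_def le_Suc_eq)
    then show "A \<in> nsets {1..m} a" using A by (auto simp: nsets_def)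
  qed
  have fin: "finite F" using assms(2) finite_subset finite_imp_finite_nsets by blast
  have inj: "inj_on (insert (Suc m)) F1"
    unfolding inj_on_def F1_def by (metis (no_types, lifting) insert_ident mem_Collect_eq)
  have "F = F0 \<union> insert (Suc m) ` F1"
  proof (intro equalityI subsetI)
    fix A assume A: "A \<in> F"
    show "A \<in> F0 \<union> insert (Suc m) ` F1"
    proof (cases "Suc m \<in> A")
      case True
      then have "A = insert (Suc m) (A - {Suc m})" by auto
      then show ?thesis using A True by (auto simp: F1_def intro!: image_eqI[of _ _ "A - {Suc m}"])
    qed (use A in \<open>auto simp: F0_def\<close>)
  qed (auto simp: F0_def F1_def)
  moreover have "F0 \<inter> insert (Suc m) ` F1 = {}" by (auto simp: F0_def)
  ultimately show "card F = card F0 + card F1"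
    using fin card_image[OF inj] by (metis card_Un_disjoint finite_Un)
  have "card F1 * (m - a) \<le> card F0 * Suc a"
  proof -
    have "card F1 * (card {1..m} - a) \<le> card F0 * Suc a"
    proof (rule upper_shadow_double_counting[OF _ F1 F0])
      fix A x assume A: "A \<in> F1" and x: "x \<in> {1..m} - A"
      have "insert x (insert (Suc m) A - {Suc m}) \<in> F"
        using A x by (intro shiftedD[OF assms(1)]) (auto simp: F1_def)
      moreover have "insert x (insert (Suc m) A - {Suc m}) = insert x A" using A by (auto simp: F1_def)
      ultimately show "insert x A \<in> F0" using A x by (auto simp: F0_def F1_def)
    qed simp
    then show ?thesis by simp
  qed
  then have "card F1 * (m - a) * (m choose a) \<le> card F0 * Suc a * (m choose a)"
    by (rule mult_right_mono) simp
  moreover have "(m - a) * (m choose a) = Suc a * (m choose Suc a)"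
    using binomial_absorb_comp[of m a] binomial_absorption[of a m] by simp
  ultimately have "Suc a * (card F1 * (m choose Suc a)) \<le> Suc a * (card F0 * (m choose a))"
    by (metis (no_types, lifting) mult.assoc mult.left_commute)
  then show "card F1 * (m choose Suc a) \<le> card F0 * (m choose a)"
    by (simp del: mult_Suc)
qed

lemma disjoint_pairs_bound_trivial:
  assumes "F \<subseteq> nsets {1..m} a" "F' \<subseteq> nsets {1..m} b" "a = 0 \<or> b = 0 \<or> m < a + b"
  shows "real (card {(A, B). A \<in> F \<and> B \<in> F' \<and> A \<inter> B = {}})
    \<le> real (m choose a) * real ((m - a) choose b) * (card F / real (m choose a)) * (card F' / real (m choose b))"
    (is "real (card ?D) \<le> _")
proof (cases "m < a + b")
  case True
  have "A \<inter> B \<noteq> {}" if "A \<in> F" "B \<in> F'" for A B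
  proof
    assume "A \<inter> B = {}"
    moreover have "A \<in> nsets {1..m} a" "B \<in> nsets {1..m} b" using that assms by auto
    ultimately have "card (A \<union> B) = a + b" "A \<union> B \<subseteq> {1..m}"
      by (auto simp: nsets_def card_Un_disjoint)
    then show False using True card_mono[of "{1..m}" "A \<union> B"] by simp
  qed
  then have "?D = {}" by blast
  then show ?thesis by (simp only: card.empty of_nat_0) simp
next
  case False
  have fin: "finite F" "finite F'"
    using finite_subset[OF assms(1)] finite_subset[OF assms(2)] finite_imp_finite_nsets by auto
  have "card ?D \<le> card (F \<times> F')"
    using fin by (intro card_mono) auto
  then have *: "real (card ?D) \<le> real (card F) * real (card F')"
    by (simp add: card_cartesian_product flip: of_nat_mult)
  have "0 < m choose a" "0 < m choose b" using False by auto
  then show ?thesis using * assms(3) False by auto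
qed

text \<open>Being shifted is a monotone property of the positions of the elements, and the positions of
  two random disjoint sets are negatively correlated.\<close>

lemma shifted_negative_correlation:
  assumes "shifted m F" "shifted m F'" "F \<subseteq> nsets {1..m} a" "F' \<subseteq> nsets {1..m} b"
  shows "real (card {(A, B). A \<in> F \<and> B \<in> F' \<and> A \<inter> B = {}})
    \<le> real (m choose a) * real ((m - a) choose b) * (card F / real (m choose a)) * (card F' / real (m choose b))"
  using assms
proof (induction m arbitrary: a b F F')
  case (0 a b F F')
  show ?case by (rule disjoint_pairs_bound_trivial) (use 0 in auto)
next
  case (Suc m a b F F')
  show ?case
  proof (cases "a = 0 \<or> b = 0 \<or> Suc m < a + b")
    case True
    then show ?thesis using Suc.prems by (intro disjoint_pairs_bound_trivial) auto
  next
    case False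
    then obtain a' b' where ab: "a = Suc a'" "b = Suc b'" by (metis not0_implies_Suc)
    have am: "a' < m" "b' < m" "a + b \<le> Suc m" using False ab by auto
    define F0 F1 where "F0 = {A \<in> F. Suc m \<notin> A}" and "F1 = {A. Suc m \<notin> A \<and> insert (Suc m) A \<in> F}"
    define G0 G1 where "G0 = {A \<in> F'. Suc m \<notin> A}" and "G1 = {A. Suc m \<notin> A \<and> insert (Suc m) A \<in> F'}"
    note F = shifted_split_last[OF Suc.prems(1) Suc.prems(3)[unfolded ab] am(1), folded F0_def F1_def ab]
    note G = shifted_split_last[OF Suc.prems(2) Suc.prems(4)[unfolded ab] am(2), folded G0_def G1_def ab]
    let ?D = "\<lambda>F G. {(A, B). A \<in> F \<and> B \<in> G \<and> A \<inter> B = ({}::nat set)}"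
    have finF: "finite F0" "finite F1" "finite G0" "finite G1"
      using F(3,4) G(3,4) finite_subset finite_imp_finite_nsets[OF finite_atLeastAtMost] by metis+
    have finD: "finite (?D X Y)" if "finite X" "finite Y" for X Y
      by (rule finite_subset[of _ "X \<times> Y"]) (use that in auto)
    let ?f = "\<lambda>(A, B::nat set). (insert (Suc m) A, B)"
    let ?g = "\<lambda>(A::nat set, B). (A, insert (Suc m) B)"
    \<comment> \<open>The last point lies in neither set or in exactly one of them; disjointness
      rules out the fourth case.\<close>
    have sub: "?D F F' \<subseteq> ?D F0 G0 \<union> ?f ` ?D F1 G0 \<union> ?g ` ?D F0 G1"
    proof (clarify)
      fix A B assume AB: "A \<in> F" "B \<in> F'" "A \<inter> B = {}"
        and *: "(A, B) \<notin> ?g ` ?D F0 G1" "(A, B) \<notin> ?f ` ?D F1 G0"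
      have "Suc m \<notin> A"
      proof
        assume "Suc m \<in> A"
        moreover from this have "insert (Suc m) (A - {Suc m}) = A" by auto
        ultimately have "(A - {Suc m}, B) \<in> ?D F1 G0" "(A, B) = ?f (A - {Suc m}, B)"
          using AB by (auto simp: F1_def G0_def)
        then show False using *(2) by blast
      qed
      moreover have "Suc m \<notin> B"
      proof
        assume "Suc m \<in> B"
        moreover from this have "insert (Suc m) (B - {Suc m}) = B" by auto
        ultimately have "(A, B - {Suc m}) \<in> ?D F0 G1" "(A, B) = ?g (A, B - {Suc m})"
          using AB by (auto simp: G1_def F0_def)
        then show False using *(1) by blast
      qed
      ultimately show "A \<in> F0 \<and> B \<in> G0 \<and> A \<inter> B = {}" using AB by (auto simp: F0_def G0_def)
    qed
    have "card (?D F F') \<le> card (?D F0 G0 \<union> ?f ` ?D F1 G0 \<union> ?g ` ?D F0 G1)"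
      using finF by (intro card_mono[OF _ sub] finite_UnI finite_imageI finD)
    also have "\<dots> \<le> card (?D F0 G0) + card (?f ` ?D F1 G0) + card (?g ` ?D F0 G1)"
      by (meson add_le_mono1 card_Un_le le_trans)
    also have "\<dots> \<le> card (?D F0 G0) + card (?D F1 G0) + card (?D F0 G1)"
      using finF by (intro add_mono card_image_le finD order_refl)
    finally have D: "real (card (?D F F')) \<le> card (?D F0 G0) + card (?D F1 G0) + card (?D F0 G1)"
      by linarith
    define M where "M = real (Suc m)"
    define T where "T = real (Suc m choose a) * real ((Suc m - a) choose b)"
    \<comment> \<open>\<open>p\<close> and \<open>q\<close> are the probabilities that the last
      point lies in the first or in the second set of a random disjoint pair, and \<open>T\<close>
      is the number of such pairs.\<close>
    define p q where "p = a / M" and "q = b / M"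
    have M: "M > 0" by (simp add: M_def)
    define x0 x1 where "x0 = card F0 / real (m choose a)" and "x1 = card F1 / real (m choose a')"
    define y0 y1 where "y0 = card G0 / real (m choose b)" and "y1 = card G1 / real (m choose b')"
    have c: "M * real (m choose a') = a * real (Suc m choose a)"
            "M * real (m choose b') = b * real (Suc m choose b)"
      using Suc_times_binomial_eq[of m a'] Suc_times_binomial_eq[of m b'] ab
      unfolding M_def by (metis mult.commute of_nat_mult)+
    have comp: "(real n - real k) * real (n choose k) = real n * real ((n - 1) choose k)" if "k \<le> n" for n k
      using binomial_absorb_comp[of n k] that by (metis of_nat_diff of_nat_mult)
    have d: "M * real (m choose a) = (M - a) * real (Suc m choose a)"
            "M * real (m choose b) = (M - b) * real (Suc m choose b)"
      using comp[of a "Suc m"] comp[of b "Suc m"] am unfolding M_def by auto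
    have nz: "real (m choose a) > 0" "real (m choose a') > 0" "real (m choose b) > 0" "real (m choose b') > 0"
      "real (Suc m choose a) > 0" "real (Suc m choose b) > 0"
      using am by (auto simp: ab intro: zero_less_binomial add_pos_pos simp del: binomial_Suc_Suc)
    have T00: "real (m choose a) * real ((m - a) choose b) = (1 - p - q) * T"
    proof -
      have "(M - a) * real ((m - a) choose b) = (M - a - b) * real ((Suc m - a) choose b)"
        using comp[of b "Suc m - a"] am ab unfolding M_def by (simp add: of_nat_diff algebra_simps)
      then have "M * real (m choose a) * real ((m - a) choose b)
          = real (Suc m choose a) * ((M - a - b) * real ((Suc m - a) choose b))"
        unfolding d(1) by (metis mult.assoc mult.commute)
      then have "M * real (m choose a) * real ((m - a) choose b) = (M - a - b) * T"
        unfolding T_def by (simp add: mult_ac)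
      then have "real (m choose a) * real ((m - a) choose b) = (M - a - b) * T / M"
        using M by (simp add: eq_divide_eq mult_ac)
      also have "\<dots> = (1 - p - q) * T" 
      proof -
        have "1 - p - q = (M - a - b) / M" using M by (simp add: p_def q_def diff_divide_distrib)
        then show ?thesis by simp
      qed
      finally show ?thesis .
    qed
    have T10: "real (m choose a') * real ((m - a') choose b) = p * T"
    proof -
      have "m - a' = Suc m - a" using ab by simp
      then have "M * real (m choose a') * real ((m - a') choose b) = a * T"
        unfolding T_def c(1) by (simp add: algebra_simps)
      then show ?thesis using M by (simp add: p_def field_simps)
    qed
    have T01: "real (m choose a) * real ((m - a) choose b') = q * T"
    proof -
      have "(M - a) * real ((m - a) choose b') = b * real ((Suc m - a) choose b)"
      proof -
        have "Suc m - a = Suc (m - a)" using am ab by simp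
        moreover have "M - a = real (Suc (m - a))" using am ab by (simp add: M_def of_nat_diff)
        ultimately show ?thesis
          using Suc_times_binomial_eq[of "m - a" b'] ab by (metis mult.commute of_nat_mult)
      qed
      then have "M * real (m choose a) * real ((m - a) choose b')
          = real (Suc m choose a) * (b * real ((Suc m - a) choose b))"
        unfolding d(1) by (metis mult.assoc mult.commute)
      then have "M * real (m choose a) * real ((m - a) choose b') = b * T"
        unfolding T_def by (simp add: mult_ac)
      then show ?thesis using M by (simp add: q_def field_simps)
    qed
    have x: "card F / real (Suc m choose a) = (1 - p) * x0 + p * x1"
    proof -
      have 1: "real (m choose a) = (1 - p) * real (Suc m choose a)" "real (m choose a') = p * real (Suc m choose a)"
        using d(1) c(1) M by (simp_all add: p_def field_simps)
      have "real (card F) = real (m choose a) * x0 + real (m choose a') * x1"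
        using nz F(5) by (simp add: x0_def x1_def)
      then show ?thesis using nz unfolding 1 by (simp add: field_simps)
    qed
    have y: "card F' / real (Suc m choose b) = (1 - q) * y0 + q * y1"
    proof -
      have 1: "real (m choose b) = (1 - q) * real (Suc m choose b)" "real (m choose b') = q * real (Suc m choose b)"
        using d(2) c(2) M by (simp_all add: q_def field_simps)
      have "real (card F') = real (m choose b) * y0 + real (m choose b') * y1"
        using nz G(5) by (simp add: y0_def y1_def)
      then show ?thesis using nz unfolding 1 by (simp add: field_simps)
    qed
    have "x1 \<le> x0" "y1 \<le> y0"
      using F(6) G(6) nz unfolding x0_def x1_def y0_def y1_def
      by (simp_all add: field_simps flip: of_nat_mult)
    moreover have "0 \<le> p" "0 \<le> q" "0 \<le> T" using M by (auto simp: p_def q_def T_def)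
    \<comment> \<open>This is precisely the amount by which the product of the two means exceeds the
      three-case sum.\<close>
    ultimately have pos: "0 \<le> T * (p * q * ((x0 - x1) * (y0 - y1)))" by simp
    have "real (card (?D F F')) \<le> (1 - p - q) * T * x0 * y0 + p * T * x1 * y0 + q * T * x0 * y1"
      using D Suc.IH[OF F(1) G(1) F(3) G(3)] Suc.IH[OF F(2) G(1) F(4) G(3)] Suc.IH[OF F(1) G(2) F(3) G(4)]
      unfolding T00 T10 T01 x0_def[symmetric] x1_def[symmetric] y0_def[symmetric] y1_def[symmetric] by linarith
    also have "\<dots> \<le> T * ((1 - p) * x0 + p * x1) * ((1 - q) * y0 + q * y1)"
      using pos by (simp add: algebra_simps)
    finally show ?thesis unfolding x[symmetric] y[symmetric] T_def .
  qed
qed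

section \<open>Dense prefixes and shadows of shifted families with bounded matching number\<close>

lemma shifted_member_meets_prefix:
  assumes "shifted m F" "F \<subseteq> nsets {1..m} l" and l: "1 \<le> l" and m: "(r + 1) * l \<le> m"
    and match: "\<And>M. M \<subseteq> F \<Longrightarrow> pairwise disjnt M \<Longrightarrow> finite M \<Longrightarrow> card M \<le> r"
    and B: "B \<in> F"
  shows "\<exists>i\<in>{1..l}. i \<le> card (B \<inter> {1..(r + 1) * i - 1})"
proof (rule ccontr)
  assume "\<not> ?thesis"
  then have small: "card (B \<inter> {1..(r + 1) * i - 1}) < i" if "1 \<le> i" "i \<le> l" for i
    using that by (meson atLeastAtMost_iff linorder_not_less)
  have Bs: "card B = l" "finite B" using B assms(2) by (auto simp: nsets_def)
  \<comment> \<open>If the claim fails, the i-th smallest element of \<open>B\<close> is at least (r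
    + 1) i. The arithmetic progressions \<open>C 1\<close>, ..., \<open>C (r + 1)\<close> with
    difference r + 1 then all lie to the left of \<open>B\<close>, hence in \<open>F\<close>, and
    they are r + 1 disjoint members.\<close>
  define C where "C c = (\<lambda>i. (r + 1) * i + c) ` {0..<l}" for c
  have inj: "inj_on (\<lambda>i. (r + 1) * i + c) X" for c X
    by (rule inj_onI) (metis add_right_cancel mult_cancel1 Suc_eq_plus1 nat.distinct(1))
  have cardC: "card (C c) = l" for c
    using card_image[OF inj] by (simp only: C_def card_atLeastLessThan)
  have bound: "(r + 1) * i + c \<le> (r + 1) * Suc i" if "c \<le> r + 1" for i c
    using that by simp
  have "C c \<in> F" if c: "c \<in> {1..r + 1}" for c
  proof (rule shifted_dominates[OF assms(1,2) B])
    have "(r + 1) * i + c \<le> m" if "i < l" for i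
    proof -
      have "(r + 1) * i + c \<le> (r + 1) * Suc i" using c by (intro bound) simp
      also have "\<dots> \<le> (r + 1) * l" using that by (intro mult_le_mono2) simp
      finally show ?thesis using m by simp
    qed
    then show "C c \<in> nsets {1..m} l"
      using c cardC[of c] by (auto simp: nsets_def C_def)
    fix j
    define q where "q = j div (r + 1)"
    have q: "(r + 1) * q \<le> j" "j < (r + 1) * Suc q"
      unfolding q_def using times_div_less_eq_dividend[of "r + 1" j] dividend_less_times_div[of "r + 1" j]
      by simp_all
    show "card (B \<inter> {1..j}) \<le> card (C c \<inter> {1..j})"
    proof (cases "q < l")
      case True
      have "B \<inter> {1..j} \<subseteq> B \<inter> {1..(r + 1) * Suc q - 1}" using q by auto
      then have "card (B \<inter> {1..j}) \<le> card (B \<inter> {1..(r + 1) * Suc q - 1})"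
        using Bs by (intro card_mono) auto
      then have "card (B \<inter> {1..j}) \<le> q" using small[of "Suc q"] True by simp
      also have "q = card ((\<lambda>i. (r + 1) * i + c) ` {0..<q})" using card_image[OF inj] by (simp only: card_atLeastLessThan)
      also have "\<dots> \<le> card (C c \<inter> {1..j})"
      proof (rule card_mono)
        have "(r + 1) * i + c \<le> j" if "i < q" for i
        proof -
          have "(r + 1) * i + c \<le> (r + 1) * Suc i" using c by (intro bound) simp
          also have "\<dots> \<le> (r + 1) * q" using that by (intro mult_le_mono2) simp
          finally show ?thesis using q by simp
        qed
        then show "(\<lambda>i. (r + 1) * i + c) ` {0..<q} \<subseteq> C c \<inter> {1..j}"
          using True c by (auto simp: C_def)
      qed simp
      finally show ?thesis .
    next
      case False
      have "(r + 1) * i + c \<le> j" if "i < l" for i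
      proof -
        have "(r + 1) * i + c \<le> (r + 1) * Suc i" using c by (intro bound) simp
        also have "\<dots> \<le> (r + 1) * q" using that False by (intro mult_le_mono2) simp
        finally show ?thesis using q by simp
      qed
      then have "C c \<inter> {1..j} = C c" using c by (auto simp: C_def)
      then show ?thesis using cardC Bs card_mono[of B "B \<inter> {1..j}"] by auto
    qed
  qed
  then have sub: "C ` {1..r + 1} \<subseteq> F" by blast
  have disj: "C c \<inter> C d = {}" if cd: "c \<in> {1..r + 1}" "d \<in> {1..r + 1}" "c \<noteq> d" for c d
  proof (rule ccontr)
    assume "C c \<inter> C d \<noteq> {}"
    then obtain i j where ij: "(r + 1) * i + c = (r + 1) * j + d" by (auto simp: C_def)
    have "(r + 1) * i + (c - 1) = (r + 1) * j + (d - 1)" using ij cd by (simp add: Nat.add_diff_assoc)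
    then have "((r + 1) * i + (c - 1)) mod (r + 1) = ((r + 1) * j + (d - 1)) mod (r + 1)" by simp
    then have "(c - 1) mod (r + 1) = (d - 1) mod (r + 1)" by (simp only: mod_mult_self4)
    then show False using cd by auto
  qed
  have ne: "C c \<noteq> {}" for c using l cardC[of c] by force
  have "inj_on C {1..r + 1}"
    using disj ne by (metis Int_absorb inj_onI)
  then have "card (C ` {1..r + 1}) = r + 1" by (simp add: card_image)
  moreover have "pairwise disjnt (C ` {1..r + 1})"
    using disj unfolding pairwise_def disjnt_def by (metis (no_types, lifting) imageE)
  ultimately show False using match[OF sub] by simp
qed

text \<open>Removing an element from the longest prefix in which a member of \<open>\<G>\<close> is dense is injective up
  to the choice of that element inside the prefix.\<close>

lemma card_le_shadow:
  assumes sh: "shifted m F" and F: "F \<subseteq> nsets {1..m} l" and l: "1 \<le> l" and m: "(r + 1) * l \<le> m"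
    and match: "\<And>M. M \<subseteq> F \<Longrightarrow> pairwise disjnt M \<Longrightarrow> finite M \<Longrightarrow> card M \<le> r" and r: "1 \<le> r"
    and G: "\<G> \<subseteq> nsets {1..m} (Suc l)" and shadow: "\<And>A x. A \<in> \<G> \<Longrightarrow> x \<in> A \<Longrightarrow> A - {x} \<in> F"
  shows "real (card \<G>) * (real l + 1) \<le> (real r * real l - 1) * real (card F)"
proof -
  define J where "J i = {1..(r + 1) * i - 1}" for i
  have J_mono: "J i \<subseteq> J j" if "i \<le> j" for i j
  proof -
    have "(r + 1) * i \<le> (r + 1) * j" using that by (rule mult_le_mono2)
    then show ?thesis by (auto simp: J_def)
  qed
  \<comment> \<open>The thresholds of \<open>SA\<close> and \<open>SB\<close> differ by one because
    passing from a member of \<open>\<G>\<close> to its shadow removes one point.\<close>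
  define SA where "SA A = {i \<in> {1..l}. i + 1 \<le> card (A \<inter> J i)}" for A
  define SB where "SB B = {i \<in> {1..l}. i \<le> card (B \<inter> J i)}" for B
  have fin: "finite F" "finite \<G>"
    using finite_subset[OF F] finite_subset[OF G] finite_imp_finite_nsets by auto
  have finS: "finite (SA A)" "finite (SB A)" for A by (auto simp: SA_def SB_def)
  have SB_ne: "SB B \<noteq> {}" if "B \<in> F" for B
    using shifted_member_meets_prefix[OF sh F l m match that] by (auto simp: SB_def J_def)
  have Gs: "finite A" "card A = Suc l" "A \<subseteq> {1..m}" if "A \<in> \<G>" for A
    using that G by (auto simp: nsets_def)
  have SA_ne: "SA A \<noteq> {}" if A: "A \<in> \<G>" for A
  proof -
    have ne: "A \<noteq> {}" "finite A" using Gs[OF A] by auto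
    define a where "a = Min A"
    have a: "a \<in> A" "\<And>z. z \<in> A \<Longrightarrow> a \<le> z" using ne by (auto simp: a_def)
    obtain i where i: "i \<in> {1..l}" "i \<le> card ((A - {a}) \<inter> J i)"
      using SB_ne[OF shadow[OF A a(1)]] by (auto simp: SB_def)
    then have "card ((A - {a}) \<inter> J i) \<noteq> 0" by auto
    then obtain z where "z \<in> (A - {a}) \<inter> J i" by (metis card.empty ex_in_conv)
    then have "a \<in> J i" using a Gs[OF A] by (force simp: J_def)
    then have "A \<inter> J i = insert a ((A - {a}) \<inter> J i)" using a by auto
    then have "card (A \<inter> J i) = Suc (card ((A - {a}) \<inter> J i))" using ne by simp
    then have "i \<in> SA A" using i by (auto simp: SA_def)
    then show ?thesis by auto
  qed
  \<comment> \<open>Taking the largest index makes the count exact: at the next index the threshold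
    is missed, so the prefix contains exactly \<open>iA A + 1\<close> points of
    \<open>A\<close>.\<close>
  define iA where "iA A = Max (SA A)" for A
  define iB where "iB B = Max (SB B)" for B
  have iA: "iA A \<in> SA A" "\<And>i. i \<in> SA A \<Longrightarrow> i \<le> iA A" if "A \<in> \<G>" for A
    using SA_ne[OF that] finS unfolding iA_def by auto
  have iB: "iB B \<in> SB B" "\<And>i. i \<in> SB B \<Longrightarrow> i \<le> iB B" if "B \<in> F" for B
    using SB_ne[OF that] finS unfolding iB_def by auto
  have exact: "card (A \<inter> J (iA A)) = iA A + 1" if A: "A \<in> \<G>" for A
  proof (rule antisym)
    show "iA A + 1 \<le> card (A \<inter> J (iA A))" using iA(1)[OF A] by (auto simp: SA_def)
    show "card (A \<inter> J (iA A)) \<le> iA A + 1"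
    proof (cases "iA A < l")
      case True
      have "Suc (iA A) \<notin> SA A" using iA(2)[OF A] by force
      then have "card (A \<inter> J (Suc (iA A))) \<le> iA A + 1" using True by (auto simp: SA_def)
      moreover have "card (A \<inter> J (iA A)) \<le> card (A \<inter> J (Suc (iA A)))"
        using J_mono[of "iA A" "Suc (iA A)"] Gs[OF A] by (intro card_mono) auto
      ultimately show ?thesis by simp
    next
      case False
      then have "iA A = l" using iA(1)[OF A] by (auto simp: SA_def)
      then show ?thesis using Gs[OF A] card_mono[of A "A \<inter> J (iA A)"] by auto
    qed
  qed
  \<comment> \<open>Removing x lowers the counts at all indices from \<open>iA A\<close> on by one,
    so the largest index can be read off from \<open>A - {x}\<close> alone.\<close>
  have same: "iB (A - {x}) = iA A" if A: "A \<in> \<G>" and x: "x \<in> A \<inter> J (iA A)" for A x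
  proof -
    have B: "A - {x} \<in> F" using shadow A x by auto
    have rem: "card ((A - {x}) \<inter> J i) = card (A \<inter> J i) - 1" if "iA A \<le> i" for i
    proof -
      have "x \<in> A \<inter> J i" using x J_mono[OF that] by auto
      then have "(A - {x}) \<inter> J i = (A \<inter> J i) - {x}" "x \<in> A \<inter> J i" by auto
      then show ?thesis using Gs[OF A] by (simp add: card_Diff_singleton)
    qed
    have "iA A \<in> SB (A - {x})"
      using rem[of "iA A"] exact[OF A] iA(1)[OF A] by (auto simp: SA_def SB_def)
    then have "iA A \<le> iB (A - {x})" using iB(2)[OF B] by auto
    moreover have "iB (A - {x}) \<in> SA A"
      using iB(1)[OF B] rem[OF \<open>iA A \<le> iB (A - {x})\<close>] by (auto simp: SA_def SB_def)
    ultimately show ?thesis using iA(2)[OF A] by force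
  qed
  let ?L = "SIGMA A:\<G>. A \<inter> J (iA A)" and ?R = "SIGMA B:F. J (iB B) - B"
  let ?f = "\<lambda>(A, x). (A - {x}, x::nat)"
  have finL: "finite ?R" using fin by (auto simp: J_def)
  have inj: "inj_on ?f ?L"
    by (auto simp: inj_on_def)
  \<comment> \<open>Each \<open>A\<close> spreads weight 1 evenly over its i + 1 points in the
    prefix. In return a shadow set \<open>B\<close> is charged only for prefix points outside
    \<open>B\<close>; there are at most (r + 1) i - 1 - i of them, and (r i - 1) / (i + 1) increases
    with i.\<close>
  have "real (card \<G>) = (\<Sum>A\<in>\<G>. \<Sum>x\<in>A \<inter> J (iA A). 1 / real (iA A + 1))"
    using exact by simp
  also have "\<dots> = (\<Sum>(A, x)\<in>?L. 1 / real (iA A + 1))"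
    using fin Gs by (intro sum.Sigma) auto
  also have "\<dots> = (\<Sum>(A, x)\<in>?L. 1 / real (iB (A - {x}) + 1))"
    using same by (intro sum.cong) auto
  also have "\<dots> = (\<Sum>(B, x)\<in>?f ` ?L. 1 / real (iB B + 1))"
    by (subst sum.reindex[OF inj]) (auto intro!: sum.cong)
  also have "\<dots> \<le> (\<Sum>(B, x)\<in>?R. 1 / real (iB B + 1))"
    using same shadow finL by (intro sum_mono2) auto
  also have "\<dots> = (\<Sum>B\<in>F. \<Sum>x\<in>J (iB B) - B. 1 / real (iB B + 1))"
    using fin by (intro sum.Sigma[symmetric]) (auto simp: J_def)
  also have "\<dots> \<le> (\<Sum>B\<in>F. (real r * real l - 1) / (real l + 1))"
  proof (rule sum_mono)
    fix B assume B: "B \<in> F"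
    define i where "i = iB B"
    have i: "1 \<le> i" "i \<le> l" "i \<le> card (B \<inter> J i)" using iB(1)[OF B] by (auto simp: SB_def i_def)
    have "card (J i - B) = card (J i) - card (B \<inter> J i)"
      by (metis Int_commute card_Diff_subset_Int finite_Int finite_atLeastAtMost J_def)
    then have "card (J i - B) + i \<le> (r + 1) * i - 1"
      using i card_mono[of "J i" "B \<inter> J i"] by (simp add: J_def)
    then have "card (J i - B) + 1 \<le> r * i" using i by (simp add: algebra_simps)
    then have c: "real (card (J i - B)) \<le> real r * real i - 1"
      by (metis add.commute le_diff_eq of_nat_1 of_nat_add of_nat_le_iff of_nat_mult)
    have "(\<Sum>x\<in>J i - B. 1 / real (i + 1)) = real (card (J i - B)) / (real i + 1)" by simp
    also have "\<dots> \<le> (real r * real i - 1) / (real i + 1)"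
      using c by (intro divide_right_mono) auto
    also have "\<dots> \<le> (real r * real l - 1) / (real l + 1)"
    proof -
      have "(real r + 1) * real i \<le> (real r + 1) * real l"
        using i by (intro mult_left_mono) auto
      then show ?thesis by (simp add: field_simps)
    qed
    finally show "(\<Sum>x\<in>J (iB B) - B. 1 / real (iB B + 1)) \<le> (real r * real l - 1) / (real l + 1)"
      by (simp add: i_def)
  qed
  finally have "real (card \<G>) \<le> real (card F) * ((real r * real l - 1) / (real l + 1))" by simp
  then show ?thesis by (simp add: field_simps)
qed

section \<open>Chains of families without a disjoint transversal\<close>

lemma card_disjoint_pairs:
  assumes V: "finite V"
  shows "card {(A, B). A \<in> nsets V a \<and> B \<in> nsets V b \<and> A \<inter> B = {}} = (card V choose a) * ((card V - a) choose b)"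
proof -
  have "{(A, B). A \<in> nsets V a \<and> B \<in> nsets V b \<and> A \<inter> B = {}} = (SIGMA A:nsets V a. nsets (V - A) b)"
    by (auto simp: nsets_def)
  also have "card \<dots> = (\<Sum>A\<in>nsets V a. card (nsets (V - A) b))"
    using V by (intro card_SigmaI) (auto intro: finite_imp_finite_nsets)
  also have "\<dots> = (\<Sum>A\<in>nsets V a. (card V - a) choose b)"
  proof (rule sum.cong[OF refl])
    fix A assume "A \<in> nsets V a"
    then have "card (V - A) = card V - a" by (auto simp: nsets_def card_Diff_subset)
    then show "card (nsets (V - A) b) = (card V - a) choose b" using V by (simp add: card_nsets)
  qed
  finally show ?thesis using V by (simp add: card_nsets)
qed

lemma disjoint_family_on_imp_inj_on:
  assumes "disjoint_family_on B I" "\<And>i. i \<in> I \<Longrightarrow> B i \<noteq> {}"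
  shows "inj_on B I"
  using assms unfolding disjoint_family_on_def inj_on_def by (metis Int_absorb)

lemma disjoint_family_on_imp_pairwise_disjnt:
  "disjoint_family_on B I \<Longrightarrow> pairwise disjnt (B ` I)"
  unfolding disjoint_family_on_def pairwise_def disjnt_def by (metis (no_types, lifting) imageE)

text \<open>Ordered pairs of distinct blocks are averaged along with single blocks; such a pair is
  uniform among disjoint pairs. The quadratic bound needs this for X (X - 1), where X is the number
  of blocks in \<open>H 0\<close>.\<close>

lemma average_over_matchings_pairs:
  fixes g :: "'a set \<Rightarrow> real" and h :: "'a set \<Rightarrow> 'a set \<Rightarrow> real"
  assumes V: "finite V" and q: "q * d \<le> card V" and d: "1 \<le> d"
    and bound: "\<And>Q. Q \<subseteq> nsets V d \<Longrightarrow> pairwise disjnt Q \<Longrightarrow> finite Q \<Longrightarrow> card Q = q \<Longrightarrow>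
      c \<le> (\<Sum>A\<in>Q. g A) + (\<Sum>A\<in>Q. \<Sum>B\<in>Q - {A}. h A B)"
  shows "c \<le> real q * ((\<Sum>A\<in>nsets V d. g A) / real (card V choose d))
    + real q * (real q - 1) * ((\<Sum>(A, B) | A \<in> nsets V d \<and> B \<in> nsets V d \<and> A \<inter> B = {}. h A B)
        / (real (card V choose d) * real ((card V - d) choose d)))"
proof -
  let ?P = "{\<pi>. \<pi> permutes V}" and ?I = "{..<q}"
  let ?X = "{(A, B). A \<in> nsets V d \<and> B \<in> nsets V d \<and> A \<inter> B = {}}"
  have "(\<Sum>i\<in>?I. d) \<le> card V" using q by simp
  from exists_disjoint_subsets[OF finite_lessThan V this]
  obtain S where S: "disjoint_family_on S ?I" "\<And>i. i \<in> ?I \<Longrightarrow> S i \<subseteq> V \<and> card (S i) = d"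
    by blast
  have finP: "finite ?P" using V by (rule finite_permutations)
  have P: "0 < card ?P" using finP permutes_id[of V] by (metis card_gt_0_iff empty_iff mem_Collect_eq)
  define gavg havg where "gavg = (\<Sum>A\<in>nsets V d. g A) / real (card V choose d)"
    and "havg = (\<Sum>(A, B)\<in>?X. h A B) / (real (card V choose d) * real ((card V - d) choose d))"
  have "real (card ?P) * c = (\<Sum>\<pi>\<in>?P. c)" by simp
  also have "\<dots> \<le> (\<Sum>\<pi>\<in>?P. (\<Sum>i\<in>?I. g (\<pi> ` S i)) + (\<Sum>i\<in>?I. \<Sum>j\<in>?I - {i}. h (\<pi> ` S i) (\<pi> ` S j)))"
  proof (rule sum_mono)
    fix \<pi> assume "\<pi> \<in> ?P"
    then have p: "\<pi> permutes V" by simp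
    define B where "B i = \<pi> ` S i" for i
    have disj: "disjoint_family_on B ?I"
      unfolding B_def using S(1) p by (rule disjoint_family_on_image_permutes)
    have B: "B i \<in> nsets V d" if "i \<in> ?I" for i
      using S(2)[OF that] permutes_image[OF p] permutes_inj[OF p] V
      by (auto simp: B_def nsets_def card_image inj_on_subset finite_subset)
    have "B i \<noteq> {}" if "i \<in> ?I" for i using B[OF that] d by (auto simp: nsets_def)
    with disj have inj: "inj_on B ?I" by (rule disjoint_family_on_imp_inj_on)
    have "c \<le> (\<Sum>A\<in>B ` ?I. g A) + (\<Sum>A\<in>B ` ?I. \<Sum>C\<in>B ` ?I - {A}. h A C)"
      using B disj inj by (intro bound) (auto simp: card_image disjoint_family_on_imp_pairwise_disjnt)
    also have "(\<Sum>A\<in>B ` ?I. g A) = (\<Sum>i\<in>?I. g (B i))" by (simp add: sum.reindex[OF inj])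
    also have "(\<Sum>A\<in>B ` ?I. \<Sum>C\<in>B ` ?I - {A}. h A C) = (\<Sum>i\<in>?I. \<Sum>C\<in>B ` ?I - {B i}. h (B i) C)"
      by (simp add: sum.reindex[OF inj])
    also have "\<dots> = (\<Sum>i\<in>?I. \<Sum>j\<in>?I - {i}. h (B i) (B j))"
    proof (rule sum.cong[OF refl])
      fix i assume i: "i \<in> ?I"
      have "B ` ?I - {B i} = B ` (?I - {i})" using inj i by (auto simp: inj_on_def)
      moreover have "inj_on B (?I - {i})" using inj by (rule inj_on_subset) auto
      ultimately show "(\<Sum>C\<in>B ` ?I - {B i}. h (B i) C) = (\<Sum>j\<in>?I - {i}. h (B i) (B j))"
        by (simp add: sum.reindex)
    qed
    finally show "c \<le> (\<Sum>i\<in>?I. g (\<pi> ` S i)) + (\<Sum>i\<in>?I. \<Sum>j\<in>?I - {i}. h (\<pi> ` S i) (\<pi> ` S j))"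
      by (simp add: B_def)
  qed
  also have "\<dots> = (\<Sum>i\<in>?I. \<Sum>\<pi>\<in>?P. g (\<pi> ` S i)) + (\<Sum>i\<in>?I. \<Sum>j\<in>?I - {i}. \<Sum>\<pi>\<in>?P. h (\<pi> ` S i) (\<pi> ` S j))"
    by (simp add: sum.distrib sum.swap[where A = ?P])
  also have "\<dots> = (\<Sum>i\<in>?I. real (card ?P) * gavg) + (\<Sum>i\<in>?I. \<Sum>j\<in>?I - {i}. real (card ?P) * havg)"
  proof -
    have "(\<Sum>\<pi>\<in>?P. g (\<pi> ` S i)) = real (card ?P) * gavg" if i: "i \<in> ?I" for i
    proof -
      have "d \<le> card V" using S(2)[OF i] V card_mono by metis
      then have "0 < card V choose d" by simp
      then show ?thesis
        using sum_over_permutations[OF V, of "S i" g] S(2)[OF i] by (simp add: gavg_def field_simps)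
    qed
    moreover have "(\<Sum>\<pi>\<in>?P. h (\<pi> ` S i) (\<pi> ` S j)) = real (card ?P) * havg" if i: "i \<in> ?I" and j: "j \<in> ?I - {i}" for i j
    proof -
      have ij: "S i \<inter> S j = {}" using S(1) i j by (auto simp: disjoint_family_on_def)
      have Sij: "S i \<subseteq> V" "card (S i) = d" "S j \<subseteq> V" "card (S j) = d" using S(2) i j by auto
      then have "card (S i \<union> S j) = d + d" "S i \<union> S j \<subseteq> V"
        using ij V by (simp_all add: card_Un_disjoint finite_subset)
      then have "d + d \<le> card V" using V card_mono by metis
      then have nz: "real (card V choose d) * real ((card V - d) choose d) \<noteq> 0" by simp
      have "real (card V choose d) * real ((card V - d) choose d) * (\<Sum>\<pi>\<in>?P. h (\<pi> ` S i) (\<pi> ` S j))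
          = real (card ?P) * (\<Sum>(A, B)\<in>?X. h A B)"
        using sum_over_permutations_pair[OF V Sij(1,3) ij, of h]
        unfolding Sij card_disjoint_pairs[OF V] of_nat_mult .
      then have "(\<Sum>\<pi>\<in>?P. h (\<pi> ` S i) (\<pi> ` S j)) * (real (card V choose d) * real ((card V - d) choose d))
          = real (card ?P) * (\<Sum>(A, B)\<in>?X. h A B)"
        by (simp only: mult.commute)
      from eq_divide_imp[OF nz this] show ?thesis unfolding havg_def by (simp only: times_divide_eq_right)
    qed
    ultimately show ?thesis by simp
  qed
  also have "\<dots> = real (card ?P) * (real q * gavg + real q * (real q - 1) * havg)"
  proof -
    have "(\<Sum>i\<in>?I. \<Sum>j\<in>?I - {i}. real (card ?P) * havg) = (\<Sum>i\<in>?I. (real q - 1) * (real (card ?P) * havg))"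
    proof (rule sum.cong[OF refl])
      fix i assume "i \<in> ?I"
      then have "1 \<le> q" "card (?I - {i}) = q - 1" by auto
      then show "(\<Sum>j\<in>?I - {i}. real (card ?P) * havg) = (real q - 1) * (real (card ?P) * havg)"
        by (simp add: of_nat_diff)
    qed
    then show ?thesis by (simp add: algebra_simps)
  qed
  finally have "c \<le> real q * gavg + real q * (real q - 1) * havg"
    using P by simp
  then show ?thesis by (simp add: gavg_def havg_def)
qed

lemma average_over_matchings:
  fixes g :: "'a set \<Rightarrow> real"
  assumes V: "finite V" and q: "q * d \<le> card V" and d: "1 \<le> d"
    and bound: "\<And>Q. Q \<subseteq> nsets V d \<Longrightarrow> pairwise disjnt Q \<Longrightarrow> finite Q \<Longrightarrow> card Q = q \<Longrightarrow> c \<le> (\<Sum>A\<in>Q. g A)"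
  shows "c \<le> real q * ((\<Sum>A\<in>nsets V d. g A) / real (card V choose d))"
  using average_over_matchings_pairs[OF V q d, of c g "\<lambda>_ _. 0"] bound by simp

text \<open>An abstract form of the links of the \<open>s + 1\<close> special points. The lack of a
  disjoint transversal is what remains of the matching number being \<open>s\<close>.\<close>

locale dependent_chain =
  fixes m l s :: nat and H :: "nat \<Rightarrow> nat set set"
  assumes l_pos: "1 \<le> l"
    and H_sub: "\<And>i. i \<le> s \<Longrightarrow> H i \<subseteq> nsets {1..m} l"
    and H_mono: "\<And>i j. i \<le> j \<Longrightarrow> j \<le> s \<Longrightarrow> H i \<subseteq> H j"
    and no_transversal: "\<And>A. disjoint_family_on A {..s} \<Longrightarrow> (\<And>i. i \<le> s \<Longrightarrow> A i \<in> H i) \<Longrightarrow> False"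
begin

text \<open>Index 0 is left out because \<open>H 0\<close> enters the target inequality through its
  own cardinality.\<close>

definition missing :: "nat set \<Rightarrow> nat" where
  "missing A = card {i \<in> {1..s}. A \<notin> H i}"

definition total_missing :: real where
  "total_missing = (\<Sum>A\<in>nsets {1..m} l. real (missing A))"

lemma total_missing_eq: "total_missing = real s * real (m choose l) - (\<Sum>i\<in>{1..s}. real (card (H i)))"
proof -
  let ?N = "nsets {1..m} l"
  have fin: "finite ?N" by (simp add: finite_imp_finite_nsets)
  have "real (missing A) = (\<Sum>i\<in>{1..s}. if A \<notin> H i then 1 else 0)" for A
    by (simp add: missing_def sum.If_cases Int_def conj_commute)
  then have "total_missing = (\<Sum>i\<in>{1..s}. \<Sum>A\<in>?N. if A \<notin> H i then 1 else 0)"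
    unfolding total_missing_def by (simp only:) (rule sum.swap)
  also have "\<dots> = (\<Sum>i\<in>{1..s}. real (m choose l) - real (card (H i)))"
  proof (rule sum.cong[OF refl])
    fix i assume i: "i \<in> {1..s}"
    have "(\<Sum>A\<in>?N. if A \<notin> H i then 1 else 0::real) = real (card (?N - H i))"
      using fin by (simp add: sum.If_cases Diff_eq Int_def)
    also have "\<dots> = real (m choose l) - real (card (H i))"
      using card_nsets_Diff[OF _ H_sub[of i]] i by simp
    finally show "(\<Sum>A\<in>?N. if A \<notin> H i then 1 else 0::real) = real (m choose l) - real (card (H i))" .
  qed
  finally show ?thesis by (simp add: sum_subtractf)
qed

text \<open>If for every j more than j blocks of \<open>R \<union> Q\<close> were in
  \<open>H j\<close>, greedy choice would give a transversal. For a j violating this, all of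
  \<open>R\<close> is among the at most j blocks because \<open>R \<subseteq> H 0\<close>, and a
  block outside \<open>H j\<close> is outside \<open>H 1\<close>, ..., \<open>H j\<close> as well.
  The exempt set \<open>E\<close> consists of the blocks of \<open>Q\<close> in
  \<open>H j\<close>.\<close>

lemma loss:
  assumes "finite Q" "finite R" "R \<inter> Q = {}" "pairwise disjnt (R \<union> Q)" "R \<subseteq> H 0"
  shows "\<exists>j E. card R \<le> j \<and> j \<le> s \<and> E \<subseteq> Q \<and> card E + card R \<le> j \<and> (\<forall>A\<in>Q - E. j \<le> missing A)"
proof -
  let ?P = "R \<union> Q"
  have "\<exists>j\<le>s. card (?P \<inter> H j) \<le> j"
  proof (rule ccontr)
    assume "\<not> ?thesis"
    then have "\<And>i. i < Suc s \<Longrightarrow> finite (?P \<inter> H i) \<and> i < card (?P \<inter> H i)"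
      using assms(1,2) by (meson finite_Int finite_Un less_Suc_eq_le not_le)
    from greedy_sdr[of "Suc s", OF this]
    obtain a where a: "inj_on a {..<Suc s}" "\<forall>i<Suc s. a i \<in> ?P \<inter> H i" by blast
    have "disjoint_family_on a {..s}"
      unfolding disjoint_family_on_def
    proof (intro ballI impI)
      fix i j assume ij: "i \<in> {..s}" "j \<in> {..s}" "i \<noteq> j"
      then have "a i \<noteq> a j" "a i \<in> ?P" "a j \<in> ?P" using a by (auto simp: inj_on_def less_Suc_eq_le)
      then show "a i \<inter> a j = {}" using assms(4) by (auto simp: pairwise_def disjnt_def)
    qed
    then show False using no_transversal a(2) by (auto simp: less_Suc_eq_le)
  qed
  then obtain j where j: "j \<le> s" "card (?P \<inter> H j) \<le> j" by blast
  define E where "E = Q \<inter> H j"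
  have "R \<subseteq> H j" using assms(5) H_mono[of 0 j] j by auto
  then have "?P \<inter> H j = R \<union> E" by (auto simp: E_def)
  moreover have "card (R \<union> E) = card R + card E"
    using assms by (intro card_Un_disjoint) (auto simp: E_def)
  ultimately have c: "card E + card R \<le> j" using j by simp
  moreover have "j \<le> missing A" if "A \<in> Q - E" for A
  proof -
    have "{1..j} \<subseteq> {i \<in> {1..s}. A \<notin> H i}"
      using that j H_mono by (fastforce simp: E_def)
    then have "card {1..j} \<le> missing A" unfolding missing_def by (intro card_mono) auto
    then show ?thesis by simp
  qed
  ultimately show ?thesis using j by (intro exI[of _ j] exI[of _ E]) (auto simp: E_def)
qed

lemma weighted_loss:
  fixes w :: "nat set \<Rightarrow> real"
  assumes "finite Q" "finite R" "R \<inter> Q = {}" "pairwise disjnt (R \<union> Q)" "R \<subseteq> H 0"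
    and w: "\<And>A. A \<in> Q \<Longrightarrow> 0 \<le> w A"
  shows "\<exists>j E. card R \<le> j \<and> j \<le> s \<and> E \<subseteq> Q \<and> card E + card R \<le> j \<and>
           real j * (\<Sum>A\<in>Q - E. w A) \<le> (\<Sum>A\<in>Q. w A * real (missing A))"
proof -
  obtain j E where j: "card R \<le> j" "j \<le> s" "E \<subseteq> Q" "card E + card R \<le> j" "\<forall>A\<in>Q - E. j \<le> missing A"
    using loss[OF assms(1-5)] by blast
  have "real j * (\<Sum>A\<in>Q - E. w A) = (\<Sum>A\<in>Q - E. w A * real j)" by (simp add: sum_distrib_left mult.commute)
  also have "\<dots> \<le> (\<Sum>A\<in>Q - E. w A * real (missing A))"
    using j(5) w by (intro sum_mono mult_left_mono) auto
  also have "\<dots> \<le> (\<Sum>A\<in>Q. w A * real (missing A))"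
    using w assms(1) by (intro sum_mono2) auto
  finally show ?thesis using j by blast
qed

lemma unweighted_loss:
  assumes "finite Q" "finite R" "R \<inter> Q = {}" "pairwise disjnt (R \<union> Q)" "R \<subseteq> H 0"
  shows "\<exists>j. card R \<le> j \<and> j \<le> s \<and>
           real j * (real (card Q) + real (card R) - real j) \<le> (\<Sum>A\<in>Q. real (missing A))"
proof -
  obtain j E where j: "card R \<le> j" "j \<le> s" "E \<subseteq> Q" "card E + card R \<le> j"
    "real j * (\<Sum>A\<in>Q - E. 1) \<le> (\<Sum>A\<in>Q. 1 * real (missing A))"
    using weighted_loss[OF assms, of "\<lambda>_. 1"] by auto
  have "real (card Q) + real (card R) - real j \<le> real (card (Q - E))"
    using j assms(1) by (simp add: card_Diff_subset finite_subset card_mono of_nat_diff)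
  then have "real j * (real (card Q) + real (card R) - real j) \<le> real j * (\<Sum>A\<in>Q - E. 1)"
    by (intro mult_left_mono) auto
  then show ?thesis using j by (intro exI[of _ j]) auto
qed

text \<open>With \<open>B\<close> prescribed, a matching of t - 1 further blocks loses at least j (t
  - j) for some j between 1 and t - 1, hence at least t - 1. So the mean of \<open>missing\<close>
  over the sets disjoint from \<open>B\<close> is at least 1, with equality for the extremal
  family.\<close>

lemma missing_disjoint_from_member:
  assumes B: "B \<in> H 0" and t: "t * l \<le> m" "s + 1 \<le> t" "1 \<le> s"
  shows "real ((m - l) choose l) \<le> (\<Sum>A\<in>nsets ({1..m} - B) l. real (missing A))"
proof -
  let ?V = "{1..m} - B"
  have Bs: "B \<subseteq> {1..m}" "finite B" "card B = l" using B H_sub[of 0] by (auto simp: nsets_def)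
  then have cV: "card ?V = m - l" by (simp add: card_Diff_subset)
  have "real (t - 1) \<le> real (t - 1) * ((\<Sum>A\<in>nsets ?V l. real (missing A)) / real (card ?V choose l))"
  proof (rule average_over_matchings)
    show "(t - 1) * l \<le> card ?V" using t cV by (simp add: diff_mult_distrib)
    fix Q assume Q: "Q \<subseteq> nsets ?V l" "pairwise disjnt Q" "finite Q" "card Q = t - 1"
    have Bq: "disjnt B A" "A \<noteq> B" if "A \<in> Q" for A
    proof -
      have "A \<inter> B = {}" "card A = l" using that Q(1) by (auto simp: nsets_def)
      then show "disjnt B A" "A \<noteq> B" using l_pos by (auto simp: disjnt_def)
    qed
    have "\<exists>j. card {B} \<le> j \<and> j \<le> s \<and>
           real j * (real (card Q) + real (card {B}) - real j) \<le> (\<Sum>A\<in>Q. real (missing A))"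
    proof (rule unweighted_loss)
      show "pairwise disjnt ({B} \<union> Q)" using Q(2) Bq by (auto simp: pairwise_insert disjnt_sym)
    qed (use Q Bq B in auto)
    then obtain j where j: "1 \<le> j" "j \<le> s" "real j * (real t - real j) \<le> (\<Sum>A\<in>Q. real (missing A))"
      using Q(4) t by (auto simp: of_nat_diff)
    have "0 \<le> (real j - 1) * (real t - 1 - real j)" using j t by (intro mult_nonneg_nonneg) auto
    then have "real (t - 1) \<le> real j * (real t - real j)" using t by (simp add: algebra_simps of_nat_diff)
    then show "real (t - 1) \<le> (\<Sum>A\<in>Q. real (missing A))" using j by linarith
  qed (use l_pos in auto)
  moreover have "0 < real (t - 1)" using t by simp
  ultimately have "1 \<le> (\<Sum>A\<in>nsets ?V l. real (missing A)) / real (card ?V choose l)"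
    by (metis mult.right_neutral mult_le_cancel_left_pos)
  moreover have "0 < real (card ?V choose l)"
  proof -
    have "2 * l \<le> t * l" using t by (intro mult_le_mono1) simp
    then have "2 * l \<le> m" using t(1) by (rule le_trans)
    then show ?thesis using cV by simp
  qed
  ultimately show ?thesis using cV by (simp add: le_divide_eq)
qed

text \<open>The function x (q - x) increases up to q / 2, so \<open>2 * s \<le> card Q\<close>
  allows the unknown j between X and s to be replaced by X.\<close>

lemma matching_loss:
  assumes Q: "Q \<subseteq> nsets {1..m} l" "pairwise disjnt Q" "finite Q" and s: "2 * s \<le> card Q"
  defines "X \<equiv> card (Q \<inter> H 0)"
  shows "real X * (real (card Q) - real X) \<le> (\<Sum>A\<in>Q. real (missing A))"
proof -
  have "card Q = card (Q \<inter> H 0) + card (Q - H 0)"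
    using Q(3) by (metis Int_Diff_Un Int_Diff_disjoint card_Un_disjoint finite_Diff finite_Int)
  then have c: "real (card Q) = real X + real (card (Q - H 0))" by (simp add: X_def)
  have "\<exists>j. card (Q \<inter> H 0) \<le> j \<and> j \<le> s \<and>
           real j * (real (card (Q - H 0)) + real (card (Q \<inter> H 0)) - real j) \<le> (\<Sum>A\<in>Q - H 0. real (missing A))"
    by (rule unweighted_loss) (use Q in \<open>auto simp: Int_Diff_Un\<close>)
  then obtain j where j: "X \<le> j" "j \<le> s" "real j * (real (card Q) - real j) \<le> (\<Sum>A\<in>Q - H 0. real (missing A))"
    using c by (auto simp: X_def add.commute)
  have "0 \<le> (real j - real X) * (real (card Q) - real j - real X)"
    using j s by (intro mult_nonneg_nonneg) linarith+
  then have "real X * (real (card Q) - real X) \<le> real j * (real (card Q) - real j)"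
    by (simp add: algebra_simps)
  also have "\<dots> \<le> (\<Sum>A\<in>Q - H 0. real (missing A))" by (rule j(3))
  also have "\<dots> \<le> (\<Sum>A\<in>Q. real (missing A))" using Q(3) by (intro sum_mono2) auto
  finally show ?thesis .
qed

lemma card_H0_indicator:
  assumes "finite Q"
  shows "(\<Sum>A\<in>Q. of_bool (A \<in> H 0) * (c::real)) = real (card (Q \<inter> H 0)) * c"
proof -
  have "(\<Sum>A\<in>Q. of_bool (A \<in> H 0) * c) = (\<Sum>A\<in>Q. if A \<in> H 0 then c else 0)"
    by (intro sum.cong) auto
  also have "\<dots> = real (card (Q \<inter> H 0)) * c" using assms by (simp add: sum.If_cases)
  finally show ?thesis .
qed

text \<open>A matching of t blocks contains X <= r members of \<open>H 0\<close>, so it loses X (t -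
  X) >= (t - r) X; taking expectations replaces X by t times the density of
  \<open>H 0\<close>.\<close>

lemma total_missing_ge_linear:
  assumes t: "t * l \<le> m" "2 * s \<le> t" "1 \<le> t"
    and match: "\<And>M. M \<subseteq> H 0 \<Longrightarrow> pairwise disjnt M \<Longrightarrow> finite M \<Longrightarrow> card M \<le> r"
  shows "(real t - real r) * real (card (H 0)) \<le> total_missing"
proof -
  let ?g = "\<lambda>A. real (missing A) - of_bool (A \<in> H 0) * (real t - real r)"
  let ?N = "nsets {1..m} l"
  have fin: "finite ?N" by (simp add: finite_imp_finite_nsets)
  have "0 \<le> real t * ((\<Sum>A\<in>?N. ?g A) / real (card {1..m} choose l))"
  proof (rule average_over_matchings)
    fix Q assume Q: "Q \<subseteq> ?N" "pairwise disjnt Q" "finite Q" "card Q = t"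
    define X where "X = card (Q \<inter> H 0)"
    have "X \<le> r" unfolding X_def
      by (rule match) (use Q in \<open>auto intro: pairwise_subset\<close>)
    then have "real X * (real t - real r) \<le> real X * (real t - real X)"
      by (intro mult_left_mono) auto
    also have "\<dots> \<le> (\<Sum>A\<in>Q. real (missing A))"
      using matching_loss[OF Q(1-3)] Q(4) t(2) by (simp add: X_def)
    finally show "0 \<le> (\<Sum>A\<in>Q. ?g A)"
      using card_H0_indicator[OF Q(3)] by (simp add: sum_subtractf X_def)
  qed (use t l_pos in auto)
  moreover have "0 < real (m choose l)"
  proof -
    have "l \<le> m" using t by (metis le_trans mult_le_mono1 nat_mult_1)
    then show ?thesis by simp
  qed
  ultimately have "0 \<le> (\<Sum>A\<in>?N. ?g A)" using t by (simp add: zero_le_mult_iff zero_le_divide_iff)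
  moreover have "?N \<inter> H 0 = H 0" using H_sub[of 0] by auto
  ultimately show ?thesis
    using card_H0_indicator[OF fin, of "real t - real r"]
    by (simp add: sum_subtractf total_missing_def mult.commute)
qed

text \<open>Writing X (t - X) as (t - 1) X - X (X - 1) leaves the expected number of ordered pairs
  of blocks in \<open>H 0\<close>, at most t (t - 1) times the squared density by negative
  correlation. Compared with the linear bound, t - r improves to t - 1 at the price of a factor 1
  minus the density.\<close>

lemma total_missing_ge_quadratic:
  assumes t: "t * l \<le> m" "2 * s \<le> t" "2 \<le> t" and sh: "shifted m (H 0)"
  shows "(real t - 1) * (1 - card (H 0) / real (m choose l)) * real (card (H 0)) \<le> total_missing"
proof -
  let ?I = "\<lambda>A. of_bool (A \<in> H 0) :: real"
  let ?g = "\<lambda>A. real (missing A) - ?I A * (real t - 1)"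
  let ?h = "\<lambda>A B. ?I A * ?I B"
  let ?N = "nsets {1..m} l"
  let ?X = "{(A, B). A \<in> ?N \<and> B \<in> ?N \<and> A \<inter> B = {}}"
  define f N C where "f = real (card (H 0))" and "N = real (m choose l)" and "C = real ((m - l) choose l)"
  have fin: "finite ?N" by (simp add: finite_imp_finite_nsets)
  have "2 * l \<le> t * l" using t by (intro mult_le_mono1) simp
  then have l: "2 * l \<le> m" using t(1) by (rule le_trans)
  then have pos: "0 < N" "0 < C" by (auto simp: N_def C_def)
  have avg: "0 \<le> real t * ((\<Sum>A\<in>?N. ?g A) / real (card {1..m} choose l))
    + real t * (real t - 1) * ((\<Sum>(A, B)\<in>?X. ?h A B) / (real (card {1..m} choose l) * real ((card {1..m} - l) choose l)))"
  proof (rule average_over_matchings_pairs)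
    fix Q assume Q: "Q \<subseteq> ?N" "pairwise disjnt Q" "finite Q" "card Q = t"
    define X where "X = real (card (Q \<inter> H 0))"
    have "(\<Sum>A\<in>Q. \<Sum>B\<in>Q - {A}. ?h A B) = (\<Sum>A\<in>Q. ?I A * (X - 1))"
    proof (rule sum.cong[OF refl])
      fix A assume A: "A \<in> Q"
      have "(\<Sum>B\<in>Q. ?I B) = X" using card_H0_indicator[OF Q(3), of 1] by (simp add: X_def)
      moreover have "(\<Sum>B\<in>Q. ?I B) = ?I A + (\<Sum>B\<in>Q - {A}. ?I B)" using Q(3) A by (rule sum.remove)
      ultimately have "(\<Sum>B\<in>Q - {A}. ?I B) = X - ?I A" by simp
      then show "(\<Sum>B\<in>Q - {A}. ?h A B) = ?I A * (X - 1)"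
        by (auto simp: sum_distrib_left[symmetric])
    qed
    also have "\<dots> = X * (X - 1)" using card_H0_indicator[OF Q(3)] by (simp add: X_def)
    finally have "(\<Sum>A\<in>Q. \<Sum>B\<in>Q - {A}. ?h A B) = X * (X - 1)" .
    moreover have "(\<Sum>A\<in>Q. ?g A) = (\<Sum>A\<in>Q. real (missing A)) - X * (real t - 1)"
      using card_H0_indicator[OF Q(3)] by (simp add: sum_subtractf X_def)
    moreover have "X * (real t - X) \<le> (\<Sum>A\<in>Q. real (missing A))"
      using matching_loss[OF Q(1-3)] Q(4) t(2) by (simp add: X_def)
    ultimately show "0 \<le> (\<Sum>A\<in>Q. ?g A) + (\<Sum>A\<in>Q. \<Sum>B\<in>Q - {A}. ?h A B)"
      by (simp add: algebra_simps)
  qed (use t l_pos in auto)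
  have gs: "(\<Sum>A\<in>?N. ?g A) = total_missing - f * (real t - 1)"
  proof -
    have "?N \<inter> H 0 = H 0" using H_sub[of 0] by auto
    then show ?thesis using card_H0_indicator[OF fin] by (simp add: sum_subtractf total_missing_def f_def)
  qed
  have hs: "(\<Sum>(A, B)\<in>?X. ?h A B) \<le> N * C * (f / N) * (f / N)"
  proof -
    have "finite ?X" by (rule finite_subset[of _ "?N \<times> ?N"]) (use fin in auto)
    then have "(\<Sum>(A, B)\<in>?X. ?h A B) = (\<Sum>p\<in>{(A, B). A \<in> H 0 \<and> B \<in> H 0 \<and> A \<inter> B = {}}. 1)"
      using H_sub[of 0] by (intro sum.mono_neutral_cong_right) auto
    then show ?thesis
      using shifted_negative_correlation[OF sh sh H_sub[of 0] H_sub[of 0]]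
      by (simp add: f_def N_def C_def)
  qed
  have "0 \<le> real t * ((total_missing - f * (real t - 1)) / N)
      + real t * (real t - 1) * ((\<Sum>(A, B)\<in>?X. ?h A B) / (N * C))"
    using avg unfolding gs by (simp add: N_def C_def)
  also have "\<dots> \<le> real t * ((total_missing - f * (real t - 1)) / N)
      + real t * (real t - 1) * ((N * C * (f / N) * (f / N)) / (N * C))"
    using t pos by (intro add_left_mono mult_left_mono divide_right_mono hs) auto
  also have "\<dots> = real t / N * (total_missing - f * (real t - 1) + (real t - 1) * f * (f / N))"
    using pos by (simp add: field_simps)
  finally have "0 \<le> total_missing - f * (real t - 1) + (real t - 1) * f * (f / N)"
    using pos t by (metis divide_pos_pos mult_le_cancel_left_pos mult_zero_right of_nat_0_less_iff
        order_less_le_trans zero_less_numeral)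
  moreover have "(real t - 1) * (1 - \<alpha>) * f = f * (real t - 1) - (real t - 1) * f * \<alpha>" for \<alpha>
    by (simp add: algebra_simps)
  ultimately have "(real t - 1) * (1 - f / N) * f \<le> total_missing" by simp
  then show ?thesis by (simp add: f_def N_def)
qed

end

section \<open>Weighted matchings through prescribed members of the first family\<close>

context dependent_chain
begin

text \<open>If j = 1 no block is exempt and the full weight t - 2 + W is lost. If j >= 2 it is
  enough that all weights are at least 1: then j (t - j) >= 2 (t - 2), and W <= t - 2.\<close>

lemma swap_loss:
  assumes t: "s + 2 \<le> t" and W: "1 \<le> W" "W \<le> real t - 2"
    and L: "L \<in> H 0" and Q: "finite Q" "pairwise disjnt (insert L Q)" "L \<notin> Q" "D \<in> Q" "card Q = t - 1"
  shows "real t - 2 + W \<le> W * real (missing D) + (\<Sum>A\<in>Q - {D}. real (missing A))"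
proof -
  define w where "w A = (if A = D then W else 1)" for A :: "nat set"
  have w1: "1 \<le> w A" for A using W by (simp add: w_def)
  have split: "(\<Sum>A\<in>Q. w A * f A) = W * f D + (\<Sum>A\<in>Q - {D}. f A)" for f :: "nat set \<Rightarrow> real"
  proof -
    have "(\<Sum>A\<in>Q. w A * f A) = w D * f D + (\<Sum>A\<in>Q - {D}. w A * f A)"
      using Q by (intro sum.remove) auto
    also have "(\<Sum>A\<in>Q - {D}. w A * f A) = (\<Sum>A\<in>Q - {D}. f A)"
      by (intro sum.cong) (auto simp: w_def)
    finally show ?thesis by (simp add: w_def)
  qed
  have "\<exists>j E. card {L} \<le> j \<and> j \<le> s \<and> E \<subseteq> Q \<and> card E + card {L} \<le> j \<and>
           real j * (\<Sum>A\<in>Q - E. w A) \<le> (\<Sum>A\<in>Q. w A * real (missing A))"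
  proof (rule weighted_loss)
    show "0 \<le> w A" for A using w1[of A] by linarith
  qed (use L Q in auto)
  then obtain j E where j: "1 \<le> j" "j \<le> s" "E \<subseteq> Q" "card E + 1 \<le> j"
    "real j * (\<Sum>A\<in>Q - E. w A) \<le> W * real (missing D) + (\<Sum>A\<in>Q - {D}. real (missing A))"
    unfolding split by auto
  have "real t - 2 + W \<le> real j * (\<Sum>A\<in>Q - E. w A)"
  proof (cases "j = 1")
    case True
    then have "E = {}" using j Q by (auto simp: finite_subset)
    then show ?thesis using split[of "\<lambda>_. 1"] Q t True by (simp add: of_nat_diff)
  next
    case False
    have "card (Q - E) = t - 1 - card E" using j(3) Q by (simp add: card_Diff_subset finite_subset)
    then have "real t - real j \<le> real (card (Q - E))" using j(2,4) t by linarith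
    also have "\<dots> = (\<Sum>A\<in>Q - E. 1)" by simp
    also have "\<dots> \<le> (\<Sum>A\<in>Q - E. w A)" using w1 by (intro sum_mono)
    finally have "real j * (real t - real j) \<le> real j * (\<Sum>A\<in>Q - E. w A)"
      by (intro mult_left_mono) auto
    moreover have "0 \<le> (real j - 2) * (real t - real j - 2)"
      using False j t by (intro mult_nonneg_nonneg) linarith+
    ultimately show ?thesis using W by (simp add: algebra_simps)
  qed
  then show ?thesis using j(5) by linarith
qed

text \<open>A random matching through \<open>[l+1] - x\<close> has a block containing \<open>x\<close>. Giving this block the
  weight \<open>W\<close> compensates for the fact that the sets meeting \<open>[l+1]\<close> in one point are spread over
  several choices of \<open>x\<close>.\<close>

lemma total_missing_ge_swap:
  assumes t: "t * l \<le> m" "m < (t + 1) * l" "s + 2 \<le> t" "1 \<le> s" and m: "4 * l \<le> m"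
    and X: "X \<subseteq> {1..l + 1}" "2 \<le> card X" "\<And>x. x \<in> X \<Longrightarrow> {1..l + 1} - {x} \<in> H 0"
  shows "real ((m - l) choose l) * (1 + min ((real (card X) - 1) * real l) (real m - 3 * real l) / (real m - real l))
    \<le> total_missing"
proof -
  define V where "V = {l + 2..m}"
  define v where "v = m - l - 1"
  have cV: "card V = v" and finV: "finite V" by (auto simp: V_def v_def)
  define z where "z = real (card X)"
  define k where "k = real t - 2"
  have z: "2 \<le> z" using X(2) by (simp add: z_def)
  have k: "1 \<le> k" using t by (simp add: k_def)
  have m4: "4 * real l \<le> real m" using m by linarith
  have l1: "1 \<le> real l" using l_pos by simp
  define M2 where "M2 = real m - 2 * real l"
  have M2: "0 < M2" using m4 l1 by (simp add: M2_def)
  \<comment> \<open>Apart from the cap required by \<open>swap_loss\<close>, this is the balancing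
    weight: by \<open>C0 * real l = C1 * M2\<close> it makes \<open>W / C1\<close> equal to
    \<open>z * k / C0\<close>, so the sets inside \<open>V\<close> and the sets through a point of
    \<open>X\<close> get the same coefficient.\<close>
  define W where "W = min k (z * real l * k / M2)"
  have W: "1 \<le> W" "W \<le> k"
  proof -
    have "real m < (real t + 1) * real l"
      using t(2) by (metis of_nat_1 of_nat_add of_nat_less_iff of_nat_mult)
    then have "M2 \<le> 2 * (real l * k)" using m4 by (simp add: M2_def k_def algebra_simps)
    also have "\<dots> \<le> z * (real l * k)" using z k l1 by (intro mult_right_mono) auto
    finally have "1 \<le> z * real l * k / M2" using M2 by (simp add: le_divide_eq mult_ac)
    then show "1 \<le> W" "W \<le> k" using k by (auto simp: W_def)
  qed
  have finX: "finite X" using X(1) finite_subset by blast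
  define a where "a = (\<Sum>A\<in>nsets V l. real (missing A))"
  define b where "b x = (\<Sum>A\<in>nsets V (l - 1). real (missing (insert x A)))" for x
  define C0 C1 where "C0 = real (v choose l)" and "C1 = real (v choose (l - 1))"
  have each: "k + W \<le> W * (b x / C1) + k * (a / C0)" if x: "x \<in> X" for x
  proof -
    define L where "L = {1..l + 1} - {x}"
    have L: "L \<in> H 0" using X(3)[OF x] by (simp add: L_def)
    have xl: "x \<in> {1..l + 1}" using x X(1) by auto
    \<comment> \<open>Block 0 has l - 1 points and is completed by x to the heavy block
      \<open>D\<close>; the other t - 2 blocks are full. Together with \<open>L\<close> these are t
      disjoint blocks, using t l - l - 1 points of \<open>V\<close>.\<close>
    let ?I = "{0..t - 2}"
    let ?d = "\<lambda>i::nat. if i = 0 then l - 1 else l"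
    let ?g = "\<lambda>i A. if i = 0 then W * real (missing (insert x A)) else real (missing A)"
    have I: "?I = insert 0 {1..t - 2}" by auto
    have "k + W \<le> (\<Sum>i\<in>?I. (\<Sum>A\<in>nsets V (?d i). ?g i A) / real (card V choose ?d i))"
    proof (rule average_over_disjoint_families[OF _ finV])
      have "(\<Sum>i\<in>?I. ?d i) = (l - 1) + (t - 2) * l" by (simp add: I)
      also have "\<dots> = t * l - l - 1"
        using l_pos t(3) by (cases t; cases "t - 1"; simp add: algebra_simps)
      also have "\<dots> \<le> card V" using t(1) cV by (simp add: v_def)
      finally show "(\<Sum>i\<in>?I. ?d i) \<le> card V" .
      fix B assume B: "disjoint_family_on B ?I" "\<And>i. i \<in> ?I \<Longrightarrow> B i \<in> nsets V (?d i)"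
      define D where "D = insert x (B 0)"
      have B0: "B 0 \<subseteq> V" "card (B 0) = l - 1" "finite (B 0)" using B(2)[of 0] by (auto simp: nsets_def)
      have Bi: "B i \<subseteq> V" "card (B i) = l" "finite (B i)" "B i \<noteq> {}" if "i \<in> {1..t - 2}" for i
        using B(2)[of i] that l_pos by (auto simp: nsets_def)
      have xV: "x \<notin> V" "L \<inter> V = {}" using xl by (auto simp: V_def L_def)
      have inj: "inj_on B {1..t - 2}"
        using B(1) Bi(4) by (intro disjoint_family_on_imp_inj_on) (auto simp: disjoint_family_on_def)
      define Q where "Q = insert D (B ` {1..t - 2})"
      have Bdisj: "B i \<inter> B j = {}" if "i \<in> ?I" "j \<in> ?I" "i \<noteq> j" for i j
        using B(1) that by (auto simp: disjoint_family_on_def)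
      have DB: "D \<inter> B i = {}" if "i \<in> {1..t - 2}" for i
        using Bdisj[of 0 i] that Bi(1)[OF that] xV by (auto simp: D_def)
      have DnB: "D \<notin> B ` {1..t - 2}" using DB Bi(4) by fastforce
      have pwB: "pairwise disjnt (B ` {1..t - 2})"
        using B(1) by (intro disjoint_family_on_imp_pairwise_disjnt) (auto simp: disjoint_family_on_def)
      have LD: "L \<inter> D = {}" "L \<noteq> D" using xV B0 by (auto simp: L_def D_def)
      have LB: "L \<inter> B i = {}" "L \<noteq> B i" if "i \<in> {1..t - 2}" for i
        using xV Bi[OF that] by auto
      have "k + W \<le> W * real (missing D) + (\<Sum>A\<in>Q - {D}. real (missing A))"
        unfolding k_def
      proof (rule swap_loss[OF t(3) W(1)])
        show "W \<le> real t - 2" using W by (simp add: k_def)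
        show "L \<in> H 0" by (rule L)
        show "pairwise disjnt (insert L Q)"
        proof -
          have "disjnt D A" "disjnt A D" "disjnt L A" "disjnt A L" if "A \<in> B ` {1..t - 2}" for A
          proof -
            obtain i where "i \<in> {1..t - 2}" "A = B i" using \<open>A \<in> B ` {1..t - 2}\<close> by (rule imageE)
            then have "D \<inter> A = {}" "L \<inter> A = {}" using DB LB by auto
            then show "disjnt D A" "disjnt A D" "disjnt L A" "disjnt A L" by (auto simp: disjnt_def)
          qed
          moreover have "disjnt L D" "disjnt D L" using LD by (auto simp: disjnt_def)
          ultimately show ?thesis using pwB unfolding Q_def pairwise_insert by blast
        qed
        show "L \<notin> Q" using LD(2) LB(2) unfolding Q_def by blast
        have "card Q = Suc (card (B ` {1..t - 2}))" unfolding Q_def using DnB by simp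
        then show "card Q = t - 1" using inj t(3) by (simp add: card_image)
      qed (auto simp: Q_def)
      moreover have "Q - {D} = B ` {1..t - 2}" using DnB by (auto simp: Q_def)
      moreover have "(\<Sum>A\<in>B ` {1..t - 2}. real (missing A)) = (\<Sum>i\<in>{1..t - 2}. real (missing (B i)))"
        unfolding sum.reindex[OF inj] by (simp only: o_def)
      ultimately show "k + W \<le> (\<Sum>i\<in>?I. ?g i (B i))"
        unfolding I by (simp add: D_def)
    qed simp
    also have "\<dots> = W * (b x / C1) + k * (a / C0)"
    proof -
      have "real (t - 2) = k" using t(3) by (simp add: k_def of_nat_diff)
      then show ?thesis
        unfolding I by (simp add: a_def b_def C0_def C1_def cV sum_distrib_left[symmetric])
    qed
    finally show ?thesis .
  qed
  have le_S: "a + (\<Sum>x\<in>X. b x) \<le> total_missing"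
  proof -
    let ?ins = "\<lambda>(x, A). insert x A"
    have XV: "X \<inter> V = {}" using X(1) by (auto simp: V_def)
    have inj: "inj_on ?ins (X \<times> nsets V (l - 1))"
    proof (rule inj_onI)
      fix p p' assume p: "p \<in> X \<times> nsets V (l - 1)" "p' \<in> X \<times> nsets V (l - 1)" "?ins p = ?ins p'"
      obtain x A y B where xy: "p = (x, A)" "p' = (y, B)" by (cases p, cases p')
      then have "x \<notin> B" "y \<notin> A" "x \<notin> A" "y \<notin> B" "insert x A = insert y B"
        using p XV by (auto simp: nsets_def)
      then have "x = y \<and> A = B" by (metis insert_ident insert_iff)
      then show "p = p'" using xy by simp
    qed
    have "(\<Sum>x\<in>X. b x) = (\<Sum>p\<in>X \<times> nsets V (l - 1). real (missing (?ins p)))"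
      using finX by (simp add: b_def sum.cartesian_product case_prod_unfold)
    also have "\<dots> = (\<Sum>A\<in>?ins ` (X \<times> nsets V (l - 1)). real (missing A))"
      unfolding sum.reindex[OF inj] by (simp only: o_def)
    finally have 1: "(\<Sum>x\<in>X. b x) = (\<Sum>A\<in>?ins ` (X \<times> nsets V (l - 1)). real (missing A))" .
    have fin: "finite (nsets V l)" "finite (?ins ` (X \<times> nsets V (l - 1)))"
      using finV finX by (auto intro: finite_imp_finite_nsets)
    have "nsets V l \<inter> ?ins ` (X \<times> nsets V (l - 1)) = {}" using XV by (auto simp: nsets_def)
    then have "a + (\<Sum>x\<in>X. b x) = (\<Sum>A\<in>nsets V l \<union> ?ins ` (X \<times> nsets V (l - 1)). real (missing A))"
      unfolding 1 a_def using fin by (simp add: sum.union_disjoint)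
    also have "\<dots> \<le> total_missing"
      unfolding total_missing_def
    proof (rule sum_mono2)
      have "insert x A \<in> nsets {1..m} l" if "x \<in> X" "A \<in> nsets V (l - 1)" for x A
      proof -
        have "x \<notin> A" "A \<subseteq> V" "finite A" "card A = l - 1" using that XV by (auto simp: nsets_def)
        moreover have "x \<in> {1..m}" using that X(1) m l_pos by auto
        moreover have "V \<subseteq> {1..m}" by (auto simp: V_def)
        ultimately show ?thesis using l_pos by (auto simp: nsets_def)
      qed
      moreover have "nsets V l \<subseteq> nsets {1..m} l" by (intro nsets_mono) (auto simp: V_def)
      ultimately show "nsets V l \<union> ?ins ` (X \<times> nsets V (l - 1)) \<subseteq> nsets {1..m} l" by auto
    qed (auto intro: finite_imp_finite_nsets)
    finally show ?thesis .
  qed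
  have C0: "0 < C0" using m l_pos by (simp add: C0_def v_def)
  have C01: "C0 * real l = C1 * M2"
  proof -
    have "l * (v choose l) = v * ((v - 1) choose (l - 1))"
      using binomial_absorption[of "l - 1" v] l_pos by simp
    also have "\<dots> = (v - (l - 1)) * (v choose (l - 1))" by (rule binomial_absorb_comp[symmetric])
    finally have "l * (v choose l) = (v - (l - 1)) * (v choose (l - 1))" .
    moreover have "real (v - (l - 1)) = M2" using m l_pos by (simp add: v_def M2_def of_nat_diff)
    ultimately show ?thesis unfolding C0_def C1_def by (metis mult.commute of_nat_mult)
  qed
  then have C1: "C1 = C0 * real l / M2" using M2 by (simp add: eq_divide_eq)
  have a0: "0 \<le> a" and b0: "0 \<le> b x" for x unfolding a_def b_def by (auto intro: sum_nonneg)
  have "z * (k + W) = (\<Sum>x\<in>X. k + W)" by (simp add: z_def)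
  also have "\<dots> \<le> (\<Sum>x\<in>X. W * (b x / C1) + k * (a / C0))" using each by (intro sum_mono)
  also have "\<dots> = (W / C1) * (\<Sum>x\<in>X. b x) + z * k / C0 * a"
    by (simp add: sum.distrib z_def sum_distrib_left)
  also have "\<dots> \<le> (z * k / C0) * (\<Sum>x\<in>X. b x) + z * k / C0 * a"
  proof -
    have "W / C1 = W * M2 / (C0 * real l)" using C1 by simp
    also have "\<dots> \<le> (z * real l * k / M2) * M2 / (C0 * real l)"
      using M2 C0 l1 by (intro divide_right_mono mult_right_mono) (auto simp: W_def)
    also have "\<dots> = z * k / C0" using M2 l1 C0 by simp
    finally show ?thesis using b0 by (intro add_right_mono mult_right_mono sum_nonneg) auto
  qed
  also have "\<dots> = (z * k / C0) * (a + (\<Sum>x\<in>X. b x))" by (simp only: distrib_left add.commute)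
  also have "\<dots> \<le> (z * k / C0) * total_missing"
    using le_S z k C0 by (intro mult_left_mono) auto
  finally have "z * (k + W) \<le> (z * k / C0) * total_missing" .
  then have "C0 * (z * (k + W)) \<le> z * k * total_missing" using C0 by (simp add: field_simps)
  moreover have "C0 * (z * (k + W)) = (z * k) * (C0 * (1 + W / k))"
    using k by (simp add: field_simps)
  ultimately have "(z * k) * (C0 * (1 + W / k)) \<le> (z * k) * total_missing" by simp
  then have main: "C0 * (1 + W / k) \<le> total_missing" using z k by (simp add: mult_le_cancel_left_pos)
  have Wk: "W / k = min 1 (z * real l / M2)"
    using k by (simp add: W_def min_divide_distrib_right)
  \<comment> \<open>\<open>C0\<close> counts the sets avoiding l + 1 points, the target only those
    avoiding l. The quotient \<open>M2 / (real m - real l)\<close> of the two is absorbed into the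
    stated gain.\<close>
  define c where "c = real ((m - l) choose l)"
  have c: "(real m - real l) * C0 = M2 * c"
  proof -
    have "(m - l - l) * ((m - l) choose l) = (m - l) * ((m - l - 1) choose l)"
      by (rule binomial_absorb_comp)
    moreover have "real (m - l - l) = M2" "real (m - l) = real m - real l"
      using m by (simp_all add: M2_def of_nat_diff)
    ultimately show ?thesis unfolding C0_def c_def v_def by (metis of_nat_mult)
  qed
  have ml: "0 < real m - real l" using m4 l1 by simp
  have "C0 = M2 * c / (real m - real l)" using c ml by (simp add: eq_divide_eq mult.commute)
  then have "C0 * (1 + W / k) = c * (M2 * (1 + min 1 (z * real l / M2)) / (real m - real l))"
    unfolding Wk by simp
  also have "M2 * (1 + min 1 (z * real l / M2)) = M2 + min M2 (z * real l)"
    using M2 by (simp add: min_mult_distrib_left distrib_left)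
  also have "\<dots> = (real m - real l) + min ((z - 1) * real l) (real m - 3 * real l)"
    by (simp add: M2_def min_def algebra_simps)
  also have "\<dots> / (real m - real l) = 1 + min ((z - 1) * real l) (real m - 3 * real l) / (real m - real l)"
    using ml by (simp add: add_divide_distrib)
  finally show ?thesis using main by (simp add: c_def z_def)
qed

end

text \<open>Pairs of an l-set and k indices whose blocks it avoids are counted in two ways; k
  disjoint blocks cover k l points.\<close>

lemma sum_choose_avoided:
  fixes B :: "nat \<Rightarrow> nat set"
  assumes disj: "disjoint_family_on B {..<q}" and B: "\<And>i. i < q \<Longrightarrow> B i \<in> nsets {1..m} l"
  shows "(\<Sum>A\<in>nsets {1..m} l. card {i \<in> {..<q}. A \<inter> B i = {}} choose k)
    = (q choose k) * ((m - k * l) choose l)"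
proof -
  let ?N = "nsets {1..m} l"
  have "(\<Sum>A\<in>?N. card {i \<in> {..<q}. A \<inter> B i = {}} choose k)
      = (\<Sum>A\<in>?N. card {p \<in> nsets {..<q} k. A \<inter> (\<Union>i\<in>p. B i) = {}})"
  proof (rule sum.cong[OF refl])
    fix A
    have "{p \<in> nsets {..<q} k. A \<inter> (\<Union>i\<in>p. B i) = {}} = nsets {i \<in> {..<q}. A \<inter> B i = {}} k"
      by (auto simp: nsets_def)
    then show "card {i \<in> {..<q}. A \<inter> B i = {}} choose k = card {p \<in> nsets {..<q} k. A \<inter> (\<Union>i\<in>p. B i) = {}}"
      by (simp add: card_nsets)
  qed
  also have "\<dots> = (\<Sum>p\<in>nsets {..<q} k. card {A \<in> ?N. A \<inter> (\<Union>i\<in>p. B i) = {}})"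
    by (rule sum_multicount_gen) (auto intro: finite_imp_finite_nsets)
  also have "\<dots> = (\<Sum>p\<in>nsets {..<q} k. (m - k * l) choose l)"
  proof (rule sum.cong[OF refl])
    fix p assume p: "p \<in> nsets {..<q} k"
    then have ps: "p \<subseteq> {..<q}" "finite p" "card p = k" by (auto simp: nsets_def)
    have "card (\<Union>i\<in>p. B i) = (\<Sum>i\<in>p. card (B i))"
    proof (rule card_UN_disjoint)
      show "\<forall>i\<in>p. finite (B i)" using ps B by (auto simp: nsets_def)
      show "\<forall>i\<in>p. \<forall>j\<in>p. i \<noteq> j \<longrightarrow> B i \<inter> B j = {}"
        using disj ps(1) unfolding disjoint_family_on_def by blast
    qed (rule ps(2))
    also have "\<dots> = k * l" using ps B by (simp add: nsets_def subset_eq)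
    finally have "card ({1..m} - (\<Union>i\<in>p. B i)) = m - k * l"
      using ps B by (subst card_Diff_subset) (auto simp: nsets_def)
    moreover have "{A \<in> ?N. A \<inter> (\<Union>i\<in>p. B i) = {}} = nsets ({1..m} - (\<Union>i\<in>p. B i)) l"
      by (auto simp: nsets_def)
    ultimately show "card {A \<in> ?N. A \<inter> (\<Union>i\<in>p. B i) = {}} = (m - k * l) choose l"
      by (simp add: card_nsets)
  qed
  finally show ?thesis by (simp add: card_nsets)
qed

context dependent_chain
begin

text \<open>A random matching through two of the disjoint sets \<open>B\<^sub>i\<close>, where every block is weighted with the
  reciprocal of the number of pairs \<open>{B\<^sub>a, B\<^sub>b}\<close> that it avoids.\<close>

lemma total_missing_ge_avoiding_pairs:
  assumes disj: "disjoint_family_on B {..<q}" and B: "\<And>i. i < q \<Longrightarrow> B i \<in> H 0"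
    and t: "t * l \<le> m" "3 \<le> t"
    and large: "(q choose 2) * s \<le> t - 2 \<or> (2 * s \<le> t \<and> 4 * (q choose 2)\<^sup>2 + 2 \<le> t)"
  shows "2 * real (card {A \<in> nsets {1..m} l. 2 \<le> card {i \<in> {..<q}. A \<inter> B i = {}}}) \<le> total_missing"
proof -
  let ?N = "nsets {1..m} l"
  define w where "w A = card {i \<in> {..<q}. A \<inter> B i = {}}" for A
  \<comment> \<open>\<open>U A\<close> is 0 when fewer than two blocks are avoided, since division
    by zero yields 0; such sets drop out.\<close>
  define U where "U A = 1 / real (w A choose 2)" for A
  define \<kappa> where "\<kappa> = real (q choose 2)"
  have finN: "finite ?N" by (simp add: finite_imp_finite_nsets)
  have wq: "w A \<le> q" for A
  proof -
    have "card {i \<in> {..<q}. A \<inter> B i = {}} \<le> card {..<q}" by (intro card_mono) auto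
    then show ?thesis by (simp add: w_def)
  qed
  have Bs: "B i \<subseteq> {1..m}" "finite (B i)" "card (B i) = l" if "i < q" for i
    using B[OF that] H_sub[of 0] by (auto simp: nsets_def)
  have Bne: "B i \<noteq> {}" if "i < q" for i using Bs[OF that] l_pos by auto
  have l3: "3 * l \<le> m"
  proof -
    have "3 * l \<le> t * l" using t(2) by (rule mult_le_mono1)
    then show ?thesis using t(1) by (rule le_trans)
  qed
  have pair: "0 \<le> (\<Sum>A\<in>nsets ({1..m} - (\<Union>i\<in>p. B i)) l. U A * (real (missing A) - 2))"
    if p: "p \<in> nsets {..<q} 2" for p
  proof -
    have ps: "p \<subseteq> {..<q}" "finite p" "card p = 2" using p by (auto simp: nsets_def)
    have q2: "2 \<le> q" using ps card_mono[of "{..<q}" p] by simp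
    then have \<kappa>1: "1 \<le> \<kappa>" using zero_less_binomial[OF q2] unfolding \<kappa>_def by linarith
    let ?V = "{1..m} - (\<Union>i\<in>p. B i)"
    have "card (\<Union>i\<in>p. B i) = (\<Sum>i\<in>p. card (B i))"
    proof (rule card_UN_disjoint)
      show "\<forall>i\<in>p. finite (B i)" using ps Bs by (auto simp: nsets_def)
      show "\<forall>i\<in>p. \<forall>j\<in>p. i \<noteq> j \<longrightarrow> B i \<inter> B j = {}"
        using disj ps(1) unfolding disjoint_family_on_def by blast
    qed (rule ps(2))
    also have "\<dots> = 2 * l" using ps Bs by (simp add: subset_eq)
    finally have cV: "card ?V = m - 2 * l"
      using ps Bs by (subst card_Diff_subset) auto
    have "0 \<le> real (t - 2) * ((\<Sum>A\<in>nsets ?V l. U A * (real (missing A) - 2)) / real (card ?V choose l))"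
    proof (rule average_over_matchings)
      show "(t - 2) * l \<le> card ?V" using t cV by (simp add: diff_mult_distrib)
      fix Q assume Q: "Q \<subseteq> nsets ?V l" "pairwise disjnt Q" "finite Q" "card Q = t - 2"
      have inj: "inj_on B p"
        using disj ps Bne by (intro disjoint_family_on_imp_inj_on) (auto simp: disjoint_family_on_def)
      have cR: "card (B ` p) = 2" using inj ps by (simp add: card_image)
      have RQ: "disjnt (B i) A" "disjnt A (B i)" "B i \<noteq> A" if "i \<in> p" "A \<in> Q" for i A
      proof -
        show "disjnt (B i) A" "disjnt A (B i)" using that Q(1) by (auto simp: nsets_def disjnt_def)
        then show "B i \<noteq> A" using Bne[of i] ps that by (auto simp: disjnt_def)
      qed
      have w2: "2 \<le> w A" if "A \<in> Q" for A
      proof -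
        have "p \<subseteq> {i \<in> {..<q}. A \<inter> B i = {}}" using ps RQ(2) that by (auto simp: disjnt_def)
        then have "card p \<le> w A" unfolding w_def by (intro card_mono) auto
        then show ?thesis using ps by simp
      qed
      have U: "1 / \<kappa> \<le> U A" "U A \<le> 1" "0 \<le> U A" if "A \<in> Q" for A
      proof -
        have "1 \<le> w A choose 2" using zero_less_binomial[OF w2[OF that]] by linarith
        then have 1: "1 \<le> real (w A choose 2)" by linarith
        have "w A choose 2 \<le> q choose 2" using wq by (rule binomial_right_mono)
        then have 2: "real (w A choose 2) \<le> \<kappa>" by (simp add: \<kappa>_def)
        show "1 / \<kappa> \<le> U A" using 1 2 \<kappa>1 unfolding U_def by (intro divide_left_mono mult_pos_pos) linarith+
        show "U A \<le> 1" "0 \<le> U A" using 1 unfolding U_def by (simp_all only: divide_le_eq_1_pos) simp_all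
      qed
      have "\<exists>j E. card (B ` p) \<le> j \<and> j \<le> s \<and> E \<subseteq> Q \<and> card E + card (B ` p) \<le> j \<and>
           real j * (\<Sum>A\<in>Q - E. U A) \<le> (\<Sum>A\<in>Q. U A * real (missing A))"
      proof (rule weighted_loss)
        show "B ` p \<inter> Q = {}" using RQ(3) by blast
        have "disjoint_family_on B p" using disj ps by (auto simp: disjoint_family_on_def)
        then have Bp: "pairwise disjnt (B ` p)" by (rule disjoint_family_on_imp_pairwise_disjnt)
        show "pairwise disjnt (B ` p \<union> Q)"
        proof (rule pairwiseI)
          fix X Y assume "X \<in> B ` p \<union> Q" "Y \<in> B ` p \<union> Q" "X \<noteq> Y"
          then show "disjnt X Y"
            using pairwiseD[OF Bp, of X Y] pairwiseD[OF Q(2), of X Y] RQ(1,2) by fast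
        qed
        show "B ` p \<subseteq> H 0" using B ps by auto
      qed (use Q ps U in auto)
      then obtain j E where j: "2 \<le> j" "j \<le> s" "E \<subseteq> Q" "card E + 2 \<le> j"
        "real j * (\<Sum>A\<in>Q - E. U A) \<le> (\<Sum>A\<in>Q. U A * real (missing A))"
        unfolding cR by blast
      define T where "T = (\<Sum>A\<in>Q. U A)"
      have finE: "finite E" using j(3) Q(3) finite_subset by blast
      have T_le: "T \<le> real t - 2"
        using sum_mono[of Q U "\<lambda>_. 1"] U(2) Q(4) t(2) by (simp add: T_def of_nat_diff)
      have T_ge: "(real t - 2) / \<kappa> \<le> T"
        using sum_mono[of Q "\<lambda>_. 1 / \<kappa>" U] U(1) Q(4) t(2) by (simp add: T_def of_nat_diff)
      \<comment> \<open>Two prescribed members give j >= 2 and at most j - 2 exempt blocks. For j <=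
        T the loss exceeds 2 T by at least (j - 2) (T - j). Otherwise j > T >= (t - 2) / \<kappa>,
        which the first alternative of \<open>large\<close> excludes; under the second one j >= 4
        \<kappa>, and t / 2 blocks of weight at least 1 / \<kappa> give a loss of 2 t.\<close>
      have "2 * T \<le> real j * (\<Sum>A\<in>Q - E. U A)"
      proof (cases "real j \<le> T")
        case True
        have "(\<Sum>A\<in>E. U A) \<le> real (card E)"
          using sum_mono[of E U "\<lambda>_. 1"] U(2) j(3) by auto
        then have "(\<Sum>A\<in>E. U A) \<le> real j - 2" using j(4) by linarith
        moreover have "(\<Sum>A\<in>Q - E. U A) = T - (\<Sum>A\<in>E. U A)"
          unfolding T_def using Q(3) j(3) by (rule sum_diff)
        ultimately have "T - (real j - 2) \<le> (\<Sum>A\<in>Q - E. U A)" by linarith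
        then have "real j * (T - (real j - 2)) \<le> real j * (\<Sum>A\<in>Q - E. U A)"
          by (intro mult_left_mono) auto
        moreover have "0 \<le> (real j - 2) * (T - real j)"
          using True j(1) by (intro mult_nonneg_nonneg) auto
        ultimately show ?thesis by (simp add: algebra_simps)
      next
        case False
        have "\<not> (q choose 2) * s \<le> t - 2"
        proof
          assume "(q choose 2) * s \<le> t - 2"
          then have "real ((q choose 2) * s) \<le> real (t - 2)" by (simp only: of_nat_le_iff)
          then have "\<kappa> * real s \<le> real t - 2" using t(2) by (simp add: \<kappa>_def of_nat_diff)
          then have "real s \<le> (real t - 2) / \<kappa>" using \<kappa>1 by (simp add: le_divide_eq mult.commute)
          then show False using False j(2) T_ge by linarith
        qed
        then have big: "2 * s \<le> t" "4 * (q choose 2)\<^sup>2 + 2 \<le> t" using large by auto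
        have "real (4 * (q choose 2)\<^sup>2 + 2) \<le> real t" using big(2) by (simp only: of_nat_le_iff)
        then have "4 * \<kappa> * \<kappa> \<le> real t - 2" by (simp add: \<kappa>_def power2_eq_square)
        then have "4 * \<kappa> \<le> (real t - 2) / \<kappa>" using \<kappa>1 by (simp add: le_divide_eq)
        then have j4: "4 * \<kappa> \<le> real j" using False T_ge by linarith
        have "card (Q - E) = t - 2 - card E" using j(3) finE Q by (simp add: card_Diff_subset)
        then have "real t - real j \<le> real (card (Q - E))" using j(4) t(2) by linarith
        moreover have "real t / 2 \<le> real t - real j" using j(2) big(1) by linarith
        ultimately have "real t / 2 \<le> real (card (Q - E))" by linarith
        then have "real t / 2 / \<kappa> \<le> real (card (Q - E)) / \<kappa>"
          using \<kappa>1 by (intro divide_right_mono) auto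
        also have "\<dots> \<le> (\<Sum>A\<in>Q - E. U A)"
          using sum_mono[of "Q - E" "\<lambda>_. 1 / \<kappa>" U] U(1) by simp
        finally have "4 * \<kappa> * (real t / 2 / \<kappa>) \<le> real j * (\<Sum>A\<in>Q - E. U A)"
          using j4 \<kappa>1 by (intro mult_mono) auto
        moreover have "4 * \<kappa> * (real t / 2 / \<kappa>) = 2 * real t" using \<kappa>1 by simp
        ultimately show ?thesis using T_le by linarith
      qed
      then have "2 * T \<le> (\<Sum>A\<in>Q. U A * real (missing A))" using j(5) by linarith
      then show "0 \<le> (\<Sum>A\<in>Q. U A * (real (missing A) - 2))"
        by (simp add: T_def right_diff_distrib sum_subtractf sum_distrib_right[symmetric])
    qed (use l_pos in auto)
    moreover have "0 < real (t - 2)" using t(2) by simp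
    moreover have "0 < real (card ?V choose l)" using l3 cV by simp
    ultimately show ?thesis by (simp add: zero_le_mult_iff zero_le_divide_iff)
  qed
  \<comment> \<open>Over all pairs, a set avoiding w >= 2 of the blocks occurs
    \<open>w choose 2\<close> times with the reciprocal weight, so it counts exactly once.\<close>
  have "0 \<le> (\<Sum>p\<in>nsets {..<q} 2. \<Sum>A\<in>nsets ({1..m} - (\<Union>i\<in>p. B i)) l. U A * (real (missing A) - 2))"
    using pair by (rule sum_nonneg)
  also have "\<dots> = (\<Sum>p\<in>nsets {..<q} 2. \<Sum>A | A \<in> ?N \<and> A \<inter> (\<Union>i\<in>p. B i) = {}. U A * (real (missing A) - 2))"
    by (intro sum.cong refl) (auto simp: nsets_def)
  also have "\<dots> = (\<Sum>A\<in>?N. \<Sum>p | p \<in> nsets {..<q} 2 \<and> A \<inter> (\<Union>i\<in>p. B i) = {}. U A * (real (missing A) - 2))"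
    by (rule sum.swap_restrict) (auto intro: finite_imp_finite_nsets)
  also have "\<dots> = (\<Sum>A\<in>?N. if 2 \<le> w A then real (missing A) - 2 else 0)"
  proof (rule sum.cong[OF refl])
    fix A
    have "{p. p \<in> nsets {..<q} 2 \<and> A \<inter> (\<Union>i\<in>p. B i) = {}} = nsets {i \<in> {..<q}. A \<inter> B i = {}} 2"
      by (auto simp: nsets_def)
    then have "card {p. p \<in> nsets {..<q} 2 \<and> A \<inter> (\<Union>i\<in>p. B i) = {}} = w A choose 2"
      by (simp add: card_nsets w_def)
    then have "(\<Sum>p | p \<in> nsets {..<q} 2 \<and> A \<inter> (\<Union>i\<in>p. B i) = {}. U A * (real (missing A) - 2))
        = real (w A choose 2) * U A * (real (missing A) - 2)" by simp
    then show "(\<Sum>p | p \<in> nsets {..<q} 2 \<and> A \<inter> (\<Union>i\<in>p. B i) = {}. U A * (real (missing A) - 2))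
        = (if 2 \<le> w A then real (missing A) - 2 else 0)"
      by (simp add: U_def)
  qed
  also have "\<dots> \<le> (\<Sum>A\<in>?N. real (missing A) - (if 2 \<le> w A then 2 else 0))"
    by (intro sum_mono) auto
  also have "\<dots> = total_missing - 2 * real (card {A \<in> ?N. 2 \<le> w A})"
    using finN by (simp add: total_missing_def sum_subtractf sum.If_cases Int_def)
  finally show ?thesis by (simp add: w_def)
qed

text \<open>A Bonferroni inequality for avoiding at least two blocks:
  \<open>(w choose 2) - 2 * (w choose 3)\<close> is 1, 1, -2 for w = 2, 3, 4. Both terms have closed
  form averages, as they concern sets avoiding two or three given blocks.\<close>

lemma total_missing_ge_disjoint_members:
  assumes disj: "disjoint_family_on B {..<q}" and B: "\<And>i. i < q \<Longrightarrow> B i \<in> H 0" and q: "q \<le> 4"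
    and t: "t * l \<le> m" "3 \<le> t"
    and large: "(q choose 2) * s \<le> t - 2 \<or> (2 * s \<le> t \<and> 4 * (q choose 2)\<^sup>2 + 2 \<le> t)"
  shows "2 * (real (q choose 2) * real ((m - 2 * l) choose l) - 2 * real (q choose 3) * real ((m - 3 * l) choose l))
    \<le> total_missing"
proof -
  let ?N = "nsets {1..m} l"
  define w where "w A = card {i \<in> {..<q}. A \<inter> B i = {}}" for A
  have finN: "finite ?N" by (simp add: finite_imp_finite_nsets)
  have Bs: "B i \<in> ?N" if "i < q" for i using B[OF that] H_sub[of 0] by auto
  have ind: "real (w A choose 2) - 2 * real (w A choose 3) \<le> (if 2 \<le> w A then 1 else 0)" for A
  proof -
    have "card {i \<in> {..<q}. A \<inter> B i = {}} \<le> card {..<q}" by (intro card_mono) auto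
    then have "w A \<le> 4" using q by (simp add: w_def)
    then have "w A = 0 \<or> w A = 1 \<or> w A = 2 \<or> w A = 3 \<or> w A = 4" by linarith
    then show ?thesis by (auto simp: eval_nat_numeral)
  qed
  have "(\<Sum>A\<in>?N. real (w A choose k)) = real (q choose k) * real ((m - k * l) choose l)" for k
    using sum_choose_avoided[OF disj, of m l k] Bs by (simp add: w_def flip: of_nat_sum of_nat_mult)
  then have "real (q choose 2) * real ((m - 2 * l) choose l) - 2 * real (q choose 3) * real ((m - 3 * l) choose l)
      = (\<Sum>A\<in>?N. real (w A choose 2) - 2 * real (w A choose 3))"
    by (simp add: sum_subtractf sum_distrib_left[symmetric])
  also have "\<dots> \<le> (\<Sum>A\<in>?N. if 2 \<le> w A then 1 else 0)" by (intro sum_mono ind)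
  also have "\<dots> = real (card {A \<in> ?N. 2 \<le> w A})" using finN by (simp add: sum.If_cases Int_def)
  finally show ?thesis
    using total_missing_ge_avoiding_pairs[OF disj B t large] by (simp add: w_def)
qed

end

section \<open>Estimates for binomial coefficients\<close>

lemma binomial_diff_le:
  assumes "1 \<le> l"
  shows "(a choose l) \<le> ((a - b) choose l) + b * ((a - 1) choose (l - 1))"
proof (induction b)
  case (Suc b)
  have "((a - b) choose l) \<le> ((a - Suc b) choose l) + ((a - 1) choose (l - 1))"
  proof (cases "a - b")
    case (Suc c)
    then have c: "a - Suc b = c" by simp
    obtain k where k: "l = Suc k" using assms by (cases l) auto
    have "c choose k \<le> (a - 1) choose k" using Suc by (intro binomial_right_mono) auto
    then show ?thesis unfolding c Suc k by simp
  qed (use assms in auto)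
  then show ?case using Suc by simp
qed simp

text \<open>Bernoulli's inequality for a quotient of binomial coefficients, with denominators
  cleared: a random l-subset of a points hits b given points with probability at most b l /
  a.\<close>

lemma binomial_shift_ge_linear:
  assumes "1 \<le> l" "b \<le> a"
  shows "real (a choose l) * (real a - real b * real l) \<le> real a * real ((a - b) choose l)"
proof -
  have "l * (a choose l) = a * ((a - 1) choose (l - 1))"
    using binomial_absorption[of "l - 1" a] assms by simp
  then have 1: "real l * real (a choose l) = real a * real ((a - 1) choose (l - 1))"
    by (metis of_nat_mult)
  have "real (a choose l) \<le> real ((a - b) choose l) + real b * real ((a - 1) choose (l - 1))"
    using binomial_diff_le[OF assms(1), of a b] by (metis of_nat_add of_nat_le_iff of_nat_mult)
  then have "real a * real (a choose l) \<le> real a * (real ((a - b) choose l) + real b * real ((a - 1) choose (l - 1)))"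
    by (intro mult_left_mono) auto
  also have "\<dots> = real a * real ((a - b) choose l) + real b * (real l * real (a choose l))"
    unfolding 1 by (simp add: algebra_simps)
  finally show ?thesis by (simp add: algebra_simps)
qed

lemma Suc_times_binomial_Suc:
  "real (Suc k) * real (n choose Suc k) = (if k \<le> n then real n - real k else 0) * real (n choose k)"
proof (cases "k \<le> n")
  case True
  have "Suc k * (n choose Suc k) = n * ((n - 1) choose k)" by (rule binomial_absorption)
  also have "\<dots> = (n - k) * (n choose k)" by (rule binomial_absorb_comp[symmetric])
  finally have "real (Suc k * (n choose Suc k)) = real ((n - k) * (n choose k))" by (simp only:)
  then show ?thesis using True by (simp only: of_nat_mult of_nat_diff if_True)
next
  case False
  then show ?thesis by (simp del: binomial_Suc_Suc)
qed

text \<open>Factor by factor this is (a - i) (a + 2 b - i) <= (a + b - i)^2. It serves to bound the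
  share of sets avoiding three blocks by the square of the share avoiding two, both relative to the
  sets avoiding one.\<close>

lemma binomial_log_concave_upper:
  "real (a choose l) * real ((a + 2 * b) choose l) \<le> (real ((a + b) choose l))\<^sup>2"
proof (induction l)
  case (Suc l)
  show ?case
  proof (cases "l \<le> a")
    case False
    then show ?thesis by (simp add: binomial_eq_0 del: binomial_Suc_Suc)
  next
    case True
    define x y where "x = real a - real l" and "y = real b"
    have xy: "0 \<le> x" "0 \<le> y" using True by (auto simp: x_def y_def)
    have "(real (Suc l))\<^sup>2 * (real (a choose Suc l) * real ((a + 2 * b) choose Suc l))
        = (real (Suc l) * real (a choose Suc l)) * (real (Suc l) * real ((a + 2 * b) choose Suc l))"
      by (simp add: power2_eq_square)
    also have "\<dots> = (x * (x + 2 * y)) * (real (a choose l) * real ((a + 2 * b) choose l))"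
      unfolding Suc_times_binomial_Suc using True by (simp add: x_def y_def)
    also have "\<dots> \<le> (x + y)\<^sup>2 * (real ((a + b) choose l))\<^sup>2"
      using xy by (intro mult_mono Suc) (auto simp: power2_eq_square algebra_simps)
    also have "\<dots> = (real (Suc l) * real ((a + b) choose Suc l))\<^sup>2"
      unfolding Suc_times_binomial_Suc using True by (simp add: x_def y_def power_mult_distrib)
    also have "\<dots> = (real (Suc l))\<^sup>2 * (real ((a + b) choose Suc l))\<^sup>2" by (simp add: power_mult_distrib)
    finally show ?thesis by (simp del: binomial_Suc_Suc)
  qed
qed simp

text \<open>Each factor quotient (a - b - i) / (a - i) with i < l is at least its value at i =
  l.\<close>

lemma binomial_shift_ge_power:
  assumes "j \<le> l" "b + l < a"
  shows "real (a choose j) * ((real a - real l - real b) / (real a - real l)) ^ j \<le> real ((a - b) choose j)"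
  using assms(1)
proof (induction j)
  case (Suc j)
  define \<rho> where "\<rho> = (real a - real l - real b) / (real a - real l)"
  have \<rho>: "0 \<le> \<rho>" using assms(2) by (simp add: \<rho>_def)
  have le: "(real a - real j) * \<rho> \<le> real (a - b) - real j"
  proof -
    have pos: "0 < real a - real l" using assms(2) by simp
    have "\<rho> = 1 - real b / (real a - real l)" using pos by (simp add: \<rho>_def diff_divide_distrib)
    moreover have "real b \<le> (real a - real j) * (real b / (real a - real l))"
      using pos Suc.prems by (simp add: le_divide_eq mult.commute mult_left_mono)
    moreover have "real (a - b) = real a - real b" using assms(2) by simp
    ultimately show ?thesis by (simp add: right_diff_distrib)
  qed
  have "real (Suc j) * (real (a choose Suc j) * \<rho> ^ Suc j)
      = ((real a - real j) * \<rho>) * (real (a choose j) * \<rho> ^ j)"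
    using Suc_times_binomial_Suc[of j a] assms(2) Suc.prems by (simp add: mult_ac del: binomial_Suc_Suc)
  also have "\<dots> \<le> (real (a - b) - real j) * real ((a - b) choose j)"
    using le Suc \<rho> assms(2) by (intro mult_mono) (auto simp: \<rho>_def)
  also have "\<dots> = real (Suc j) * real ((a - b) choose Suc j)"
    using Suc_times_binomial_Suc[of j "a - b"] assms(2) Suc.prems by simp
  finally have "real (a choose Suc j) * \<rho> ^ Suc j \<le> real ((a - b) choose Suc j)"
    by (rule mult_left_le_imp_le) simp
  then show ?case by (simp only: \<rho>_def)
qed simp

text \<open>With y = m - 3 l the quotient is at least (1 + l / y) to the power -l, and l^2 <= y
  makes this at least 1 / e, hence at least 1/3.\<close>

lemma binomial_shift_ge_third:
  assumes "1 \<le> l" "3 * l < m" "l * l \<le> m - 3 * l"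
  shows "real ((m - l) choose l) / 3 \<le> real ((m - 2 * l) choose l)"
proof -
  define y where "y = real m - 3 * real l"
  have y: "0 < y" using assms(2) by (simp add: y_def)
  have ly: "real l * real l \<le> y"
  proof -
    have "real (l * l) \<le> real (m - 3 * l)" using assms(3) by (simp only: of_nat_le_iff)
    then show ?thesis using assms(2) by (simp add: y_def of_nat_diff)
  qed
  have "(1 + real l / y) ^ l \<le> exp (real l / y) ^ l"
    using y by (intro power_mono exp_ge_add_one_self) (auto intro: add_nonneg_nonneg)
  also have "\<dots> = exp (real l * (real l / y))" by (rule exp_of_nat_mult[symmetric])
  also have "\<dots> \<le> exp 1" using ly y by (simp add: divide_le_eq)
  also have "\<dots> \<le> 3" by (rule exp_le)
  finally have 3: "(1 + real l / y) ^ l \<le> 3" .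
  have "real ((m - l) choose l) * ((real (m - l) - real l - real l) / (real (m - l) - real l)) ^ l
      \<le> real ((m - l - l) choose l)"
    using assms by (intro binomial_shift_ge_power) auto
  moreover have "(real (m - l) - real l - real l) / (real (m - l) - real l) = 1 / (1 + real l / y)"
  proof -
    have "real (m - l) - real l - real l = y" "real (m - l) - real l = y + real l"
      using assms(2) by (simp_all add: y_def of_nat_diff)
    moreover have "1 + real l / y = (y + real l) / y" using y by (simp add: add_divide_distrib)
    ultimately show ?thesis by simp
  qed
  moreover have "m - l - l = m - 2 * l" by simp
  ultimately have "real ((m - l) choose l) * (1 / (1 + real l / y) ^ l) \<le> real ((m - 2 * l) choose l)"
    by (simp only: power_one_over)
  moreover have "real ((m - l) choose l) * (1 / 3) \<le> real ((m - l) choose l) * (1 / (1 + real l / y) ^ l)"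
  proof (rule mult_left_mono)
    have "0 < 1 + real l / y" using y by (simp add: add_pos_nonneg)
    then have "0 < (1 + real l / y) ^ l" by (rule zero_less_power)
    then show "1 / 3 \<le> 1 / (1 + real l / y) ^ l" using 3 by (intro divide_left_mono) simp_all
  qed simp
  ultimately have "real ((m - l) choose l) * (1 / 3) \<le> real ((m - 2 * l) choose l)"
    by (rule order_trans[rotated])
  then show ?thesis by simp
qed

text \<open>The condition \<open>real r + 1 \<le> D * g\<close> of \<open>chain_bound\<close> for g
  = 3/10. Here 21 is the least value of 24 - r <= t - 2 r - 1, and 26 bounds t - 1.\<close>

lemma few_disjoint_members_arith:
  assumes "r \<le> 3" "r + 25 \<le> t" "27 \<le> t"
  shows "real r + 1 \<le> ((real t - 1) * (1 - 1 / (real t - 2 * real r - 1)) - (real r + 1)) * (3 / 10)"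
proof -
  have e: "21 \<le> real t - 2 * real r - 1" using assms by linarith
  then have "1 / (real t - 2 * real r - 1) \<le> 1 / 21" by (intro divide_left_mono) auto
  then have "26 * (20 / 21) \<le> (real t - 1) * (1 - 1 / (real t - 2 * real r - 1))"
    using assms by (intro mult_mono) linarith+
  moreover have "real r + 1 \<le> (X - (real r + 1)) * (3 / 10)" if "26 * (20 / 21) \<le> X" for X
    using that assms(1) by simp
  ultimately show ?thesis by blast
qed

text \<open>The same condition for g = 5/8. It asks for a product of at least (1 + 8/5) (r + 1),
  which is where 13/5 comes from.\<close>

lemma many_disjoint_members_arith:
  assumes "3 \<le> r" "r + 25 \<le> t" "3 * r + 2 \<le> t"
  shows "real r + 1 \<le> ((real t - 1) * (1 - 1 / (real t - 2 * real r - 1)) - (real r + 1)) * (5 / 8)"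
proof -
  have main: "(real r + 1) * (13 / 5) \<le> (real t - 1) * (1 - 1 / (real t - 2 * real r - 1))"
  \<comment> \<open>Up to r = 11 the bound t >= r + 25 is the stronger one, beyond that t >= 3 r +
    2.\<close>
  proof (cases "r \<le> 11")
    case True
    have "24 - real r \<le> real t - 2 * real r - 1" using assms by linarith
    then have "1 / (real t - 2 * real r - 1) \<le> 1 / (24 - real r)" using True by (intro divide_left_mono) auto
    moreover have "1 / (24 - real r) \<le> 1" using True by simp
    ultimately have "(real r + 24) * (1 - 1 / (24 - real r)) \<le> (real t - 1) * (1 - 1 / (real t - 2 * real r - 1))"
      using assms by (intro mult_mono) linarith+
    moreover have "(real r + 1) * (13 / 5) \<le> (real r + 24) * (1 - 1 / (24 - real r))"
    proof -
      have "r \<in> {3, 4, 5, 6, 7, 8, 9, 10, 11}" using True assms(1) by auto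
      then show ?thesis by auto
    qed
    ultimately show ?thesis by linarith
  next
    case False
    have "real r + 1 \<le> real t - 2 * real r - 1" using assms by linarith
    then have "1 / (real t - 2 * real r - 1) \<le> 1 / (real r + 1)" by (intro divide_left_mono) auto
    moreover have "1 / (real r + 1) \<le> 1" by simp
    ultimately have "(3 * real r + 1) * (1 - 1 / (real r + 1)) \<le> (real t - 1) * (1 - 1 / (real t - 2 * real r - 1))"
      using assms by (intro mult_mono) linarith+
    moreover have "(real r + 1) * (13 / 5) \<le> (3 * real r + 1) * (1 - 1 / (real r + 1))"
    proof -
      have r: "12 \<le> real r" using False by simp
      have "0 \<le> (real r - 12) * (2 * real r + 3)" using r by (intro mult_nonneg_nonneg) auto
      then have "(real r + 1) * (13 / 5) * (real r + 1) \<le> (3 * real r + 1) * real r"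
        using r by (simp add: algebra_simps)
      then show ?thesis by (simp add: field_simps)
    qed
    ultimately show ?thesis by linarith
  qed
  moreover have "real r + 1 \<le> (X - (real r + 1)) * (5 / 8)" if "(real r + 1) * (13 / 5) \<le> X" for X
    using that by simp
  ultimately show ?thesis by blast
qed

section \<open>The bound for chains\<close>

text \<open>A member omitting some x <= y has in every prefix at most as many points as {1..l + 1}
  without y. With x = y = 1 this shows that all members contain 1 unless {2..l + 1} is a
  member.\<close>

lemma shifted_omit:
  assumes sh: "shifted m F" "F \<subseteq> nsets {1..m} l" and B: "B \<in> F" "x \<notin> B"
    and xy: "1 \<le> x" "x \<le> y" "y \<le> l + 1" and m: "l + 1 \<le> m"
  shows "{1..l + 1} - {y} \<in> F"
proof (rule shifted_dominates[OF sh B(1)])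
  have y: "y \<in> {1..l + 1}" using xy by auto
  have cC: "card ({1..l + 1} - {y}) = l" using y by simp
  then show "{1..l + 1} - {y} \<in> nsets {1..m} l" using m by (auto simp: nsets_def)
  have Bs: "finite B" "card B = l" using B sh(2) by (auto simp: nsets_def)
  fix i
  consider "l + 1 \<le> i" | "y \<le> i" "i \<le> l" | "i < y" by linarith
  then show "card (B \<inter> {1..i}) \<le> card (({1..l + 1} - {y}) \<inter> {1..i})"
  proof cases
    case 1
    then have "({1..l + 1} - {y}) \<inter> {1..i} = {1..l + 1} - {y}" by auto
    then show ?thesis using cC Bs card_mono[of B "B \<inter> {1..i}"] by (metis inf_le1)
  next
    case 2
    then have "({1..l + 1} - {y}) \<inter> {1..i} = {1..i} - {y}" by auto
    moreover have "card ({1..i} - {y}) = i - 1" "card ({1..i} - {x}) = i - 1" using 2 xy by auto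
    moreover have "card (B \<inter> {1..i}) \<le> card ({1..i} - {x})" using B(2) by (intro card_mono) auto
    ultimately show ?thesis by metis
  next
    case 3
    then have "({1..l + 1} - {y}) \<inter> {1..i} = {1..i}" using xy by auto
    then show ?thesis by (metis card_mono finite_atLeastAtMost inf_le2)
  qed
qed

lemma two_times_choose_two: "2 * real (n choose 2) = real n * (real n - 1)"
  using Suc_times_binomial_Suc[of 1 n]
  by (cases n) (simp_all add: numeral_2_eq_2 mult.commute del: binomial_Suc_Suc)

context dependent_chain
begin

lemma card_matching_le:
  assumes "M \<subseteq> H 0" "pairwise disjnt M" "finite M"
  shows "card M \<le> s"
  using loss[of "{}" M] assms by auto

lemma total_missing_ge_one_member:
  assumes B: "B \<in> H 0" and t: "t * l \<le> m" "s + 1 \<le> t" "1 \<le> s"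
  shows "real ((m - l) choose l) \<le> total_missing"
proof -
  have "(\<Sum>A\<in>nsets ({1..m} - B) l. real (missing A)) \<le> total_missing"
    unfolding total_missing_def
    by (intro sum_mono2 nsets_mono) (auto intro: finite_imp_finite_nsets)
  then show ?thesis using missing_disjoint_from_member[OF assms] by linarith
qed

text \<open>If the first family is a full star of edges then averaging over all its members beats the
  bound from any bounded number of them.\<close>

lemma total_missing_ge_full_star:
  assumes l: "l = 2" and star: "\<And>y. y \<in> {2..m} \<Longrightarrow> {1, y} \<in> H 0"
    and t: "t * l \<le> m" "s + 1 \<le> t" "1 \<le> s" and m: "4 \<le> m"
  shows "(real m - 1) * (real m - 2) / 2 \<le> total_missing"
proof -
  let ?N = "nsets {1..m} 2"
  have finN: "finite ?N" by (simp add: finite_imp_finite_nsets)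
  have "real (m - 1) * real ((m - 2) choose 2) = (\<Sum>y\<in>{2..m}. real ((m - l) choose l))"
    using m by (simp add: l)
  also have "\<dots> \<le> (\<Sum>y\<in>{2..m}. \<Sum>A\<in>nsets ({1..m} - {1, y}) l. real (missing A))"
    using missing_disjoint_from_member[OF star t] by (intro sum_mono)
  also have "\<dots> = (\<Sum>y\<in>{2..m}. \<Sum>A | A \<in> ?N \<and> A \<inter> {1, y} = {}. real (missing A))"
    unfolding l by (intro sum.cong refl) (auto simp: nsets_def)
  also have "\<dots> = (\<Sum>A\<in>?N. \<Sum>y | y \<in> {2..m} \<and> A \<inter> {1, y} = {}. real (missing A))"
    by (rule sum.swap_restrict) (auto intro: finite_imp_finite_nsets)
  also have "\<dots> \<le> (\<Sum>A\<in>?N. (real m - 3) * real (missing A))"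
  proof (rule sum_mono)
    fix A assume A: "A \<in> ?N"
    then have As: "A \<subseteq> {1..m}" "card A = 2" "finite A" by (auto simp: nsets_def)
    \<comment> \<open>\<open>A\<close> meets every edge of the star if it contains 1, and exactly
      two of the m - 1 edges otherwise.\<close>
    have "card {y \<in> {2..m}. A \<inter> {1, y} = {}} \<le> m - 3"
    proof (cases "1 \<in> A")
      case False
      have "A \<subseteq> {2..m}"
      proof
        fix x assume "x \<in> A"
        then have "1 \<le> x" "x \<le> m" "x \<noteq> 1" using False As(1) by auto
        then show "x \<in> {2..m}" by simp
      qed
      then have "card ({2..m} - A) = m - 1 - 2" using As by (simp add: card_Diff_subset)
      moreover have "{y \<in> {2..m}. A \<inter> {1, y} = {}} = {2..m} - A" using False by auto
      ultimately show ?thesis by simp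
    qed auto
    then have "real (card {y \<in> {2..m}. A \<inter> {1, y} = {}}) \<le> real m - 3" using m by linarith
    then have "real (card {y \<in> {2..m}. A \<inter> {1, y} = {}}) * real (missing A) \<le> (real m - 3) * real (missing A)"
      by (intro mult_right_mono) auto
    then show "(\<Sum>y | y \<in> {2..m} \<and> A \<inter> {1, y} = {}. real (missing A)) \<le> (real m - 3) * real (missing A)"
      by simp
  qed
  also have "\<dots> = (real m - 3) * total_missing"
    unfolding total_missing_def unfolding l by (rule sum_distrib_left[symmetric])
  finally have 1: "real (m - 1) * real ((m - 2) choose 2) \<le> (real m - 3) * total_missing" .
  have c2: "real ((m - 2) choose 2) = (real m - 2) * (real m - 3) / 2"
    using two_times_choose_two[of "m - 2"] m by (simp add: of_nat_diff)
  have "real (m - 1) * real ((m - 2) choose 2) = (real m - 3) * ((real m - 1) * (real m - 2) / 2)"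
    unfolding c2 using m by (simp add: of_nat_diff)
  then have "(real m - 3) * ((real m - 1) * (real m - 2) / 2) \<le> (real m - 3) * total_missing"
    using 1 by (simp only:)
  moreover have "0 < real m - 3" using m by simp
  ultimately show ?thesis by (simp only: mult_le_cancel_left_pos)
qed

text \<open>All members of \<open>H 0\<close> contain 1, so r = 1. A single member is settled by
  \<open>C\<close> alone. Otherwise {1..l + 1} without l + 1 and without l are members. If omitting
  l - 1 gives a member too, three swaps together with the linear bound suffice. If not, every member
  is {1..l - 1} plus a point, so there are at most m - l + 1 of them, and the gain
  \<open>(m - l - 1) choose (l - 1)\<close> from two swaps pays for them. It falls short, by one,
  only for the full star with l = 2.\<close>

lemma chain_bound_centered:
  assumes l: "2 \<le> l" and t: "t * l \<le> m" "m < (t + 1) * l" "s + 25 \<le> t" "2 * s + 2 \<le> t" "1 \<le> s"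
    and sh: "shifted m (H 0)" and ne: "H 0 \<noteq> {}" and center: "{1..l + 1} - {1} \<notin> H 0"
  shows "real ((m - l) choose l) - 1 + real (card (H 0)) \<le> total_missing"
proof -
  have F: "H 0 \<subseteq> nsets {1..m} l" using H_sub by simp
  define C f S where "C = real ((m - l) choose l)" and "f = real (card (H 0))" and "S = total_missing"
  have "26 * l \<le> t * l" using t by (intro mult_le_mono1) simp
  then have m26: "26 * l \<le> m" using t(1) by (rule le_trans)
  have l1m: "l + 1 \<le> m" using m26 l by simp
  have finF: "finite (H 0)" using F finite_subset finite_imp_finite_nsets by blast
  have init: "{1..l} \<in> H 0" using shifted_initial_segment[OF sh F ne] .
  have init': "{1..l + 1} - {l + 1} \<in> H 0"
  proof -
    have "{1..l + 1} - {l + 1} = {1..l}" by auto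
    then show ?thesis using init by simp
  qed
  have one: "1 \<in> B" if "B \<in> H 0" for B
    using shifted_omit[OF sh F that, of 1 1] center l1m by auto
  have "card M \<le> 1" if M: "M \<subseteq> H 0" "pairwise disjnt M" "finite M" for M
  proof (rule ccontr)
    assume "\<not> card M \<le> 1"
    then obtain A B where AB: "A \<in> M" "B \<in> M" "A \<noteq> B"
      by (metis One_nat_def card_le_Suc0_iff_eq M(3))
    then have "disjnt A B" using M(2) by (auto dest: pairwiseD)
    moreover have "1 \<in> A" "1 \<in> B" using one AB M(1) by blast+
    ultimately show False unfolding disjnt_def by blast
  qed
  then have lin: "(real t - 1) * f \<le> S"
    using total_missing_ge_linear[of t 1] t by (simp add: f_def S_def)
  have m': "26 * real l \<le> real m" using m26 by linarith
  have l': "2 \<le> real l" using l by simp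
  have t': "26 \<le> real t" using t by linarith
  have tl: "real m < (real t + 1) * real l"
    using t(2) by (metis of_nat_1 of_nat_add of_nat_less_iff of_nat_mult)
  have C: "0 < C" using m26 l by (simp add: C_def)
  have "f \<le> 1 \<or> C - 1 + f \<le> S"
  proof (cases "card (H 0) \<le> 1")
    case False
    then obtain B where B: "B \<in> H 0" "B \<noteq> {1..l}" using finF by (metis One_nat_def card_le_Suc0_iff_eq)
    have Bs: "finite B" "card B = l" using B F by (auto simp: nsets_def)
    then have "\<not> {1..l} \<subseteq> B" using B(2) card_subset_eq[of B "{1..l}"] by auto
    then obtain x where "x \<in> {1..l}" "x \<notin> B" by (meson subsetI)
    then have swap: "{1..l + 1} - {l} \<in> H 0"
      using shifted_omit[OF sh F B(1), of x l] l1m by auto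
    note ge_swap = total_missing_ge_swap[OF t(1,2) _ t(5), folded C_def S_def]
    have "C - 1 + f \<le> S"
    proof (cases "{1..l + 1} - {l - 1} \<in> H 0")
      case True
      have card3: "card {l - 1, l, l + 1} = 3"
      proof -
        have "l - 1 \<noteq> l" "l - 1 \<noteq> l + 1" using l by linarith+
        then show ?thesis by simp
      qed
      have "C * (1 + min ((real (card {l - 1, l, l + 1}) - 1) * real l) (real m - 3 * real l) / (real m - real l)) \<le> S"
        using True swap init' t l m26 card3 by (intro ge_swap) auto
      then have g: "C * (1 + min (2 * real l) (real m - 3 * real l) / (real m - real l)) \<le> S" unfolding card3 by simp
      show ?thesis
      proof (rule ccontr)
        assume "\<not> ?thesis"
        then have *: "S < C - 1 + f" by simp
        define \<mu> where "\<mu> = min (2 * real l) (real m - 3 * real l)"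
        have ml: "0 < real m - real l" using m' l' by simp
        \<comment> \<open>The linear bound keeps f below C / (t - 2), the swap bound forces it above
          C \<mu> / (m - l). These are incompatible because (t - 2) \<mu> >= m - l in both branches
          of the minimum.\<close>
        have "(real t - 2) * f < C" using * lin by (simp add: algebra_simps)
        moreover have "C * (\<mu> / (real m - real l)) < f" using * g by (simp add: \<mu>_def distrib_left)
        ultimately have "(real t - 2) * (C * (\<mu> / (real m - real l))) < C"
          using t' mult_strict_left_mono[of "C * (\<mu> / (real m - real l))" f "real t - 2"] by linarith
        then have "C * ((real t - 2) * \<mu> / (real m - real l)) < C * 1" by (simp add: mult_ac)
        then have "(real t - 2) * \<mu> / (real m - real l) < 1" using C by (simp only: mult_less_cancel_left_pos)
        then have less: "(real t - 2) * \<mu> < real m - real l" using ml by (simp add: divide_less_eq)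
        have "real m - real l \<le> (real t - 2) * (2 * real l)"
          using tl m' by (simp add: algebra_simps)
        moreover have "real m - real l \<le> (real t - 2) * (real m - 3 * real l)"
        proof -
          have "2 * (real m - 3 * real l) \<le> (real t - 2) * (real m - 3 * real l)"
            using t' m' l' by (intro mult_right_mono) auto
          then show ?thesis using m' l' by simp
        qed
        ultimately show False using less by (auto simp: \<mu>_def min_def split: if_splits)
      qed
    next
      case False
      have F_star: "\<exists>y\<in>{l..m}. B = insert y {1..l - 1}" if B: "B \<in> H 0" for B
      proof -
        have Bs: "finite B" "card B = l" "B \<subseteq> {1..m}" using B F by (auto simp: nsets_def)
        have sub: "{1..l - 1} \<subseteq> B"
        proof
          fix x assume "x \<in> {1..l - 1}"
          then show "x \<in> B" using shifted_omit[OF sh F B, of x "l - 1"] False l1m by fastforce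
        qed
        then have "card (B - {1..l - 1}) = 1" using Bs l by (simp add: card_Diff_subset)
        then obtain y where y: "B - {1..l - 1} = {y}" by (auto simp: card_1_singleton_iff)
        then have "B = insert y {1..l - 1}" using sub by auto
        moreover have "y \<in> {l..m}" using y Bs(3) by fastforce
        ultimately show ?thesis by blast
      qed
      then have sub: "H 0 \<subseteq> (\<lambda>y. insert y {1..l - 1}) ` {l..m}" by blast
      then have "card (H 0) \<le> card {l..m}" using surj_card_le[OF _ sub] by simp
      then have f_le: "f \<le> real m + 1 - real l" using l1m by (simp add: f_def of_nat_diff)
      have "C * (1 + min ((real (card {l, l + 1}) - 1) * real l) (real m - 3 * real l) / (real m - real l)) \<le> S"
        using swap init' t l m26 by (intro ge_swap) auto
      moreover have "min (real l) (real m - 3 * real l) = real l" using m' l' by simp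
      ultimately have g: "C * (1 + real l / (real m - real l)) \<le> S" by simp
      define c where "c = real ((m - l - 1) choose (l - 1))"
      have "l * ((m - l) choose l) = (m - l) * ((m - l - 1) choose (l - 1))"
        using binomial_absorption[of "l - 1" "m - l"] l by simp
      then have "real l * C = real (m - l) * c" unfolding C_def c_def by (metis of_nat_mult)
      then have "c = C * (real l / (real m - real l))" using m' l' by (simp add: field_simps)
      then have gc: "C + c \<le> S" using g by (simp add: distrib_left)
      show ?thesis
      proof (cases "l = 2")
        case False
        have "(m - l - 1) choose 2 \<le> (m - l - 1) choose (l - 1)"
          using False l m26 by (intro binomial_mono) auto
        moreover have "2 * real ((m - l - 1) choose 2) = (real m - real l - 1) * (real m - real l - 2)"
          using two_times_choose_two[of "m - l - 1"] m26 l by (simp add: of_nat_diff)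
        ultimately have "(real m - real l - 1) * (real m - real l - 2) \<le> 2 * c" by (simp add: c_def)
        moreover have "(real m - real l - 1) * 4 \<le> (real m - real l - 1) * (real m - real l - 2)"
          using m' l' by (intro mult_left_mono) auto
        ultimately have "(real m - real l - 1) * 4 \<le> 2 * c" by (meson order_trans)
        then have "2 * real m - 2 * real l - 2 \<le> c" by simp
        moreover have "f - 1 \<le> real m - real l" using f_le by simp
        moreover have "real m - real l \<le> 2 * real m - 2 * real l - 2" using m' l' by simp
        ultimately have "f - 1 \<le> c" by linarith
        then show ?thesis using gc by simp
      next
        case True
        have c: "c = real m - 3" using True m26 by (simp add: c_def of_nat_diff)
        show ?thesis
        proof (cases "f \<le> real m - 2")
          case True
          then show ?thesis using gc c by linarith
        next
          case False
          have "card (H 0) = m - 1" using False f_le \<open>l = 2\<close> l1m by (simp add: f_def)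
          moreover have "(\<lambda>y. insert y {1..l - 1}) ` {l..m} = (\<lambda>y. {1, y}) ` {2..m}" using \<open>l = 2\<close> by auto
          moreover have "card ((\<lambda>y. {1, y}) ` {2..m}) = m - 1"
            by (subst card_image) (auto simp: inj_on_def doubleton_eq_iff)
          ultimately have "H 0 = (\<lambda>y. {1, y}) ` {2..m}" using sub by (intro card_subset_eq) auto
          then have "(real m - 1) * (real m - 2) / 2 \<le> S"
            using total_missing_ge_full_star[OF \<open>l = 2\<close> _ t(1)] t m26 l unfolding S_def by auto
          moreover have "2 * C = (real m - 2) * (real m - 3)"
            using two_times_choose_two[of "m - 2"] m26 \<open>l = 2\<close> by (simp add: C_def of_nat_diff)
          ultimately show ?thesis using f_le \<open>l = 2\<close> by (simp add: algebra_simps)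
        qed
      qed
    qed
    then show ?thesis by simp
  qed (simp add: f_def)
  moreover have "C \<le> S" using total_missing_ge_one_member[OF init t(1)] t by (simp add: C_def S_def)
  ultimately show ?thesis unfolding C_def f_def S_def by auto
qed

end

section \<open>Gains from swaps or disjoint members, and their combination by matching
  number\<close>

context dependent_chain
begin

lemma obtain_disjoint_members:
  assumes M: "M \<subseteq> H 0" "pairwise disjnt M" "finite M" and q: "q \<le> card M"
  obtains B where "disjoint_family_on B {..<q}" "\<And>i. i < q \<Longrightarrow> B i \<in> H 0"
proof -
  obtain h where h: "bij_betw h {0..<card M} M" using ex_bij_betw_nat_finite[OF M(3)] by blast
  have hM: "h i \<in> M" if "i < q" for i using h that q by (auto simp: bij_betw_def)
  have "disjoint_family_on h {..<q}"
    unfolding disjoint_family_on_def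
  proof (intro ballI impI)
    fix i j assume ij: "i \<in> {..<q}" "j \<in> {..<q}" "i \<noteq> j"
    then have "h i \<noteq> h j" using h q by (auto simp: bij_betw_def inj_on_def)
    then have "disjnt (h i) (h j)" using M(2) hM ij by (auto dest: pairwiseD)
    then show "h i \<inter> h j = {}" by (simp add: disjnt_def)
  qed
  moreover have "h i \<in> H 0" if "i < q" for i using hM[OF that] M(1) by blast
  ultimately show thesis by (rule that)
qed

lemma gain_swap:
  assumes l: "2 \<le> l" and t: "t * l \<le> m" "m < (t + 1) * l" "s + 2 \<le> t" "1 \<le> s" and m: "4 * l \<le> m"
    and swaps: "\<And>x. x \<in> {1..l + 1} \<Longrightarrow> {1..l + 1} - {x} \<in> H 0"
    and g: "g * (real m - real l) \<le> real l * real l" "g * (real m - real l) \<le> real m - 3 * real l"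
  shows "real ((m - l) choose l) * (1 + g) \<le> total_missing"
proof -
  have "4 * real l \<le> real m" using m by linarith
  then have "0 < real m - real l" using l by simp
  moreover have "g * (real m - real l) \<le> min (real l * real l) (real m - 3 * real l)"
    using g by simp
  ultimately have "g \<le> min (real l * real l) (real m - 3 * real l) / (real m - real l)"
    by (simp only: le_divide_eq if_True)
  then have "real ((m - l) choose l) * (1 + g)
      \<le> real ((m - l) choose l) * (1 + min (real l * real l) (real m - 3 * real l) / (real m - real l))"
    by (intro mult_left_mono add_left_mono) auto
  also have "\<dots> \<le> total_missing"
    using total_missing_ge_swap[OF t m, of "{1..l + 1}"] swaps l by simp
  finally show ?thesis .
qed

text \<open>With \<open>v\<close> the conditional probability that a random set avoids a second member, either \<open>v\<close> is
  large and two, three or four disjoint members give the gain, or \<open>l\<^sup>2\<close> is large compared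
  to \<open>m\<close> and the sets meeting \<open>[l+1]\<close> do.\<close>

lemma gain_small:
  assumes l: "2 \<le> l" and t: "t * l \<le> m" "m < (t + 1) * l" "s + 25 \<le> t" "1 \<le> s"
    and swaps: "\<And>x. x \<in> {1..l + 1} \<Longrightarrow> {1..l + 1} - {x} \<in> H 0"
    and M: "M \<subseteq> H 0" "pairwise disjnt M" "finite M" "2 \<le> card M"
  shows "real ((m - l) choose l) * (1 + 3 / 10) \<le> total_missing"
proof (cases "3 / 10 * (real m - real l) \<le> real l * real l")
  case True
  have "26 * l \<le> t * l" using t by (intro mult_le_mono1) simp
  then have m26: "26 * l \<le> m" using t(1) by (rule le_trans)
  then have m': "26 * real l \<le> real m" by linarith
  have ml: "0 < real m - real l" using m' l by simp
  show ?thesis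
    by (rule gain_swap[OF l t(1,2) _ t(4) _ swaps True]) (use t m26 m' in auto)
next
  case False
  have "26 * l \<le> t * l" using t by (intro mult_le_mono1) simp
  then have m26: "26 * l \<le> m" using t(1) by (rule le_trans)
  then have m': "26 * real l \<le> real m" by linarith
  have ml: "0 < real m - real l" using m' l by simp
  obtain B where B: "disjoint_family_on B {..<2::nat}" "\<And>i. i < 2 \<Longrightarrow> B i \<in> H 0"
    using obtain_disjoint_members[OF M(1-3,4)] by blast
  \<comment> \<open>Here v > 7/10 by the Bernoulli bound, so two disjoint members already give 2 v >
    13/10.\<close>
  have "2 * real ((m - 2 * l) choose l) \<le> total_missing"
  proof -
    have "s \<le> t - 2" "3 \<le> t" using t by auto
    then show ?thesis using total_missing_ge_disjoint_members[OF B _ t(1)] by (simp add: binomial_eq_0)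
  qed
  moreover have "real ((m - l) choose l) * (real (m - l) - real l * real l) \<le> real (m - l) * real ((m - l - l) choose l)"
    using l m26 by (intro binomial_shift_ge_linear) auto
  moreover have "real (m - l) = real m - real l" "m - l - l = m - 2 * l" using m26 by simp_all
  ultimately have 1: "2 * (real ((m - l) choose l) * (real m - real l - real l * real l)) \<le> (real m - real l) * total_missing"
    using ml mult_left_mono[of "2 * real ((m - 2 * l) choose l)" total_missing "real m - real l"]
    by (simp add: algebra_simps)
  have "13 / 10 * x \<le> 2 * (x - y)" if "\<not> 3 / 10 * x \<le> y" "0 < x" for x y :: real using that by simp
  from this[OF False ml] have "real ((m - l) choose l) * (13 / 10 * (real m - real l))
      \<le> real ((m - l) choose l) * (2 * (real m - real l - real l * real l))"
    by (rule mult_left_mono) simp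
  then have "(real m - real l) * (real ((m - l) choose l) * (1 + 3 / 10)) \<le> (real m - real l) * total_missing"
    using 1 by (simp add: algebra_simps)
  then show ?thesis using ml by (simp only: mult_le_cancel_left_pos)
qed

text \<open>Log-concavity gives \<open>C3 \<le> C * v\<^sup>2\<close>, so the bound becomes a
  polynomial in v alone.\<close>

lemma gain_disjoint_members:
  assumes t: "t * l \<le> m" "3 \<le> t" and q: "q \<le> 4"
    and large: "(q choose 2) * s \<le> t - 2 \<or> (2 * s \<le> t \<and> 4 * (q choose 2)\<^sup>2 + 2 \<le> t)"
    and M: "M \<subseteq> H 0" "pairwise disjnt M" "finite M" "q \<le> card M"
    and v: "v = real ((m - 2 * l) choose l) / real ((m - l) choose l)"
  shows "real ((m - l) choose l) * (2 * (real (q choose 2) * v - 2 * real (q choose 3) * v\<^sup>2)) \<le> total_missing"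
proof -
  have "3 * l \<le> t * l" using t by (intro mult_le_mono1) simp
  then have m3: "3 * l \<le> m" using t(1) by (rule le_trans)
  define C C2 C3 where "C = real ((m - l) choose l)" and "C2 = real ((m - 2 * l) choose l)"
    and "C3 = real ((m - 3 * l) choose l)"
  have C: "0 < C" using m3 by (simp add: C_def)
  have C2: "C2 = C * v" using C by (simp add: v C_def C2_def)
  have "C3 * C \<le> C2\<^sup>2"
  proof -
    have "m - 3 * l + 2 * l = m - l" "m - 3 * l + l = m - 2 * l" using m3 by auto
    then show ?thesis
      using binomial_log_concave_upper[of "m - 3 * l" l l] by (simp add: C_def C2_def C3_def)
  qed
  then have "C * C3 \<le> C * (C * v\<^sup>2)" unfolding C2 by (simp add: power2_eq_square mult_ac)
  then have "C3 \<le> C * v\<^sup>2" using C by (simp only: mult_le_cancel_left_pos)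
  then have C3: "real (q choose 3) * C3 \<le> real (q choose 3) * (C * v\<^sup>2)" by (rule mult_left_mono) simp
  obtain B where B: "disjoint_family_on B {..<q}" "\<And>i. i < q \<Longrightarrow> B i \<in> H 0"
    using obtain_disjoint_members[OF M] by blast
  have "2 * (real (q choose 2) * C2 - 2 * real (q choose 3) * C3) \<le> total_missing"
    using total_missing_ge_disjoint_members[OF B q t large] by (simp add: C2_def C3_def)
  moreover have "C * (2 * (real (q choose 2) * v - 2 * real (q choose 3) * v\<^sup>2))
      = 2 * (real (q choose 2) * C2 - 2 * (real (q choose 3) * (C * v\<^sup>2)))"
    unfolding C2 by (simp add: algebra_simps)
  ultimately show ?thesis using C3 by (simp add: C_def)
qed

text \<open>38 is \<open>4 * 3\<^sup>2 + 2\<close>, from the three pairs among three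
  members.\<close>

lemma gain_three_members:
  assumes t: "t * l \<le> m" "3 \<le> t" and large: "3 * s \<le> t - 2 \<or> (2 * s \<le> t \<and> 38 \<le> t)"
    and M: "M \<subseteq> H 0" "pairwise disjnt M" "finite M" "3 \<le> card M"
    and v: "v = real ((m - 2 * l) choose l) / real ((m - l) choose l)"
  shows "real ((m - l) choose l) * (2 * (3 * v - 2 * v\<^sup>2)) \<le> total_missing"
proof -
  have c: "(3::nat) choose 2 = 3" "(3::nat) choose 3 = 1" by (simp_all add: eval_nat_numeral)
  show ?thesis
    using gain_disjoint_members[OF t _ _ M v] large unfolding c by simp
qed

text \<open>Six pairs would make the alternative 6 s <= t - 2 too demanding, so the other one is
  used; it asks for t >= \<open>4 * 6\<^sup>2 + 2\<close>, that is 146.\<close>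

lemma gain_four_members:
  assumes t: "t * l \<le> m" "146 \<le> t" "2 * s \<le> t"
    and M: "M \<subseteq> H 0" "pairwise disjnt M" "finite M" "4 \<le> card M"
    and v: "v = real ((m - 2 * l) choose l) / real ((m - l) choose l)"
  shows "real ((m - l) choose l) * (2 * (6 * v - 8 * v\<^sup>2)) \<le> total_missing"
proof -
  have c: "(4::nat) choose 2 = 6" "(4::nat) choose 3 = 4" by (simp_all add: eval_nat_numeral)
  show ?thesis
    using gain_disjoint_members[OF t(1) _ _ _ M v] t unfolding c by simp
qed

text \<open>If l^2 >= 5/8 (m - l), swaps suffice. Otherwise v >= 3/8, and the concave function 2 (3
  v - 2 v^2) has the values 27/16 and 2 at the ends of the interval from 3/8 to 1, both above
  13/8.\<close>

lemma gain_medium: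
  assumes l: "2 \<le> l" and t: "t * l \<le> m" "m < (t + 1) * l" "s + 25 \<le> t" "1 \<le> s" "3 * s + 2 \<le> t"
    and swaps: "\<And>x. x \<in> {1..l + 1} \<Longrightarrow> {1..l + 1} - {x} \<in> H 0"
    and M: "M \<subseteq> H 0" "pairwise disjnt M" "finite M" "3 \<le> card M"
  shows "real ((m - l) choose l) * (1 + 5 / 8) \<le> total_missing"
proof -
  have "26 * l \<le> t * l" using t by (intro mult_le_mono1) simp
  then have m26: "26 * l \<le> m" using t(1) by (rule le_trans)
  then have m': "26 * real l \<le> real m" by linarith
  have ml: "0 < real m - real l" using m' l by simp
  have C: "0 < real ((m - l) choose l)" using m26 by simp
  show ?thesis
  proof (cases "5 / 8 * (real m - real l) \<le> real l * real l")
    case True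
    show ?thesis
      by (rule gain_swap[OF l t(1,2) _ t(4) _ swaps True]) (use t m26 m' in auto)
  next
    case False
    define v where "v = real ((m - 2 * l) choose l) / real ((m - l) choose l)"
    have "(m - 2 * l) choose l \<le> (m - l) choose l" by (intro binomial_right_mono) simp
    then have v1: "v \<le> 1" using C by (simp add: v_def divide_le_eq)
    have "real ((m - l) choose l) * (real (m - l) - real l * real l) \<le> real (m - l) * real ((m - l - l) choose l)"
      using l m26 by (intro binomial_shift_ge_linear) auto
    moreover have e: "real (m - l) = real m - real l" "m - l - l = m - 2 * l" using m26 by simp_all
    ultimately have 1: "real ((m - l) choose l) * (real m - real l - real l * real l)
        \<le> (real m - real l) * real ((m - 2 * l) choose l)" by (simp only: e)
    have "3 / 8 * x \<le> x - y" if "\<not> 5 / 8 * x \<le> y" for x y :: real using that by simp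
    from this[OF False]
    have "real ((m - l) choose l) * (3 / 8 * (real m - real l))
        \<le> real ((m - l) choose l) * (real m - real l - real l * real l)"
      by (rule mult_left_mono) simp
    also note 1
    also have "real ((m - l) choose l) * (3 / 8 * (real m - real l))
        = (real m - real l) * (3 / 8 * real ((m - l) choose l))" by (simp only: mult_ac)
    finally have "(real m - real l) * (3 / 8 * real ((m - l) choose l)) \<le> (real m - real l) * real ((m - 2 * l) choose l)" .
    then have "3 / 8 * real ((m - l) choose l) \<le> real ((m - 2 * l) choose l)"
      using ml by (simp only: mult_le_cancel_left_pos)
    then have v3: "3 / 8 \<le> v" using C by (simp add: v_def le_divide_eq)
    have "0 \<le> (v - 3 / 8) * (1 - v)" using v1 v3 by (intro mult_nonneg_nonneg) auto
    then have "1 + 5 / 8 \<le> 2 * (3 * v - 2 * v\<^sup>2)" using v3 by (simp add: power2_eq_square field_simps)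
    then have "real ((m - l) choose l) * (1 + 5 / 8) \<le> real ((m - l) choose l) * (2 * (3 * v - 2 * v\<^sup>2))"
      by (rule mult_left_mono) simp
    also have "\<dots> \<le> total_missing"
    proof -
      have "3 * s \<le> t - 2" "3 \<le> t" using t by auto
      then show ?thesis using gain_three_members[OF t(1) _ _ M(1-3) _ v_def] l M(4) by simp
    qed
    finally show ?thesis .
  qed
qed

text \<open>If l^2 >= m - 3 l, swaps gain (m - 3 l) / (m - l) >= 1 - 2 / (t - 1). Otherwise v >= 1/3
  and a full gain of 1 is available: three members give it for v between 1/2 and 1, four members for
  v between 1/4 and 1/2, these being the ranges where the respective quadratic is at least
  2.\<close>

lemma gain_large:
  assumes l: "2 \<le> l" and t: "t * l \<le> m" "m < (t + 1) * l" "146 \<le> t" "1 \<le> s" "2 * s + 2 \<le> t"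
    and swaps: "\<And>x. x \<in> {1..l + 1} \<Longrightarrow> {1..l + 1} - {x} \<in> H 0"
    and M: "M \<subseteq> H 0" "pairwise disjnt M" "finite M" "4 \<le> card M"
  shows "real ((m - l) choose l) * (1 + (1 - 2 / (real t - 1))) \<le> total_missing"
proof -
  have "26 * l \<le> t * l" using t by (intro mult_le_mono1) simp
  then have m26: "26 * l \<le> m" using t(1) by (rule le_trans)
  then have m': "26 * real l \<le> real m" by linarith
  have ml: "0 < real m - real l" using m' l by simp
  have C: "0 < real ((m - l) choose l)" using m26 by simp
  have t1: "0 < real t - 1" using t by simp
  show ?thesis
  proof (cases "real m - 3 * real l \<le> real l * real l")
    case True
    have "1 - 2 / (real t - 1) \<le> (real m - 3 * real l) / (real m - real l)"
    proof -
      have "real (t * l) \<le> real m" using t(1) by (simp only: of_nat_le_iff)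
      then have "2 * real l / (real m - real l) \<le> 2 / (real t - 1)"
        using ml t1 by (simp add: field_simps)
      moreover have "(real m - 3 * real l) / (real m - real l) = 1 - 2 * real l / (real m - real l)"
        using ml by (simp add: field_simps)
      ultimately show ?thesis by linarith
    qed
    then have "real ((m - l) choose l) * (1 + (1 - 2 / (real t - 1)))
        \<le> real ((m - l) choose l) * (1 + min (real l * real l) (real m - 3 * real l) / (real m - real l))"
      using True by (intro mult_left_mono add_left_mono) auto
    also have "\<dots> \<le> total_missing"
      using total_missing_ge_swap[OF t(1,2) _ t(4), of "{1..l + 1}"] swaps t m26 l by simp
    finally show ?thesis .
  next
    case False
    define v where "v = real ((m - 2 * l) choose l) / real ((m - l) choose l)"
    have "(m - 2 * l) choose l \<le> (m - l) choose l" by (intro binomial_right_mono) simp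
    then have v1: "v \<le> 1" using C by (simp add: v_def divide_le_eq)
    have "real (l * l) \<le> real (m - 3 * l)" using False m26 by (simp add: of_nat_diff)
    then have "l * l \<le> m - 3 * l" by (simp only: of_nat_le_iff)
    then have "real ((m - l) choose l) / 3 \<le> real ((m - 2 * l) choose l)"
      using l m26 by (intro binomial_shift_ge_third) auto
    then have v3: "1 / 3 \<le> v" using C by (simp add: v_def le_divide_eq)
    have "real ((m - l) choose l) * 2 \<le> total_missing"
    proof (cases "1 / 2 \<le> v")
      case True
      have "0 \<le> (v - 1 / 2) * (1 - v)" using v1 True by (intro mult_nonneg_nonneg) auto
      then have "2 \<le> 2 * (3 * v - 2 * v\<^sup>2)" by (simp add: power2_eq_square field_simps)
      then have "real ((m - l) choose l) * 2 \<le> real ((m - l) choose l) * (2 * (3 * v - 2 * v\<^sup>2))"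
        by (rule mult_left_mono) simp
      also have "\<dots> \<le> total_missing"
        using gain_three_members[OF t(1) _ _ M(1-3) _ v_def] t l M(4) by auto
      finally show ?thesis .
    next
      case False
      have "0 \<le> (v - 1 / 4) * (1 / 2 - v)" using v3 False by (intro mult_nonneg_nonneg) auto
      then have "2 \<le> 2 * (6 * v - 8 * v\<^sup>2)" by (simp add: power2_eq_square algebra_simps)
      then have "real ((m - l) choose l) * 2 \<le> real ((m - l) choose l) * (2 * (6 * v - 8 * v\<^sup>2))"
        by (rule mult_left_mono) simp
      also have "\<dots> \<le> total_missing"
        using gain_four_members[OF t(1) _ _ M v_def] t l by simp
      finally show ?thesis .
    qed
    moreover have "real ((m - l) choose l) * (1 + (1 - 2 / (real t - 1))) \<le> real ((m - l) choose l) * 2"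
      using t1 by (intro mult_left_mono) auto
    ultimately show ?thesis by linarith
  qed
qed

text \<open>The second alternative of \<open>regime\<close> is the condition
  \<open>real r + 1 \<le> D * g\<close> of the proof at r = s, with g the gain of
  \<open>gain_large\<close>. The case r = 1 is separate, since there no two disjoint members can be
  prescribed.\<close>

lemma chain_bound:
  assumes l: "2 \<le> l" and t: "t * l \<le> m" "m < (t + 1) * l" "s + 25 \<le> t" "2 * s + 2 \<le> t" "1 \<le> s"
    and regime: "3 * s + 2 \<le> t \<or> (146 \<le> t \<and> real s + 1 \<le>
        ((real t - 1) * (1 - 1 / (real t - 2 * real s - 1)) - (real s + 1)) * (1 - 2 / (real t - 1)))"
    and sh: "shifted m (H 0)" and ne: "H 0 \<noteq> {}"
    and G: "\<G> \<subseteq> nsets {1..m} (Suc l)" and shadow: "\<And>A x. A \<in> \<G> \<Longrightarrow> x \<in> A \<Longrightarrow> A - {x} \<in> H 0"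
  shows "real ((m - l) choose l) - 1 + real (card (H 0)) + real (card \<G>) \<le> total_missing"
proof (cases "{1..l + 1} - {1} \<in> H 0")
  case False
  have F: "H 0 \<subseteq> nsets {1..m} l" using H_sub by simp
  have "26 * l \<le> t * l" using t by (intro mult_le_mono1) simp
  then have m26: "26 * l \<le> m" using t(1) by (rule le_trans)
  \<comment> \<open>Removing the least point from a member of \<open>\<G>\<close> would leave a
    member of \<open>H 0\<close> that avoids 1.\<close>
  have "\<G> = {}"
  proof (rule ccontr)
    assume "\<G> \<noteq> {}"
    then obtain A where A: "A \<in> \<G>" by blast
    then have As: "A \<subseteq> {1..m}" "finite A" "A \<noteq> {}" using G by (auto simp: nsets_def)
    then have "1 \<notin> A - {Min A}" by (metis Diff_iff Min_le Min_in atLeastAtMost_iff insertI1 le_antisym subsetD)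
    then show False
      using shifted_omit[OF sh F shadow[OF A Min_in[OF As(2,3)]], of 1 1] False m26 l by auto
  qed
  then show ?thesis using chain_bound_centered[OF l t sh ne False] by simp
next
  case True
  have F: "H 0 \<subseteq> nsets {1..m} l" using H_sub by simp
  have finF: "finite (H 0)" using F finite_subset finite_imp_finite_nsets by blast
  have "26 * l \<le> t * l" using t by (intro mult_le_mono1) simp
  then have m26: "26 * l \<le> m" using t(1) by (rule le_trans)
  then have m': "26 * real l \<le> real m" by linarith
  have l': "2 \<le> real l" using l by simp
  have ml: "0 < real m - real l" using m' l' by simp
  have swaps: "{1..l + 1} - {x} \<in> H 0" if x: "x \<in> {1..l + 1}" for x
    using shifted_omit[OF sh F True, of 1 x] x m26 l by auto
  define f C S N where "f = real (card (H 0))" and "C = real ((m - l) choose l)"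
    and "S = total_missing" and "N = real (m choose l)"
  have f: "0 < f" using ne finF by (simp add: f_def card_gt_0_iff)
  have C: "0 < C" using m26 by (simp add: C_def)
  have CN: "C \<le> N" unfolding C_def N_def by (simp add: binomial_right_mono)
  let ?Ms = "{M. M \<subseteq> H 0 \<and> pairwise disjnt M}"
  define r where "r = Max (card ` ?Ms)"
  have finMs: "finite (card ` ?Ms)" using finF by simp
  have "{} \<in> ?Ms" by simp
  then have "r \<in> card ` ?Ms" unfolding r_def using finMs by (intro Max_in) blast+
  then obtain M where M: "M \<subseteq> H 0" "pairwise disjnt M" "card M = r" by auto
  have finM: "finite M" using M(1) finF by (rule finite_subset)
  have match: "card M' \<le> r" if "M' \<subseteq> H 0" "pairwise disjnt M'" "finite M'" for M'
    unfolding r_def using finMs that by (intro Max_ge) auto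
  have rs: "r \<le> s" using card_matching_le[OF M(1,2) finM] M(3) by simp
  have r1: "1 \<le> r"
  proof -
    obtain A where "A \<in> H 0" using ne by blast
    then show ?thesis using match[of "{A}"] by simp
  qed
  \<comment> \<open>This is 1 + (r l - 1) / (l + 1): the shadow bound for \<open>\<G>\<close> with
    \<open>H 0\<close> itself added.\<close>
  define \<Lambda> where "\<Lambda> = (real r + 1) * real l / (real l + 1)"
  have "f + real (card \<G>) \<le> \<Lambda> * f"
  proof -
    have "(r + 1) * l \<le> t * l" using rs t by (intro mult_le_mono1) simp
    then have "(r + 1) * l \<le> m" using t(1) by (rule le_trans)
    then have "real (card \<G>) * (real l + 1) \<le> (real r * real l - 1) * f"
      using card_le_shadow[OF sh F _ _ match r1 G shadow] l by (simp add: f_def)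
    then have "(f + real (card \<G>)) * (real l + 1) \<le> (real r + 1) * real l * f"
      by (simp add: algebra_simps)
    then show ?thesis by (simp add: \<Lambda>_def le_divide_eq)
  qed
  moreover have "C - 1 + \<Lambda> * f \<le> S"
  proof (rule ccontr)
    assume "\<not> ?thesis"
    then have less: "S < C + \<Lambda> * f" by simp
    have \<Lambda>: "\<Lambda> \<le> real r + 1" "0 < \<Lambda>" unfolding \<Lambda>_def by (simp_all add: divide_le_eq algebra_simps)
      (use l' in \<open>simp_all add: add_pos_nonneg\<close>)
    have lin: "(real t - real r) * f \<le> S"
      using total_missing_ge_linear[OF t(1) _ _ match] t by (simp add: f_def S_def)
    have swap: "C * (1 + min (real l * real l) (real m - 3 * real l) / (real m - real l)) \<le> S"
      using total_missing_ge_swap[OF t(1,2) _ t(5), of "{1..l + 1}"] swaps t m26 l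
      by (simp add: C_def S_def)
    show False
    proof (cases "r = 1")
      case True
      define \<mu> where "\<mu> = min (real l * real l) (real m - 3 * real l)"
      have L: "\<Lambda> * (real l + 1) = 2 * real l" using True by (simp add: \<Lambda>_def)
      \<comment> \<open>\<open>k\<close> is (t - 1 - \<Lambda>) (l + 1). The exact value \<Lambda> =
        2 l / (l + 1) matters: with \<Lambda> rounded up to 2 this comparison would fail for l =
        2.\<close>
      define k where "k = (real t - 1) * (real l + 1) - 2 * real l"
      have tl: "real m < (real t + 1) * real l"
        using t(2) by (metis of_nat_1 of_nat_add of_nat_less_iff of_nat_mult)
      have t26: "26 \<le> real t" using t by linarith
      have "(real t - 1 - \<Lambda>) * f < C" using lin less True by (simp add: algebra_simps)
      then have "(real t - 1 - \<Lambda>) * f * (real l + 1) < C * (real l + 1)" using l' by (intro mult_strict_right_mono) auto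
      moreover have "(real t - 1 - \<Lambda>) * f * (real l + 1) = k * f"
        unfolding k_def L[symmetric] by (simp add: algebra_simps)
      ultimately have kf: "k * f < C * (real l + 1)" by simp
      have k: "2 * real t \<le> k" "4 * real l \<le> k"
      proof -
        have "0 \<le> (real t - 3) * (real l - 2)" "0 \<le> (real t - 26) * (real l + 1)"
          using t26 l' by (auto intro: mult_nonneg_nonneg)
        then show "2 * real t \<le> k" "4 * real l \<le> k" using t26 l' by (simp_all add: k_def algebra_simps)
      qed
      have "C * (\<mu> / (real m - real l)) < \<Lambda> * f" using swap less by (simp add: \<mu>_def distrib_left)
      then have "C * (\<mu> / (real m - real l)) * (real l + 1) < \<Lambda> * f * (real l + 1)"
        using l' by (intro mult_strict_right_mono) auto
      moreover have "\<Lambda> * f * (real l + 1) = 2 * real l * f" using L by (simp add: mult_ac)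
      ultimately have "C * (\<mu> / (real m - real l)) * (real l + 1) < 2 * real l * f" by simp
      then have "k * (C * (\<mu> / (real m - real l)) * (real l + 1)) < k * (2 * real l * f)"
        using k t26 by (intro mult_strict_left_mono) auto
      also have "\<dots> = 2 * real l * (k * f)" by simp
      also have "\<dots> < 2 * real l * (C * (real l + 1))" using kf l' by (intro mult_strict_left_mono) auto
      finally have "(C * (real l + 1)) * (k * (\<mu> / (real m - real l))) < (C * (real l + 1)) * (2 * real l)"
        by (simp add: mult_ac)
      moreover have "0 < C * (real l + 1)" using C l' by simp
      ultimately have "k * (\<mu> / (real m - real l)) < 2 * real l" by (simp only: mult_less_cancel_left_pos)
      then have "k * \<mu> < 2 * real l * (real m - real l)" using ml by (simp add: divide_less_eq)
      moreover have "2 * real l * (real m - real l) \<le> k * (real l * real l)"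
      proof -
        have "2 * real l * (real m - real l) \<le> 2 * real l * (real t * real l)"
          using tl l' by (intro mult_left_mono) (auto simp: algebra_simps)
        also have "\<dots> = 2 * real t * (real l * real l)" by simp
        also have "\<dots> \<le> k * (real l * real l)" using k by (intro mult_right_mono) auto
        finally show ?thesis .
      qed
      moreover have "2 * real l * (real m - real l) \<le> k * (real m - 3 * real l)"
      proof -
        have "2 * real l * (real m - real l) \<le> 2 * real l * (2 * (real m - 3 * real l))"
          using m' l' by (intro mult_left_mono) auto
        also have "\<dots> = 4 * real l * (real m - 3 * real l)" by simp
        also have "\<dots> \<le> k * (real m - 3 * real l)" using k m' l' by (intro mult_right_mono) auto
        finally show ?thesis .
      qed
      ultimately show False by (auto simp: \<mu>_def min_def split: if_splits)
    next
      case False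
      then have r2: "2 \<le> r" using r1 by simp
      \<comment> \<open>Inserting the linear bound into S < C + (r + 1) f leaves e f < C, and C <= N
        turns this into a bound on the density of \<open>H 0\<close>.\<close>
      define e where "e = real t - 2 * real r - 1"
      have rr: "real r \<le> real s" using rs by simp
      have e: "0 < e" using t rr by (simp add: e_def)
      have less': "S < C + (real r + 1) * f" using less \<Lambda>(1) f mult_right_mono[OF \<Lambda>(1), of f] by linarith
      then have "e * f < C" using lin by (simp add: e_def algebra_simps)
      then have "f / N \<le> 1 / e" using CN C e by (simp add: field_simps)
      define D where "D = (real t - 1) * (1 - 1 / e) - (real r + 1)"
      have "(real t - 1) * (1 - 1 / e) * f \<le> (real t - 1) * (1 - f / N) * f"
        using \<open>f / N \<le> 1 / e\<close> f t by (intro mult_right_mono mult_left_mono) auto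
      also have "\<dots> \<le> S" using total_missing_ge_quadratic[OF t(1) _ _ sh] t by (simp add: f_def N_def S_def)
      finally have "(real t - 1) * (1 - 1 / e) * f \<le> S" .
      then have "(D + (real r + 1)) * f \<le> S" by (simp only: D_def diff_add_cancel)
      then have Df: "D * f < C" using less' by (simp only: distrib_right)
      \<comment> \<open>The two sides collide as C g < (r + 1) f <= D g f <= C g.\<close>
      have no_gain: False if g: "0 \<le> g" "C * (1 + g) \<le> S" "real r + 1 \<le> D * g" for g
      proof -
        have "C * g < (real r + 1) * f" using less' g(2) by (simp add: distrib_left)
        also have "\<dots> \<le> D * g * f" using g(3) f by (intro mult_right_mono) auto
        also have "\<dots> = D * f * g" by simp
        also have "\<dots> \<le> C * g" using Df g(1) by (intro mult_right_mono) auto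
        finally show False by simp
      qed
      show False
      proof (cases "r \<le> 3")
        case True
        have "real r + 1 \<le> D * (3 / 10)"
          using few_disjoint_members_arith[OF True, of t] r2 rs t by (simp add: D_def e_def)
        moreover have "C * (1 + 3 / 10) \<le> S"
          unfolding C_def S_def using gain_small[OF l t(1,2,3,5) swaps M(1,2) finM] M(3) r2 by simp
        ultimately show False by (intro no_gain[of "3 / 10"]) auto
      next
        case False
        show False
        proof (cases "3 * s + 2 \<le> t")
          case True
          have "real r + 1 \<le> D * (5 / 8)"
            using many_disjoint_members_arith[of r t] False rs t True by (simp add: D_def e_def)
          moreover have "C * (1 + 5 / 8) \<le> S"
            unfolding C_def S_def using gain_medium[OF l t(1,2,3,5) True swaps M(1,2) finM] M(3) False by simp
          ultimately show False by (intro no_gain[of "5 / 8"]) auto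
        next
          case reg: False
          then have reg2: "146 \<le> t" "real s + 1 \<le>
            ((real t - 1) * (1 - 1 / (real t - 2 * real s - 1)) - (real s + 1)) * (1 - 2 / (real t - 1))"
            using regime by auto
          define g where "g = 1 - 2 / (real t - 1)"
          have g: "0 \<le> g" using reg2(1) by (simp add: g_def divide_le_eq)
          have "0 < real t - 2 * real s - 1" using t by linarith
          \<comment> \<open>\<open>e\<close> decreases with r and r <= s, so \<open>regime\<close>,
            stated for s, is the worst case.\<close>
          then have "1 / e \<le> 1 / (real t - 2 * real s - 1)"
            unfolding e_def using rr by (intro divide_left_mono) auto
          then have "(real t - 1) * (1 - 1 / (real t - 2 * real s - 1)) \<le> (real t - 1) * (1 - 1 / e)"
            using t by (intro mult_left_mono) auto
          then have "(real t - 1) * (1 - 1 / (real t - 2 * real s - 1)) - (real s + 1) \<le> D"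
            using rr by (simp add: D_def)
          then have "((real t - 1) * (1 - 1 / (real t - 2 * real s - 1)) - (real s + 1)) * g \<le> D * g"
            using g by (rule mult_right_mono)
          then have "real r + 1 \<le> D * g" using reg2(2) rr by (simp add: g_def)
          moreover have "C * (1 + g) \<le> S"
            unfolding C_def S_def g_def
            using gain_large[OF l t(1,2) reg2(1) t(5,4) swaps M(1,2) finM] M(3) False by simp
          ultimately show False using g by (intro no_gain[of g])
        qed
      qed
    qed
  qed
  ultimately show ?thesis by (simp add: f_def C_def S_def)
qed

end

section \<open>Reduction to chains by shifting\<close>

definition shift_set :: "nat \<Rightarrow> nat \<Rightarrow> nat set \<Rightarrow> nat set" where
  "shift_set x y A = (if y \<in> A \<and> x \<notin> A then insert x (A - {y}) else A)"

text \<open>Compression is encoded as the image of an injective map on the family, so that sizes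
  agree at once and old and new sets can be compared one by one.\<close>

definition compress_map :: "nat \<Rightarrow> nat \<Rightarrow> nat set set \<Rightarrow> nat set \<Rightarrow> nat set" where
  "compress_map x y F A = (if shift_set x y A \<in> F then A else shift_set x y A)"

definition compress :: "nat \<Rightarrow> nat \<Rightarrow> nat set set \<Rightarrow> nat set set" where
  "compress x y F = compress_map x y F ` F"

lemma compress_map_cases:
  assumes "A \<in> F"
  obtains "compress_map x y F A = A"
  | "compress_map x y F A = insert x (A - {y})" "y \<in> A" "x \<notin> A" "insert x (A - {y}) \<notin> F"
proof (cases "y \<in> A \<and> x \<notin> A \<and> insert x (A - {y}) \<notin> F")
  case True
  then show ?thesis using that(2) by (simp add: compress_map_def shift_set_def)
next
  case False
  then show ?thesis using that(1) by (auto simp: compress_map_def shift_set_def)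
qed

lemma inj_on_compress_map: "inj_on (compress_map x y F) F"
proof (rule inj_onI)
  fix A B assume AB: "A \<in> F" "B \<in> F" "compress_map x y F A = compress_map x y F B"
  show "A = B"
  proof (cases rule: compress_map_cases[OF AB(1), of x y])
    case 1
    show ?thesis
      by (cases rule: compress_map_cases[OF AB(2), of x y]) (use 1 AB in auto)
  next
    case A: 2
    show ?thesis
    proof (cases rule: compress_map_cases[OF AB(2), of x y])
      case B: 2
      have "insert x (A - {y}) = insert x (B - {y})" using A B AB(3) by simp
      then have "A - {y} = B - {y}" using A B by (metis Diff_iff insert_ident)
      then show ?thesis using A B by (metis insert_Diff)
    qed (use A AB in auto)
  qed
qed

lemma card_compress: "card (compress x y F) = card F"
  unfolding compress_def by (rule card_image[OF inj_on_compress_map])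

lemma compress_subset_nsets:
  assumes "F \<subseteq> nsets V k" "x \<in> V"
  shows "compress x y F \<subseteq> nsets V k"
proof
  fix B assume "B \<in> compress x y F"
  then obtain A where A: "A \<in> F" "B = compress_map x y F A" by (auto simp: compress_def)
  then have As: "A \<subseteq> V" "finite A" "card A = k" using assms by (auto simp: nsets_def)
  show "B \<in> nsets V k"
  proof (cases rule: compress_map_cases[OF A(1), of x y])
    case 2
    then have "card (insert x (A - {y})) = Suc (card (A - {y}))" using As by simp
    also have "\<dots> = card A" using As(2) 2(2) by (rule card_Suc_Diff1)
    finally have "card (insert x (A - {y})) = card A" .
    then show ?thesis using 2 A As assms(2) by (auto simp: nsets_def)
  qed (use A assms in auto)
qed

lemma compress_memE:
  assumes "B \<in> compress x y F" "x \<noteq> y"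
  obtains "B \<in> F" "shift_set x y B \<in> F"
  | "x \<in> B" "y \<notin> B" "insert y (B - {x}) \<in> F"
proof -
  obtain A where A: "A \<in> F" "B = compress_map x y F A" using assms by (auto simp: compress_def)
  show thesis
  proof (cases rule: compress_map_cases[OF A(1), of x y])
    case 1
    then have "shift_set x y A \<in> F" using A(1) by (auto simp: compress_map_def split: if_splits)
    then show ?thesis using A 1 that(1) by simp
  next
    case 2
    have "insert y (B - {x}) = A" using 2 A(2) by auto
    then show ?thesis using 2 A assms(2) that(2) by auto
  qed
qed

text \<open>All new sets contain x, so a disjoint transversal has at most one of them, at
  \<open>i0\<close>. Moving its x back to y can collide only with a block containing y. That block
  can be shifted from y to x instead, because a set that stayed in place has its shift in the same
  family.\<close>

lemma compress_transversal:
  assumes disj: "disjoint_family_on A I" and A: "\<And>i. i \<in> I \<Longrightarrow> A i \<in> compress x y (H i)" and xy: "x \<noteq> y"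
  shows "\<exists>B. disjoint_family_on B I \<and> (\<forall>i\<in>I. B i \<in> H i)"
proof (cases "\<forall>i\<in>I. A i \<in> H i")
  case True
  then show ?thesis using disj by blast
next
  case False
  then obtain i0 where i0: "i0 \<in> I" "A i0 \<notin> H i0" by blast
  then have new: "x \<in> A i0" "y \<notin> A i0" "insert y (A i0 - {x}) \<in> H i0"
    using compress_memE[OF A[OF i0(1)] xy] by blast+
  have dj: "A i \<inter> A j = {}" if "i \<in> I" "j \<in> I" "i \<noteq> j" for i j
    using disj that by (auto simp: disjoint_family_on_def)
  have nx: "x \<notin> A i" if "i \<in> I" "i \<noteq> i0" for i
    using dj[OF that(1) i0(1) that(2)] new(1) by blast
  define B where "B i = (if i = i0 then insert y (A i0 - {x}) else shift_set x y (A i))" for i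
  have "B i \<in> H i" if "i \<in> I" for i
  proof (cases "i = i0")
    case False
    then show ?thesis using compress_memE[OF A[OF that] xy] nx[OF that False] by (auto simp: B_def)
  qed (use new in \<open>simp add: B_def\<close>)
  moreover have "disjoint_family_on B I"
    unfolding disjoint_family_on_def
  proof (intro ballI impI)
    have aux: "B i0 \<inter> B j = {}" if "j \<in> I" "j \<noteq> i0" for j
      using dj[OF i0(1) that(1)] that nx[OF that] xy by (auto simp: B_def shift_set_def)
    fix i j assume ij: "i \<in> I" "j \<in> I" "i \<noteq> j"
    consider "i = i0" | "j = i0" | "i \<noteq> i0" "j \<noteq> i0" by blast
    then show "B i \<inter> B j = {}"
    proof cases
      case 3
      then show ?thesis using dj[OF ij] nx[OF ij(1)] nx[OF ij(2)] by (auto simp: B_def shift_set_def)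
    qed (use aux ij in auto)
  qed
  ultimately show ?thesis by blast
qed

text \<open>Termination measure for shifting: an effective shift replaces some y by a smaller
  x.\<close>

definition weight :: "nat set set \<Rightarrow> nat" where
  "weight F = (\<Sum>A\<in>F. \<Sum>A)"

lemma weight_compress_le:
  assumes F: "F \<subseteq> nsets {1..m} k" and xy: "x < y"
  shows "weight (compress x y F) \<le> weight F" "compress x y F \<noteq> F \<Longrightarrow> weight (compress x y F) < weight F"
proof -
  have finF: "finite F" using F finite_subset finite_imp_finite_nsets by blast
  have w: "weight (compress x y F) = (\<Sum>A\<in>F. \<Sum>(compress_map x y F A))"
    unfolding weight_def compress_def by (simp add: sum.reindex[OF inj_on_compress_map])
  have less: "\<Sum>(compress_map x y F A) < \<Sum>A" if A: "A \<in> F" "compress_map x y F A \<noteq> A" for A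
  proof (cases rule: compress_map_cases[OF A(1), of x y])
    case 2
    have fin: "finite A" using A F by (auto simp: nsets_def)
    then have "\<Sum>A = y + \<Sum>(A - {y})" using 2 by (simp add: sum.remove)
    moreover have "\<Sum>(insert x (A - {y})) = x + \<Sum>(A - {y})" using 2 fin by simp
    ultimately show ?thesis using 2 xy by simp
  qed (use A in auto)
  then have le: "\<Sum>(compress_map x y F A) \<le> \<Sum>A" if "A \<in> F" for A
    using that by (cases "compress_map x y F A = A") (auto intro: less_imp_le)
  show "weight (compress x y F) \<le> weight F"
    unfolding w unfolding weight_def by (intro sum_mono le)
  assume "compress x y F \<noteq> F"
  then have "\<exists>A\<in>F. compress_map x y F A \<noteq> A" by (auto simp: compress_def)
  then show "weight (compress x y F) < weight F"
    unfolding w unfolding weight_def using finF le less by (intro sum_strict_mono_ex1) auto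
qed

lemma not_shiftedE:
  assumes "\<not> shifted m F"
  obtains x y where "1 \<le> x" "x < y" "y \<le> m" "compress x y F \<noteq> F"
proof -
  obtain A x y where A: "A \<in> F" and xy: "1 \<le> x" "x < y" "y \<le> m" "y \<in> A" "x \<notin> A"
    and new: "insert x (A - {y}) \<notin> F"
    using assms unfolding shifted_def by blast
  have "compress_map x y F A = insert x (A - {y})"
    using xy new by (simp add: compress_map_def shift_set_def)
  then have "insert x (A - {y}) \<in> compress x y F" using A unfolding compress_def by (metis imageI)
  then have "compress x y F \<noteq> F" using new by metis
  with xy(1-3) show thesis by (rule that)
qed

text \<open>Suppose the next shift creates a cover \<open>T\<close> with at most s points. Then
  \<open>insert y T\<close> covers the unshifted family, since the sets that move contain y and the
  others already meet \<open>T\<close>. Its size is exactly s + 1 because the unshifted family has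
  no smaller cover.\<close>

lemma shift_covers:
  fixes s :: nat
  assumes F: "G \<subseteq> nsets {1..n} k"
    and match: "\<not> (\<exists>A. disjoint_family_on A {..s} \<and> (\<forall>i\<in>{..s}. A i \<in> G))"
    and cover: "\<forall>T. T \<subseteq> {1..n} \<longrightarrow> card T \<le> s \<longrightarrow> (\<exists>A\<in>G. T \<inter> A = {})"
  shows "\<exists>G'. card G' = card G \<and> G' \<subseteq> nsets {1..n} k
    \<and> \<not> (\<exists>A. disjoint_family_on A {..s} \<and> (\<forall>i\<in>{..s}. A i \<in> G'))
    \<and> (\<forall>T. T \<subseteq> {1..n} \<longrightarrow> card T \<le> s \<longrightarrow> (\<exists>A\<in>G'. T \<inter> A = {}))
    \<and> (shifted n G' \<or> (\<exists>U\<subseteq>{1..n}. card U = s + 1 \<and> (\<forall>A\<in>G'. U \<inter> A \<noteq> {})))"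
  using assms
proof (induction "weight G" arbitrary: G rule: less_induct)
  case less
  note F = less.prems(1) and match = less.prems(2) and cover = less.prems(3)
  show ?case
  proof (cases "shifted n G")
    case True
    then show ?thesis using less.prems by (intro exI[of _ G]) blast
  next
    case False
    then obtain x y where xy: "1 \<le> x" "x < y" "y \<le> n" "compress x y G \<noteq> G"
      by (rule not_shiftedE)
    let ?G = "compress x y G"
    have sub: "?G \<subseteq> nsets {1..n} k" using F xy by (intro compress_subset_nsets) auto
    have m: "\<not> (\<exists>A. disjoint_family_on A {..s} \<and> (\<forall>i\<in>{..s}. A i \<in> ?G))"
    proof
      assume "\<exists>A. disjoint_family_on A {..s} \<and> (\<forall>i\<in>{..s}. A i \<in> ?G)"
      then obtain A where A: "disjoint_family_on A {..s}" "\<And>i. i \<in> {..s} \<Longrightarrow> A i \<in> compress x y G" by blast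
      from compress_transversal[where H = "\<lambda>_. G", OF A less_imp_neq[OF xy(2)]] show False using match by blast
    qed
    show ?thesis
    proof (cases "\<forall>T. T \<subseteq> {1..n} \<longrightarrow> card T \<le> s \<longrightarrow> (\<exists>A\<in>?G. T \<inter> A = {})")
      case True
      have "weight ?G < weight G" using weight_compress_le(2)[OF F xy(2,4)] .
      from less.hyps[OF this sub m True] show ?thesis by (simp only: card_compress)
    next
      case no: False
      then obtain T where T: "T \<subseteq> {1..n}" "card T \<le> s" "\<forall>A\<in>?G. T \<inter> A \<noteq> {}" by blast
      have finT: "finite T" using T(1) finite_subset by blast
      have "insert y T \<inter> A \<noteq> {}" if A: "A \<in> G" for A
      proof (cases rule: compress_map_cases[OF A, of x y])
        case 1
        then have "A \<in> ?G" using A by (auto simp: compress_def intro: rev_image_eqI)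
        then show ?thesis using T(3) by blast
      qed auto
      moreover have U: "insert y T \<subseteq> {1..n}" using T xy by auto
      moreover have "card (insert y T) = s + 1"
      proof -
        have "\<not> card (insert y T) \<le> s" using cover U calculation(1) by blast
        moreover have "card (insert y T) \<le> Suc (card T)" using finT by (simp add: card_insert_if)
        ultimately show ?thesis using T(2) by simp
      qed
      ultimately show ?thesis using less.prems by (intro exI[of _ G]) blast
    qed
  qed
qed

text \<open>All families are compressed with the same pair at once, as
  \<open>compress_transversal\<close> requires; the total weight drops as soon as one of them
  changes.\<close>

lemma shift_families:
  fixes H :: "nat \<Rightarrow> nat set set"
  assumes "\<And>i. i \<le> s \<Longrightarrow> H i \<subseteq> nsets {1..m} l"
    and "\<not> (\<exists>A. disjoint_family_on A {..s} \<and> (\<forall>i\<in>{..s}. A i \<in> H i))"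
  shows "\<exists>H'. (\<forall>i\<le>s. card (H' i) = card (H i) \<and> H' i \<subseteq> nsets {1..m} l \<and> shifted m (H' i))
    \<and> \<not> (\<exists>A. disjoint_family_on A {..s} \<and> (\<forall>i\<in>{..s}. A i \<in> H' i))"
  using assms
proof (induction "\<Sum>i\<le>s. weight (H i)" arbitrary: H rule: less_induct)
  case less
  show ?case
  proof (cases "\<forall>i\<le>s. shifted m (H i)")
    case True
    then show ?thesis using less.prems by (intro exI[of _ H]) blast
  next
    case False
    then obtain i0 where i0: "i0 \<le> s" "\<not> shifted m (H i0)" by blast
    obtain x y where xy: "1 \<le> x" "x < y" "y \<le> m" "compress x y (H i0) \<noteq> H i0"
      using i0(2) by (rule not_shiftedE)
    let ?H = "\<lambda>i. compress x y (H i)"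
    have "(\<Sum>i\<le>s. weight (?H i)) < (\<Sum>i\<le>s. weight (H i))"
    proof (rule sum_strict_mono_ex1)
      show "\<forall>i\<in>{..s}. weight (?H i) \<le> weight (H i)"
        using weight_compress_le(1)[OF less.prems(1) xy(2)] by simp
      show "\<exists>i\<in>{..s}. weight (?H i) < weight (H i)"
        using weight_compress_le(2)[OF less.prems(1)[OF i0(1)] xy(2,4)] i0(1) by blast
    qed simp
    moreover have "?H i \<subseteq> nsets {1..m} l" if "i \<le> s" for i
      using less.prems(1)[OF that] xy by (intro compress_subset_nsets) auto
    moreover have "\<not> (\<exists>A. disjoint_family_on A {..s} \<and> (\<forall>i\<in>{..s}. A i \<in> ?H i))"
    proof
      assume "\<exists>A. disjoint_family_on A {..s} \<and> (\<forall>i\<in>{..s}. A i \<in> ?H i)"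
      then obtain A where A: "disjoint_family_on A {..s}" "\<And>i. i \<in> {..s} \<Longrightarrow> A i \<in> compress x y (H i)" by blast
      from compress_transversal[where H = H, OF A less_imp_neq[OF xy(2)]] show False using less.prems(2) by blast
    qed
    ultimately have "\<exists>H'. (\<forall>i\<le>s. card (H' i) = card (?H i) \<and> H' i \<subseteq> nsets {1..m} l \<and> shifted m (H' i))
      \<and> \<not> (\<exists>A. disjoint_family_on A {..s} \<and> (\<forall>i\<in>{..s}. A i \<in> H' i))"
      by (rule less.hyps)
    then show ?thesis by (simp add: card_compress)
  qed
qed

text \<open>Families without a disjoint transversal are made into a chain by replacing them with their
  order statistics: the \<open>j\<close>-th new family consists of the sets that lie in at least \<open>s + 1 - j\<close>
  of the old ones.\<close>

lemma chain_of_families: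
  assumes sub: "\<And>i. i \<le> s \<Longrightarrow> H i \<subseteq> nsets {1..m} l" and ne: "\<And>i. i \<le> s \<Longrightarrow> H i \<noteq> {}"
    and dep: "\<not> (\<exists>A. disjoint_family_on A {..s} \<and> (\<forall>i\<in>{..s}. A i \<in> H i))" and l: "1 \<le> l"
  shows "\<exists>K. dependent_chain m l s K \<and> shifted m (K 0) \<and> K 0 \<noteq> {} \<and> (\<Sum>i\<le>s. card (K i)) = (\<Sum>i\<le>s. card (H i))"
proof -
  obtain H' where H': "\<And>i. i \<le> s \<Longrightarrow> card (H' i) = card (H i)" "\<And>i. i \<le> s \<Longrightarrow> H' i \<subseteq> nsets {1..m} l"
    "\<And>i. i \<le> s \<Longrightarrow> shifted m (H' i)" "\<not> (\<exists>A. disjoint_family_on A {..s} \<and> (\<forall>i\<in>{..s}. A i \<in> H' i))"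
    using shift_families[OF sub dep] by blast
  let ?N = "nsets {1..m} l"
  have finN: "finite ?N" by (simp add: finite_imp_finite_nsets)
  define c where "c A = card {i \<in> {..s}. A \<in> H' i}" for A
  define K where "K j = {A \<in> ?N. s + 1 \<le> c A + j}" for j
  have c_le: "c A \<le> s + 1" for A
  proof -
    have "c A \<le> card {..s}" unfolding c_def by (intro card_mono) auto
    then show ?thesis by simp
  qed
  \<comment> \<open>Being the intersection of the families, \<open>K 0\<close> is shifted, and it
    contains {1..l} like each of them.\<close>
  have K0: "A \<in> K 0 \<longleftrightarrow> (\<forall>i\<le>s. A \<in> H' i)" for A
  proof
    assume A: "A \<in> K 0"
    have "{i \<in> {..s}. A \<in> H' i} = {..s}"
      using A by (intro card_seteq) (auto simp: K_def c_def)
    then show "\<forall>i\<le>s. A \<in> H' i" by auto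
  next
    assume A: "\<forall>i\<le>s. A \<in> H' i"
    then have "{i \<in> {..s}. A \<in> H' i} = {..s}" by auto
    then have "c A = s + 1" by (simp add: c_def)
    moreover have "A \<in> ?N" using A H'(2)[of 0] by auto
    ultimately show "A \<in> K 0" by (simp add: K_def)
  qed
  have "{1..l} \<in> H' i" if i: "i \<le> s" for i
  proof (rule shifted_initial_segment[OF H'(3)[OF i] H'(2)[OF i]])
    have "finite (H i)" using sub[OF i] finN finite_subset by blast
    then have "card (H' i) \<noteq> 0" using ne[OF i] H'(1)[OF i] by simp
    then show "H' i \<noteq> {}" by auto
  qed
  then have "{1..l} \<in> K 0" using K0 by blast
  moreover have "shifted m (K 0)"
    unfolding shifted_def
  proof (intro ballI allI impI)
    fix A x y assume A: "A \<in> K 0" and xy: "1 \<le> x" "x < y" "y \<le> m" "y \<in> A" "x \<notin> A"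
    have "insert x (A - {y}) \<in> H' i" if "i \<le> s" for i
      using A that by (intro shiftedD[OF H'(3)[OF that] _ xy]) (simp add: K0)
    then show "insert x (A - {y}) \<in> K 0" by (simp add: K0)
  qed
  moreover have "dependent_chain m l s K"
  proof
    show "1 \<le> l" by (rule l)
    show "K i \<subseteq> ?N" if "i \<le> s" for i by (auto simp: K_def)
    show "K i \<subseteq> K j" if "i \<le> j" "j \<le> s" for i j using that by (auto simp: K_def)
    fix A assume disj: "disjoint_family_on A {..s}" and A: "\<And>i. i \<le> s \<Longrightarrow> A i \<in> K i"
    \<comment> \<open>A member of \<open>K (s - j)\<close> lies in at least j + 1 of the old
      families, so greedy choice assigns distinct old indices to the blocks. Inverting this
      assignment gives a transversal of the old families.\<close>
    have "finite {i \<in> {..s}. A (s - j) \<in> H' i} \<and> j < card {i \<in> {..s}. A (s - j) \<in> H' i}" if "j < s + 1" for j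
      using A[of "s - j"] that by (auto simp: K_def c_def)
    from greedy_sdr[of "s + 1", OF this]
    obtain a where a: "inj_on a {..<s + 1}" "\<forall>j<s + 1. a j \<in> {i \<in> {..s}. A (s - j) \<in> H' i}" by blast
    have eq: "{..<s + 1} = {..s}" by auto
    have "a ` {..s} \<subseteq> {..s}" using a(2) by auto
    then have bij: "bij_betw a {..s} {..s}"
      using a(1) unfolding eq by (simp add: bij_betw_def endo_inj_surj)
    define b where "b = the_inv_into {..s} a"
    have b: "bij_betw b {..s} {..s}" unfolding b_def using bij by (rule bij_betw_the_inv_into)
    have ab: "a (b i) = i" "b i \<le> s" if "i \<le> s" for i
      using f_the_inv_into_f_bij_betw[OF bij, of i] b that by (auto simp: b_def bij_betw_def)
    have "A (s - b i) \<in> H' i" if i: "i \<le> s" for i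
    proof -
      have "b i < s + 1" using ab(2)[OF i] by simp
      then have "a (b i) \<in> {k \<in> {..s}. A (s - b i) \<in> H' k}" using a(2) by blast
      then show ?thesis unfolding ab(1)[OF i] by blast
    qed
    moreover have "disjoint_family_on (\<lambda>i. A (s - b i)) {..s}"
      unfolding disjoint_family_on_def
    proof (intro ballI impI)
      fix i j assume ij: "i \<in> {..s}" "j \<in> {..s}" "i \<noteq> j"
      then have "b i \<noteq> b j" "b i \<le> s" "b j \<le> s" using ab by (metis atMost_iff)+
      then have "s - b i \<noteq> s - b j" by linarith
      then show "A (s - b i) \<inter> A (s - b j) = {}" using disj by (auto simp: disjoint_family_on_def)
    qed
    ultimately show False using H'(4) by blast
  qed
  \<comment> \<open>Both sides count each set \<open>A\<close> exactly \<open>c A\<close>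
    times.\<close>
  moreover have "(\<Sum>i\<le>s. card (K i)) = (\<Sum>i\<le>s. card (H i))"
  proof -
    have "(\<Sum>i\<le>s. card (K i)) = (\<Sum>i\<in>{..s}. card {A \<in> ?N. s + 1 \<le> c A + i})" by (simp add: K_def)
    also have "\<dots> = (\<Sum>A\<in>?N. card {i \<in> {..s}. s + 1 \<le> c A + i})"
      by (rule sum_multicount_gen[symmetric]) (auto intro: finite_imp_finite_nsets)
    also have "\<dots> = (\<Sum>A\<in>?N. c A)"
    proof (rule sum.cong[OF refl])
      fix A
      have "{i \<in> {..s}. s + 1 \<le> c A + i} = {s + 1 - c A..s}" by auto
      then show "card {i \<in> {..s}. s + 1 \<le> c A + i} = c A" using c_le[of A] by simp
    qed
    also have "\<dots> = (\<Sum>i\<in>{..s}. card {A \<in> ?N. A \<in> H' i})"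
      unfolding c_def by (rule sum_multicount_gen) (auto intro: finite_imp_finite_nsets)
    also have "\<dots> = (\<Sum>i\<le>s. card (H i))"
    proof (rule sum.cong[OF refl])
      fix i assume "i \<in> {..s}"
      then have "{A \<in> ?N. A \<in> H' i} = H' i" using H'(2)[of i] by auto
      then show "card {A \<in> ?N. A \<in> H' i} = card (H i)" using H'(1)[of i] \<open>i \<in> {..s}\<close> by simp
    qed
    finally show ?thesis .
  qed
  ultimately show ?thesis by blast
qed

section \<open>Counting a family through the links of the special points\<close>

lemma card_le_links:
  assumes u: "inj_on u {..s}" "u ` {..s} \<subseteq> {1..n}" and h: "bij_betw h {1..m} ({1..n} - u ` {..s})"
    and G: "G \<subseteq> nsets {1..n} (Suc l)"
    and H: "\<And>i. i \<le> s \<Longrightarrow> H i = {B \<in> nsets {1..m} l. insert (u i) (h ` B) \<in> G}"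
    and \<G>: "\<G> = {B \<in> nsets {1..m} (Suc l). h ` B \<in> G}"
  shows "real (card G) \<le> real (n choose Suc l) - (real s + 1) * real (m choose l) - real (m choose Suc l)
    + real (\<Sum>i\<le>s. card (H i)) + real (card \<G>)"
proof -
  let ?N = "nsets {1..m} l" and ?N' = "nsets {1..m} (Suc l)" and ?U = "u ` {..s}"
  \<comment> \<open>Non-members are counted: missing links give sets meeting the special points
    exactly once, and sets missing from \<open>\<G>\<close> give sets avoiding them. All sets with
    two or more special points are granted to \<open>G\<close>.\<close>
  define P where "P = (SIGMA i:{..s}. ?N - H i)"
  define f where "f = (\<lambda>(i, B). insert (u i) (h ` B))"
  have finN: "finite (nsets {1..m} k)" "finite (nsets {1..n} k)" for k
    by (simp_all add: finite_imp_finite_nsets)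
  have inj_h: "inj_on h {1..m}" and im_h: "h ` {1..m} = {1..n} - ?U" using h by (auto simp: bij_betw_def)
  have hB: "h ` B \<subseteq> {1..n}" "h ` B \<inter> ?U = {}" "card (h ` B) = card B" "finite (h ` B)"
    if "B \<in> nsets {1..m} k" for B k
  proof -
    have B: "B \<subseteq> {1..m}" "finite B" using that by (auto simp: nsets_def)
    then have "h ` B \<subseteq> h ` {1..m}" by blast
    then show "h ` B \<subseteq> {1..n}" "h ` B \<inter> ?U = {}" unfolding im_h by auto
    show "card (h ` B) = card B" using inj_h B(1) by (metis card_image inj_on_subset)
    show "finite (h ` B)" using B by simp
  qed
  have h_eq: "B = B'" if "h ` B = h ` B'" "B \<in> nsets {1..m} k" "B' \<in> nsets {1..m} k'" for B B' k k'
    using inj_on_image_eq_iff[OF inj_h, of B B'] that by (auto simp: nsets_def)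
  have f_U: "f (i, B) \<inter> ?U = {u i}" "f (i, B) - ?U = h ` B" if "i \<le> s" "B \<in> ?N" for i B
    using hB[OF that(2)] that(1) by (auto simp: f_def)
  have inj_f: "inj_on f P"
  proof (rule inj_onI)
    fix p p' assume p: "p \<in> P" "p' \<in> P" "f p = f p'"
    obtain i B i' B' where e: "p = (i, B)" "p' = (i', B')" by (cases p, cases p')
    have iB: "i \<le> s" "B \<in> ?N" "i' \<le> s" "B' \<in> ?N" using p e by (auto simp: P_def)
    have "u i = u i'" "h ` B = h ` B'"
      using f_U[OF iB(1,2)] f_U[OF iB(3,4)] p(3) e by auto
    moreover from this have "i = i'" using inj_onD[OF u(1)] iB by simp
    moreover have "B = B'" using h_eq[OF \<open>h ` B = h ` B'\<close> iB(2,4)] .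
    ultimately show "p = p'" using e by simp
  qed
  have f_sub: "f ` P \<subseteq> nsets {1..n} (Suc l) - G"
  proof
    fix X assume "X \<in> f ` P"
    then obtain i B where X: "i \<le> s" "B \<in> ?N" "B \<notin> H i" "X = insert (u i) (h ` B)"
      by (auto simp: P_def f_def)
    then have "u i \<notin> h ` B" using hB(2)[OF X(2)] by blast
    then have "X \<in> nsets {1..n} (Suc l)"
      using X hB[OF X(2)] u(2) by (auto simp: nsets_def)
    moreover have "X \<notin> G" using X H by auto
    ultimately show "X \<in> nsets {1..n} (Suc l) - G" by blast
  qed
  have h_sub: "(`) h ` (?N' - \<G>) \<subseteq> nsets {1..n} (Suc l) - G"
  proof
    fix X assume "X \<in> (`) h ` (?N' - \<G>)"
    then obtain B where B: "B \<in> ?N'" "B \<notin> \<G>" "X = h ` B" by auto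
    then show "X \<in> nsets {1..n} (Suc l) - G" using hB[OF B(1)] \<G> by (auto simp: nsets_def)
  qed
  have inj_h': "inj_on ((`) h) (?N' - \<G>)" 
  proof (rule inj_onI)
    fix B B' assume "B \<in> ?N' - \<G>" "B' \<in> ?N' - \<G>" "h ` B = h ` B'"
    then show "B = B'" using h_eq[of B B' "Suc l" "Suc l"] by simp
  qed
  have disj: "f ` P \<inter> (`) h ` (?N' - \<G>) = {}"
  proof (rule ccontr)
    assume "f ` P \<inter> (`) h ` (?N' - \<G>) \<noteq> {}"
    then obtain i B B' where X: "i \<le> s" "B \<in> ?N" "B' \<in> ?N'" "f (i, B) = h ` B'" by (auto simp: P_def)
    then show False using f_U(1)[OF X(1,2)] hB(2)[OF X(3)] by auto
  qed
  have finP: "finite P" unfolding P_def using finN by auto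
  have "card (f ` P \<union> (`) h ` (?N' - \<G>)) = card P + card (?N' - \<G>)"
    using finP finN disj inj_f inj_h' by (subst card_Un_disjoint) (auto simp: card_image)
  moreover have "card (f ` P \<union> (`) h ` (?N' - \<G>)) \<le> card (nsets {1..n} (Suc l) - G)"
    using f_sub h_sub finN by (intro card_mono) auto
  moreover have "real (card (nsets {1..n} (Suc l) - G)) = real (n choose Suc l) - real (card G)"
    using card_nsets_Diff[OF _ G] by (simp del: binomial_Suc_Suc)
  moreover have "real (card (?N' - \<G>)) = real (m choose Suc l) - real (card \<G>)"
    using card_nsets_Diff[of "{1..m}" \<G> "Suc l"] by (simp add: \<G> Collect_restrict del: binomial_Suc_Suc)
  moreover have "real (card P) = (real s + 1) * real (m choose l) - real (\<Sum>i\<le>s. card (H i))"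
  proof -
    have "card P = (\<Sum>i\<le>s. card (?N - H i))" unfolding P_def using finN by (intro card_SigmaI) auto
    also have "real \<dots> = (\<Sum>i\<le>s. real (m choose l) - real (card (H i)))"
      unfolding of_nat_sum
    proof (rule sum.cong[OF refl])
      fix i assume "i \<in> {..s}"
      then have sub: "H i \<subseteq> ?N" using H by auto
      then show "real (card (?N - H i)) = real (m choose l) - real (card (H i))"
        using card_nsets_Diff[of "{1..m}" "H i" l] by simp
    qed
    finally show ?thesis by (simp add: sum_subtractf)
  qed
  ultimately show ?thesis by linarith
qed

lemma links_dependent:
  assumes u: "inj_on u {..s}" and h: "bij_betw h {1..m} ({1..n} - u ` {..s})"
    and match: "\<not> (\<exists>A. disjoint_family_on A {..s} \<and> (\<forall>i\<in>{..s}. A i \<in> G))"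
  shows "\<not> (\<exists>A. disjoint_family_on A {..s} \<and> (\<forall>i\<in>{..s}. A i \<in> {B \<in> nsets {1..m} l. insert (u i) (h ` B) \<in> G}))"
proof
  assume "\<exists>A. disjoint_family_on A {..s} \<and> (\<forall>i\<in>{..s}. A i \<in> {B \<in> nsets {1..m} l. insert (u i) (h ` B) \<in> G})"
  then obtain A where A: "disjoint_family_on A {..s}" "\<And>i. i \<le> s \<Longrightarrow> A i \<subseteq> {1..m}"
    "\<And>i. i \<le> s \<Longrightarrow> insert (u i) (h ` A i) \<in> G" by (auto simp: nsets_def)
  have inj_h: "inj_on h {1..m}" and im_h: "h ` {1..m} = {1..n} - u ` {..s}" using h by (auto simp: bij_betw_def)
  have "disjoint_family_on (\<lambda>i. insert (u i) (h ` A i)) {..s}"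
    unfolding disjoint_family_on_def
  proof (intro ballI impI)
    fix i j assume ij: "i \<in> {..s}" "j \<in> {..s}" "i \<noteq> j"
    have "h ` A i \<subseteq> h ` {1..m}" "h ` A j \<subseteq> h ` {1..m}" using A(2) ij by blast+
    then have "u i \<notin> h ` A j" "u j \<notin> h ` A i" unfolding im_h using ij by blast+
    moreover have "u i \<noteq> u j" using u ij by (auto simp: inj_on_def)
    moreover have "h ` A i \<inter> h ` A j = {}"
      using inj_on_image_Int[OF inj_h, of "A i" "A j"] A(1,2) ij by (auto simp: disjoint_family_on_def)
    ultimately show "insert (u i) (h ` A i) \<inter> insert (u j) (h ` A j) = {}" by auto
  qed
  then show False using match A(3) by auto
qed

lemma (in dependent_chain) sum_card_le_of_total_missing:
  assumes "real ((m - l) choose l) - 1 + real (card (H 0)) + c \<le> total_missing"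
  shows "real (\<Sum>i\<le>s. card (H i)) + c \<le> real s * real (m choose l) - real ((m - l) choose l) + 1"
proof -
  have "{..s} = insert 0 {1..s}" by auto
  then have "real (\<Sum>i\<le>s. card (H i)) = real (card (H 0)) + (\<Sum>i\<in>{1..s}. real (card (H i)))" by simp
  then show ?thesis using assms total_missing_eq by linarith
qed

lemma card_le_of_no_cover:
  fixes l s t n m :: nat
  assumes l: "2 \<le> l" and n: "n = m + s + 1"
    and t: "t * l \<le> m" "m < (t + 1) * l" "s + 25 \<le> t" "2 * s + 2 \<le> t" "1 \<le> s"
    and regime: "3 * s + 2 \<le> t \<or> (146 \<le> t \<and> real s + 1 \<le>
        ((real t - 1) * (1 - 1 / (real t - 2 * real s - 1)) - (real s + 1)) * (1 - 2 / (real t - 1)))"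
    and G: "G \<subseteq> nsets {1..n} (Suc l)"
    and match: "\<not> (\<exists>A. disjoint_family_on A {..s} \<and> (\<forall>i\<in>{..s}. A i \<in> G))"
    and cover: "\<And>T. T \<subseteq> {1..n} \<Longrightarrow> card T \<le> s \<Longrightarrow> \<exists>A\<in>G. T \<inter> A = {}"
  shows "real (card G) \<le> real (n choose Suc l) - real ((n - s) choose Suc l) + 1 - real ((n - s - Suc l) choose l)"
proof -
  have "26 * l \<le> t * l" using t by (intro mult_le_mono1) simp
  then have m26: "26 * l \<le> m" using t(1) by (rule le_trans)
  obtain G' where G': "card G' = card G" "G' \<subseteq> nsets {1..n} (Suc l)"
    "\<not> (\<exists>A. disjoint_family_on A {..s} \<and> (\<forall>i\<in>{..s}. A i \<in> G'))"
    "\<And>T. T \<subseteq> {1..n} \<Longrightarrow> card T \<le> s \<Longrightarrow> \<exists>A\<in>G'. T \<inter> A = {}"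
    "shifted n G' \<or> (\<exists>U\<subseteq>{1..n}. card U = s + 1 \<and> (\<forall>A\<in>G'. U \<inter> A \<noteq> {}))"
  proof -
    have "\<forall>T. T \<subseteq> {1..n} \<longrightarrow> card T \<le> s \<longrightarrow> (\<exists>A\<in>G. T \<inter> A = {})" using cover by blast
    from shift_covers[OF G match this] show thesis
      by (elim exE conjE) (rule that, assumption+, simp, assumption)
  qed
  have "\<exists>u h. inj_on u {..s} \<and> u ` {..s} \<subseteq> {1..n} \<and> bij_betw h {1..m} ({1..n} - u ` {..s}) \<and>
      real (\<Sum>i\<le>s. card {B \<in> nsets {1..m} l. insert (u i) (h ` B) \<in> G'})
        + real (card {B \<in> nsets {1..m} (Suc l). h ` B \<in> G'})
      \<le> real s * real (m choose l) - real ((m - l) choose l) + 1"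
    using G'(5)
  proof
    assume sh: "shifted n G'"
    \<comment> \<open>\<open>u\<close> is decreasing so that \<open>H 0\<close> belongs to s + 1,
      the last special point; shiftedness makes its link the smallest.\<close>
    define u h where "u i = s + 1 - i" and "h b = b + (s + 1)" for i b :: nat
    have u: "inj_on u {..s}" by (auto simp: inj_on_def u_def)
    have im_u: "u ` {..s} = {1..s + 1}"
    proof
      show "{1..s + 1} \<subseteq> u ` {..s}"
      proof
        fix x assume "x \<in> {1..s + 1}"
        then have "x = u (s + 1 - x)" "s + 1 - x \<in> {..s}" by (auto simp: u_def)
        then show "x \<in> u ` {..s}" by blast
      qed
    qed (auto simp: u_def)
    have im_h: "h ` {a..b} = {a + (s + 1)..b + (s + 1)}" for a b
      unfolding h_def by (rule image_add_atLeastAtMost')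
    have inj_h: "inj h" by (auto simp: inj_on_def h_def)
    have "h ` {1..m} = {1..n} - u ` {..s}" unfolding im_h im_u using n by auto
    then have h: "bij_betw h {1..m} ({1..n} - u ` {..s})"
      using inj_h by (auto simp: bij_betw_def intro: inj_on_subset)
    define H where "H i = {B \<in> nsets {1..m} l. insert (u i) (h ` B) \<in> G'}" for i
    define \<G> where "\<G> = {B \<in> nsets {1..m} (Suc l). h ` B \<in> G'}"
    have u_h: "u i \<notin> h ` B" if "B \<subseteq> {1..m}" for i B
    proof
      assume "u i \<in> h ` B"
      then obtain b where b: "b \<in> B" "u i = h b" by blast
      then have "1 \<le> b" using that by auto
      then show False using b(2) by (simp add: u_def h_def)
    qed
    have hn: "h b \<le> n" "s + 1 < h b" if "b \<in> {1..m}" for b using that n by (auto simp: h_def)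
    have hm: "h x \<in> h ` B \<longleftrightarrow> x \<in> B" for x B using inj_h by (simp add: inj_image_mem_iff)
    have mono: "H i \<subseteq> H j" if ij: "i \<le> j" "j \<le> s" for i j
    proof (cases "i = j")
      case False
      show ?thesis
      proof
        fix B assume B: "B \<in> H i"
        then have Bs: "B \<subseteq> {1..m}" "B \<in> nsets {1..m} l" by (auto simp: H_def nsets_def)
        have "insert (u j) (insert (u i) (h ` B) - {u i}) \<in> G'"
        proof (rule shiftedD[OF sh])
          show "insert (u i) (h ` B) \<in> G'" using B by (simp add: H_def)
          show "u j \<notin> insert (u i) (h ` B)" using u_h[OF Bs(1)] ij False by (auto simp: u_def)
        qed (use ij False n in \<open>auto simp: u_def\<close>)
        moreover have "insert (u i) (h ` B) - {u i} = h ` B" using u_h[OF Bs(1)] by auto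
        ultimately show "B \<in> H j" using Bs by (simp add: H_def)
      qed
    qed simp
    interpret dependent_chain m l s H
    proof
      show "1 \<le> l" using l by simp
      show "H i \<subseteq> nsets {1..m} l" for i by (auto simp: H_def)
      show "H i \<subseteq> H j" if "i \<le> j" "j \<le> s" for i j using mono that .
      show False if "disjoint_family_on A {..s}" "\<And>i. i \<le> s \<Longrightarrow> A i \<in> H i" for A
        using links_dependent[OF u h G'(3), of l] that by (auto simp: H_def)
    qed
    have "shifted m (H 0)"
      unfolding shifted_def
    proof (intro ballI allI impI)
      fix B x y assume B: "B \<in> H 0" and xy: "1 \<le> x" "x < y" "y \<le> m" "y \<in> B" "x \<notin> B"
      have Bs: "B \<subseteq> {1..m}" "finite B" "card B = l" using B by (auto simp: H_def nsets_def)
      have ne: "u 0 \<noteq> h x" "u 0 \<noteq> h y" using xy by (auto simp: u_def h_def)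
      have "insert (h x) (insert (u 0) (h ` B) - {h y}) \<in> G'"
      proof (rule shiftedD[OF sh])
        show "insert (u 0) (h ` B) \<in> G'" using B by (simp add: H_def)
        show "h x \<notin> insert (u 0) (h ` B)" using ne xy hm by auto
      qed (use xy hm n in \<open>auto simp: h_def\<close>)
      moreover have "insert (h x) (insert (u 0) (h ` B) - {h y}) = insert (u 0) (h ` insert x (B - {y}))"
        using ne inj_h by (auto simp: image_set_diff)
      moreover have "insert x (B - {y}) \<in> nsets {1..m} l"
      proof -
        have "card (insert x (B - {y})) = Suc (card (B - {y}))" using Bs xy by simp
        also have "\<dots> = card B" using Bs(2) xy(4) by (rule card_Suc_Diff1)
        finally show ?thesis using Bs xy by (auto simp: nsets_def)
      qed
      ultimately show "insert x (B - {y}) \<in> H 0" by (simp add: H_def)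
    qed
    moreover have "H 0 \<noteq> {}"
    proof -
      \<comment> \<open>As {1..s} is no cover, some member avoids it, and shifting that member to
        the left yields {s + 1..s + l + 1}.\<close>
      have "{1..s} \<subseteq> {1..n}" "card {1..s} \<le> s" using n by auto
      then obtain A where A: "A \<in> G'" "{1..s} \<inter> A = {}" using G'(4) by blast
      have As: "A \<subseteq> {1..n}" "finite A" "card A = Suc l" using A G'(2) by (auto simp: nsets_def)
      have "{s + 1..s + Suc l} \<in> G'"
      proof (rule shifted_dominates[OF sh G'(2) A(1)])
        show "{s + 1..s + Suc l} \<in> nsets {1..n} (Suc l)" using n m26 l by (auto simp: nsets_def)
        fix i
        have "A \<inter> {1..i} \<subseteq> {s + 1..i}"
        proof
          fix x assume "x \<in> A \<inter> {1..i}"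
          moreover from this have "x \<notin> {1..s}" using A(2) by blast
          ultimately show "x \<in> {s + 1..i}" by auto
        qed
        then have "card (A \<inter> {1..i}) \<le> card {s + 1..i}" by (intro card_mono) auto
        moreover have "card (A \<inter> {1..i}) \<le> Suc l" using As card_mono[of A "A \<inter> {1..i}"] by auto
        moreover have "{s + 1..s + Suc l} \<inter> {1..i} = {s + 1..min (s + Suc l) i}" by auto
        ultimately show "card (A \<inter> {1..i}) \<le> card ({s + 1..s + Suc l} \<inter> {1..i})" by simp
      qed
      moreover have "insert (u 0) (h ` {1..l}) = {s + 1..s + Suc l}" unfolding im_h by (auto simp: u_def)
      moreover have "{1..l} \<in> nsets {1..m} l" using m26 by (auto simp: nsets_def)
      ultimately have "{1..l} \<in> H 0" by (simp add: H_def)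
      then show ?thesis by blast
    qed
    moreover have "\<G> \<subseteq> nsets {1..m} (Suc l)" by (auto simp: \<G>_def)
    moreover have "A - {x} \<in> H 0" if A: "A \<in> \<G>" and x: "x \<in> A" for A x
    proof -
      have As: "A \<subseteq> {1..m}" "finite A" "card A = Suc l" "h ` A \<in> G'" using A by (auto simp: \<G>_def nsets_def)
      have xm: "x \<in> {1..m}" using As x by blast
      have "insert (u 0) (h ` A - {h x}) \<in> G'"
      proof (rule shiftedD[OF sh As(4)])
        show "u 0 < h x" "h x \<le> n" using hn[OF xm] by (auto simp: u_def)
        show "u 0 \<notin> h ` A" using u_h[OF As(1)] .
      qed (use x in \<open>auto simp: u_def\<close>)
      moreover have "h ` A - {h x} = h ` (A - {x})" using inj_h by (auto simp: image_set_diff)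
      moreover have "A - {x} \<in> nsets {1..m} l" using As x by (auto simp: nsets_def)
      ultimately show ?thesis by (simp add: H_def)
    qed
    ultimately have "real ((m - l) choose l) - 1 + real (card (H 0)) + real (card \<G>) \<le> total_missing"
      by (rule chain_bound[OF l t regime])
    note sum_le = sum_card_le_of_total_missing[OF this]
    show ?thesis
    proof (rule exI[of _ u], rule exI[of _ h], intro conjI)
      show "u ` {..s} \<subseteq> {1..n}" using n unfolding im_u by simp
    qed (use sum_le u h in \<open>simp_all only: H_def \<G>_def\<close>)
  next
    assume "\<exists>U\<subseteq>{1..n}. card U = s + 1 \<and> (\<forall>A\<in>G'. U \<inter> A \<noteq> {})"
    then obtain U where U: "U \<subseteq> {1..n}" "card U = s + 1" "\<And>A. A \<in> G' \<Longrightarrow> U \<inter> A \<noteq> {}" by blast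
    have finU: "finite U" using U(1) finite_subset by blast
    obtain u where u: "bij_betw u {..s} U"
      using finite_same_card_bij[of "{..s}" U] finU U(2) by auto
    have im_u: "u ` {..s} = U" and inj_u: "inj_on u {..s}" using u by (auto simp: bij_betw_def)
    have "card ({1..n} - U) = m" using U n finU by (simp add: card_Diff_subset)
    then obtain h where h: "bij_betw h {1..m} ({1..n} - U)"
      using finite_same_card_bij[of "{1..m}" "{1..n} - U"] by auto
    have inj_h: "inj_on h {1..m}" and im_h: "h ` {1..m} = {1..n} - U" using h by (auto simp: bij_betw_def)
    define H where "H i = {B \<in> nsets {1..m} l. insert (u i) (h ` B) \<in> G'}" for i
    have none: "{B \<in> nsets {1..m} (Suc l). h ` B \<in> G'} = {}"
    proof (rule ccontr)
      assume "\<not> ?thesis"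
      then obtain B where B: "B \<subseteq> {1..m}" "h ` B \<in> G'" by (auto simp: nsets_def)
      then have "h ` B \<subseteq> {1..n} - U" using im_h by blast
      then show False using U(3)[OF B(2)] by blast
    qed
    have ne: "H i \<noteq> {}" if i: "i \<le> s" for i
    proof -
      have ui: "u i \<in> U" using im_u i by blast
      \<comment> \<open>Without \<open>u i\<close> only s points of the cover remain, so some member
        misses them and meets \<open>U\<close> in \<open>u i\<close> alone.\<close>
      have "U - {u i} \<subseteq> {1..n}" "card (U - {u i}) \<le> s" using U ui finU by auto
      then obtain A where A: "A \<in> G'" "(U - {u i}) \<inter> A = {}" using G'(4) by blast
      have uA: "u i \<in> A" using U(3)[OF A(1)] A(2) by blast
      have As: "A \<subseteq> {1..n}" "finite A" "card A = Suc l" using A G'(2) by (auto simp: nsets_def)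
      define B where "B = {b \<in> {1..m}. h b \<in> A}"
      have hB: "h ` B = A - {u i}"
      proof
        have "h ` B \<subseteq> h ` {1..m}" by (auto simp: B_def)
        then have "u i \<notin> h ` B" unfolding im_h using ui by blast
        moreover have "h ` B \<subseteq> A" by (auto simp: B_def)
        ultimately show "h ` B \<subseteq> A - {u i}" by blast
        show "A - {u i} \<subseteq> h ` B"
        proof
          fix a assume a: "a \<in> A - {u i}"
          then have "a \<in> h ` {1..m}" unfolding im_h using As A(2) by blast
          then show "a \<in> h ` B" using a by (auto simp: B_def)
        qed
      qed
      have "inj_on h B" using inj_h by (rule inj_on_subset) (auto simp: B_def)
      then have "card B = card (h ` B)" by (simp add: card_image)
      also have "\<dots> = l" unfolding hB using uA As by simp
      finally have "B \<in> nsets {1..m} l" by (auto simp: B_def nsets_def)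
      moreover have "insert (u i) (h ` B) = A" unfolding hB using uA by blast
      ultimately have "B \<in> H i" using A(1) by (simp add: H_def)
      then show ?thesis by blast
    qed
    have h': "bij_betw h {1..m} ({1..n} - u ` {..s})" using h by (simp only: im_u)
    have dep: "\<not> (\<exists>A. disjoint_family_on A {..s} \<and> (\<forall>i\<in>{..s}. A i \<in> H i))"
      unfolding H_def by (rule links_dependent[OF inj_u h' G'(3)])
    obtain K where K: "dependent_chain m l s K" "shifted m (K 0)" "K 0 \<noteq> {}"
      "(\<Sum>i\<le>s. card (K i)) = (\<Sum>i\<le>s. card (H i))"
      using chain_of_families[of s H m l] ne dep l by (auto simp: H_def)
    interpret dependent_chain m l s K by (rule K(1))
    \<comment> \<open>Every member meets \<open>U\<close>, so the empty family plays the role of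
      \<open>\<G>\<close> and the order statistics owe no shadow condition.\<close>
    have "real ((m - l) choose l) - 1 + real (card (K 0)) + real (card ({} :: nat set set)) \<le> total_missing"
      by (rule chain_bound[OF l t regime K(2,3)]) auto
    note sum_le = sum_card_le_of_total_missing[OF this, unfolded K(4)]
    show ?thesis
    proof (rule exI[of _ u], rule exI[of _ h], intro conjI)
      show "u ` {..s} \<subseteq> {1..n}" using U(1) im_u by simp
    qed (use sum_le inj_u h' in \<open>simp_all only: none H_def\<close>)
  qed
  then obtain u h where uh: "inj_on u {..s}" "u ` {..s} \<subseteq> {1..n}" "bij_betw h {1..m} ({1..n} - u ` {..s})"
    and sum: "real (\<Sum>i\<le>s. card {B \<in> nsets {1..m} l. insert (u i) (h ` B) \<in> G'})
        + real (card {B \<in> nsets {1..m} (Suc l). h ` B \<in> G'})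
      \<le> real s * real (m choose l) - real ((m - l) choose l) + 1" by blast
  have "real (card G') \<le> real (n choose Suc l) - (real s + 1) * real (m choose l) - real (m choose Suc l)
    + real (\<Sum>i\<le>s. card {B \<in> nsets {1..m} l. insert (u i) (h ` B) \<in> G'})
    + real (card {B \<in> nsets {1..m} (Suc l). h ` B \<in> G'})"
    by (rule card_le_links[OF uh G'(2)]) auto
  \<comment> \<open>Pascal's rule with n - s = m + 1: one of the s + 1 copies of
    \<open>m choose l\<close> survives and joins \<open>m choose Suc l\<close>.\<close>
  moreover have "real ((n - s) choose Suc l) = real (m choose l) + real (m choose Suc l)"
    using n by simp
  moreover have "n - s - Suc l = m - l" using n by simp
  ultimately show ?thesis using sum G'(1) by (simp add: algebra_simps del: binomial_Suc_Suc)
qed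

section \<open>The size of the extremal family and the two ranges of n\<close>

lemma card_HM_family:
  assumes "1 \<le> k" "1 \<le> s" "s + k \<le> n"
  shows "real (card (HM_family k n s))
    = real (n choose k) - real ((n - s) choose k) + 1 - real ((n - s - k) choose (k - 1))"
proof -
  define A where "A = {H \<in> nsets {1..n} k. H \<inter> {1..s} \<noteq> {}}"
  define S where "S = {s + 1..s + k}"
  define D where "D = {H \<in> nsets {1..n} k. H \<inter> {1..s} = {s} \<and> H \<inter> S = {}}"
  have fin: "finite (nsets {1..n} k)" by (simp add: finite_imp_finite_nsets)
  have finA: "finite A" "finite D" using fin by (auto simp: A_def D_def)
  have "nsets {1..n} k - A = nsets {s + 1..n} k"
  proof
    show "nsets {1..n} k - A \<subseteq> nsets {s + 1..n} k"
    proof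
      fix H assume "H \<in> nsets {1..n} k - A"
      then have "H \<subseteq> {1..n}" "H \<inter> {1..s} = {}" "finite H" "card H = k" by (auto simp: A_def nsets_def)
      moreover from this have "H \<subseteq> {s + 1..n}" by fastforce
      ultimately show "H \<in> nsets {s + 1..n} k" by (simp add: nsets_def)
    qed
  qed (auto simp: A_def nsets_def)
  then have "card (nsets {1..n} k - A) = (n - s) choose k" by (simp add: card_nsets)
  moreover have "A \<subseteq> nsets {1..n} k" by (auto simp: A_def)
  ultimately have cA: "real (card A) = real (n choose k) - real ((n - s) choose k)"
    using card_nsets_Diff[of "{1..n}" A k] by simp
  have "D = insert s ` nsets {s + k + 1..n} (k - 1)"
  proof
    show "D \<subseteq> insert s ` nsets {s + k + 1..n} (k - 1)"
    proof
      fix H assume "H \<in> D"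
      then have H: "H \<subseteq> {1..n}" "finite H" "card H = k" "H \<inter> {1..s} = {s}" "H \<inter> S = {}"
        by (auto simp: D_def nsets_def)
      have s: "s \<in> H" using H(4) by blast
      have "H - {s} \<subseteq> {s + k + 1..n}"
      proof
        fix x assume x: "x \<in> H - {s}"
        then have "x \<notin> {1..s}" "x \<notin> S" "1 \<le> x" "x \<le> n" using H by auto
        then show "x \<in> {s + k + 1..n}" by (auto simp: S_def)
      qed
      then have "H - {s} \<in> nsets {s + k + 1..n} (k - 1)" using H s by (auto simp: nsets_def)
      moreover have "H = insert s (H - {s})" using s by blast
      ultimately show "H \<in> insert s ` nsets {s + k + 1..n} (k - 1)" by blast
    qed
    show "insert s ` nsets {s + k + 1..n} (k - 1) \<subseteq> D"
    proof
      fix H assume "H \<in> insert s ` nsets {s + k + 1..n} (k - 1)"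
      then obtain B where B: "H = insert s B" "B \<subseteq> {s + k + 1..n}" "finite B" "card B = k - 1"
        by (auto simp: nsets_def)
      have sB: "s \<notin> B" using B(2) by auto
      have "card H = k" using B sB assms(1) by simp
      moreover have "H \<subseteq> {1..n}" using B assms by auto
      moreover have "H \<inter> {1..s} = {s}" "H \<inter> S = {}" using B assms by (auto simp: S_def)
      ultimately show "H \<in> D" using B by (auto simp: D_def nsets_def)
    qed
  qed
  moreover have "inj_on (insert s) (nsets {s + k + 1..n} (k - 1))"
  proof (rule inj_onI)
    fix B B' assume "B \<in> nsets {s + k + 1..n} (k - 1)" "B' \<in> nsets {s + k + 1..n} (k - 1)" "insert s B = insert s B'"
    moreover from this have "s \<notin> B" "s \<notin> B'" by (auto simp: nsets_def)
    ultimately show "B = B'" by (metis insert_ident)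
  qed
  ultimately have cD: "card D = (n - s - k) choose (k - 1)"
    by (simp add: card_image card_nsets)
  have DA: "D \<subseteq> A" using assms by (auto simp: A_def D_def)
  have "S \<notin> A" by (auto simp: A_def S_def)
  have "HM_family k n s = (A \<union> {S}) - D" by (simp add: HM_family_def A_def S_def D_def)
  also have "card \<dots> = card (A \<union> {S}) - card D" using finA DA by (intro card_Diff_subset) auto
  also have "card (A \<union> {S}) = card A + 1" using finA \<open>S \<notin> A\<close> by simp
  finally have "card (HM_family k n s) = card A + 1 - card D" .
  moreover have "card D \<le> card A" using finA DA by (intro card_mono) auto
  ultimately show ?thesis using cA cD by (simp add: of_nat_diff)
qed

text \<open>Put w = t - 2 s - 1. The factor 1 - 1 / w costs about 2 s / w, which the surplus w has
  to absorb, so w must be of order sqrt(s); this is the source of an error term of order 1 /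
  sqrt(s). With 30 sqrt(s) the first factor is at least s + 3, and (s + 3) (1 - 1 / s) >= s +
  1.\<close>

lemma asymptotic_regime_arith:
  assumes s: "891 \<le> s" and t: "2 * real s + 30 * sqrt (real s) - 1 \<le> real t"
  shows "146 \<le> t" "s + 25 \<le> t" "2 * s + 2 \<le> t"
    "real s + 1 \<le> ((real t - 1) * (1 - 1 / (real t - 2 * real s - 1)) - (real s + 1)) * (1 - 2 / (real t - 1))"
proof -
  define q where "q = sqrt (real s)"
  have q2: "q * q = real s" by (simp add: q_def)
  have q: "29 \<le> q" unfolding q_def by (rule real_le_rsqrt) (use s in simp)
  have rs: "891 \<le> real s" using s by simp
  have t': "2 * real s + 30 * q - 1 \<le> real t" using t by (simp add: q_def)
  then have "2 * real s + 869 \<le> real t" using q by linarith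
  then show "146 \<le> t" "s + 25 \<le> t" "2 * s + 2 \<le> t" by linarith+
  define Y w where "Y = real t - 1" and "w = real t - 2 * real s - 1"
  have w: "30 * q - 2 \<le> w" using t' by (simp add: w_def)
  have w0: "0 < w" using w q by linarith
  have Yw: "Y = 2 * real s + w" by (simp add: Y_def w_def)
  have Y: "2 * real s \<le> Y" "0 < Y" using w0 rs Yw by auto
  have "2 * q \<le> w" using w q by linarith
  then have "q * (2 * q) \<le> q * w" using q by (intro mult_left_mono) auto
  then have "2 * real s / w \<le> q" using w0 q2 by (simp add: divide_le_eq)
  moreover have "Y * (1 - 1 / w) = Y - 1 - 2 * real s / w" using w0 by (simp add: Yw field_simps)
  ultimately have "Y - 1 - q \<le> Y * (1 - 1 / w)" by linarith
  then have big: "real s + 3 \<le> Y * (1 - 1 / w) - (real s + 1)" using w q Yw by linarith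
  have "2 / Y \<le> 1 / real s" using Y rs by (simp add: field_simps)
  moreover have "1 / real s \<le> 1" using rs by simp
  ultimately have "(real s + 3) * (1 - 1 / real s) \<le> (Y * (1 - 1 / w) - (real s + 1)) * (1 - 2 / Y)"
    using big rs by (intro mult_mono) linarith+
  moreover have "real s + 1 \<le> (real s + 3) * (1 - 1 / real s)" using rs by (simp add: field_simps)
  ultimately show "real s + 1 \<le> ((real t - 1) * (1 - 1 / (real t - 2 * real s - 1)) - (real s + 1)) * (1 - 2 / (real t - 1))"
    unfolding Y_def w_def by linarith
qed

text \<open>In this range s + 2 <= 30 sqrt(s), so the second hypothesis on n implies the one with
  the maximum. The value 299/10 is an upper bound for sqrt(890).\<close>

lemma small_regime_arith:
  assumes "1 \<le> s" "s \<le> 890"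
  shows "real (s + max 25 (2 * s + 2)) \<le> (2 + 30 / sqrt (real s)) * real s"
proof -
  define q where "q = sqrt (real s)"
  have q2: "q * q = real s" by (simp add: q_def)
  have q1: "1 \<le> q" unfolding q_def by (rule real_le_rsqrt) (use assms in simp)
  have "q \<le> 299 / 10" unfolding q_def by (rule real_le_lsqrt) (use assms in \<open>simp_all add: power2_eq_square\<close>)
  then have "0 \<le> (q - 1) * (299 / 10 - q)" using q1 by (intro mult_nonneg_nonneg) auto
  then have "q * q + 2 \<le> 30 * q" using \<open>q \<le> 299 / 10\<close> by (simp add: field_simps)
  then have "real s + 2 \<le> 30 * q" "25 \<le> real s + 30 * q" using q1 q2 by auto
  moreover have "(2 + 30 / q) * real s = 2 * real s + 30 * q" unfolding q2[symmetric] using q1 by (simp add: field_simps)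
  ultimately show ?thesis unfolding q_def[symmetric] by (simp add: max_def)
qed

theorem theorem3:
  "\<exists>\<epsilon> :: nat \<Rightarrow> real. (\<forall>s. 0 \<le> \<epsilon> s) \<and> \<epsilon> \<longlonglongrightarrow> 0 \<and>
     (\<forall>(k::nat) (s::nat) (n::nat).
        3 \<le> k \<longrightarrow> 1 \<le> s \<longrightarrow>
        (s + max 25 (2 * s + 2)) * k \<le> n \<or> (2 + \<epsilon> s) * real s * real k \<le> real n \<longrightarrow>
        (\<forall>G \<subseteq> nsets {1..n} k.
           matching_number G = s \<longrightarrow> s < covering_number n G \<longrightarrow>
           card G \<le> card (HM_family k n s) \<and>
           int (card G) \<le> int (n choose k) - int ((n - s) choose k) + 1
                              - int ((n - s - k) choose (k - 1))))"
proof (intro exI[of _ "\<lambda>s. 30 / sqrt (real s)"] conjI allI impI)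
  show "0 \<le> 30 / sqrt (real s)" for s by simp
  have "filterlim (\<lambda>s. sqrt (real s)) at_infinity sequentially"
    by (intro filterlim_at_top_imp_at_infinity filterlim_compose[OF sqrt_at_top] filterlim_real_sequentially)
  then show "(\<lambda>s. 30 / sqrt (real s)) \<longlonglongrightarrow> 0" by (intro tendsto_divide_0[OF tendsto_const])
  fix k s n :: nat and G :: "nat set set"
  assume k: "3 \<le> k" and s: "1 \<le> s"
    and n: "(s + max 25 (2 * s + 2)) * k \<le> n \<or> (2 + 30 / sqrt (real s)) * real s * real k \<le> real n"
    and G: "G \<subseteq> nsets {1..n} k" and \<nu>: "matching_number G = s" and \<tau>: "s < covering_number n G"
  define l where "l = k - 1"
  have kl: "k = Suc l" "2 \<le> l" using k by (auto simp: l_def)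
  have finG: "finite G" using G finite_subset finite_imp_finite_nsets by blast
  have match: "\<not> (\<exists>A. disjoint_family_on A {..s} \<and> (\<forall>i\<in>{..s}. A i \<in> G))"
  proof
    assume "\<exists>A. disjoint_family_on A {..s} \<and> (\<forall>i\<in>{..s}. A i \<in> G)"
    then obtain A where A: "disjoint_family_on A {..s}" "\<And>i. i \<in> {..s} \<Longrightarrow> A i \<in> G" by blast
    have "A i \<noteq> {}" if "i \<in> {..s}" for i using A(2)[OF that] G k by (auto simp: nsets_def)
    with A(1) have "inj_on A {..s}" by (rule disjoint_family_on_imp_inj_on)
    then have "card (A ` {..s}) = s + 1" by (simp add: card_image)
    moreover have "pairwise disjnt (A ` {..s})" using A(1) by (rule disjoint_family_on_imp_pairwise_disjnt)
    ultimately have "s + 1 \<in> {card M | M. M \<subseteq> G \<and> finite M \<and> pairwise disjnt M}"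
      using A(2) by (intro CollectI exI[of _ "A ` {..s}"]) auto
    moreover have "finite {card M | M. M \<subseteq> G \<and> finite M \<and> pairwise disjnt M}"
      by (rule finite_subset[of _ "card ` Pow G"]) (use finG in auto)
    ultimately have "s + 1 \<le> matching_number G" unfolding matching_number_def by (intro Max_ge)
    then show False using \<nu> by simp
  qed
  have cover: "\<exists>A\<in>G. T \<inter> A = {}" if "T \<subseteq> {1..n}" "card T \<le> s" for T
  proof (rule ccontr)
    assume "\<not> ?thesis"
    then have "covering_number n G \<le> card T"
      unfolding covering_number_def using that by (intro Least_le) blast
    then show False using that \<tau> by simp
  qed
  define m where "m = n - s - 1"
  define t where "t = m div l"
  \<comment> \<open>\<open>t\<close> is the number of disjoint l-blocks that fit beside the s + 1
    special points; each hypothesis on n is turned into a lower bound on \<open>t\<close>.\<close>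
  have main: "s + k \<le> n \<and> n = m + s + 1 \<and> s + 25 \<le> t \<and> 2 * s + 2 \<le> t \<and> (3 * s + 2 \<le> t \<or> (146 \<le> t \<and> real s + 1 \<le>
        ((real t - 1) * (1 - 1 / (real t - 2 * real s - 1)) - (real s + 1)) * (1 - 2 / (real t - 1))))"
  proof (cases "(s + max 25 (2 * s + 2)) * k \<le> n")
    case True
    define T where "T = s + max 25 (2 * s + 2)"
    \<comment> \<open>Of the T k points, T pay for the s + 1 special ones, so m >= T l and hence t
      >= T.\<close>
    have T: "T * l + T \<le> n" using True by (simp add: T_def kl)
    have Ts: "s + 25 \<le> T" "3 * s + 2 \<le> T" by (auto simp: T_def)
    have "2 * l \<le> T * l" using Ts by (intro mult_le_mono1) simp
    then have nn: "s + k \<le> n" "s + 1 \<le> n" "T * l \<le> m" using T Ts kl unfolding m_def by linarith+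
    then have "T \<le> t" unfolding t_def using kl by (simp add: less_eq_div_iff_mult_less_eq)
    then show ?thesis using nn Ts by (auto simp: m_def)
  next
    case False
    then have n': "(2 + 30 / sqrt (real s)) * real s * real k \<le> real n" using n by blast
    \<comment> \<open>For smaller s the second hypothesis would imply the first, which is excluded
      in this case.\<close>
    have s891: "891 \<le> s"
    proof (rule ccontr)
      assume "\<not> 891 \<le> s"
      then have "real (s + max 25 (2 * s + 2)) * real k \<le> (2 + 30 / sqrt (real s)) * real s * real k"
        using small_regime_arith[OF s] by (intro mult_right_mono) auto
      then have "real ((s + max 25 (2 * s + 2)) * k) \<le> real n" using n' by (simp only: of_nat_mult)
      then show False using False by (simp only: of_nat_le_iff)
    qed
    define X where "X = 2 * real s + 30 * sqrt (real s)"
    have "30 / sqrt (real s) * real s = 30 * sqrt (real s)"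
      using s by (simp add: field_simps)
    then have "X * real k \<le> real n" using n' by (simp add: X_def distrib_right)
    then have Xn: "X * real l + X \<le> real n" by (simp add: kl algebra_simps)
    have Xs: "2 * real s \<le> X" by (simp add: X_def)
    have "2 * real s * real l \<le> X * real l" using Xs by (intro mult_right_mono) auto
    moreover have "1 * real l \<le> (2 * real s) * real l" using s by (intro mult_right_mono) auto
    ultimately have nn: "real s + real l + 1 \<le> real n" using Xn Xs s by linarith
    then have nm: "n = m + s + 1" "s + k \<le> n" unfolding m_def kl(1) by linarith+
    have "X * real l \<le> real m" using Xn Xs s nm(1) by (simp add: algebra_simps)
    also have "m < (t + 1) * l"
      unfolding t_def using kl(2) dividend_less_times_div[of l m] by (simp add: algebra_simps)
    then have "real m < (real t + 1) * real l" by (metis of_nat_1 of_nat_add of_nat_less_iff of_nat_mult)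
    finally have "X < real t + 1" using kl(2) by (simp add: mult_less_cancel_right)
    then have "2 * real s + 30 * sqrt (real s) - 1 \<le> real t" by (simp add: X_def)
    from asymptotic_regime_arith[OF s891 this] nm show ?thesis by blast
  qed
  have tl: "t * l \<le> m" "m < (t + 1) * l"
    unfolding t_def using kl(2) dividend_less_times_div[of l m] by (simp_all add: algebra_simps)
  have "real (card G) \<le> real (n choose Suc l) - real ((n - s) choose Suc l) + 1 - real ((n - s - Suc l) choose l)"
    using main tl s kl G match cover by (intro card_le_of_no_cover[of l n m s t]) auto
  then have bound: "real (card G) \<le> real (n choose k) - real ((n - s) choose k) + 1 - real ((n - s - k) choose (k - 1))"
    by (simp only: kl(1) diff_Suc_1)
  then show "card G \<le> card (HM_family k n s)"
    using card_HM_family[of k s n] main s k by simp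
  have "real_of_int (int (card G)) \<le> real_of_int (int (n choose k) - int ((n - s) choose k) + 1
      - int ((n - s - k) choose (k - 1)))" using bound by simp
  then show "int (card G) \<le> int (n choose k) - int ((n - s) choose k) + 1 - int ((n - s - k) choose (k - 1))"
    by (simp only: of_int_le_iff)
qed

end
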